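(* Let $\Phi$ be an irreducible reduced root system of rank $\ell$, let $j\in J\setminus\{0\}$ and $\omega=\omega_j$. Then the type of the root system $\Phi_{\mathrm{re}}^\omega=\{\beta^\omega:\beta\in\Phi,\ \beta^\omega\neq0\}$ is as follows. \begin{itemize} \item $\Phi$ of type $A_\ell$ ($\ell\ge1$) and $\gcd\{\ell+1,j\}=1$: $\Phi_{\mathrm{re}}^\omega=\varnothing$. \item $\Phi$ of type $A_\ell$ and $g=\gcd\{\ell+1,j\}\neq1$: type $A_{g-1}$. \item $\Phi$ of type $B_2$, $j=1$: type $A_1$. \item $\Phi$ of type $B_\ell$ ($\ell\ge3$), $j=1$: type $B_{\ell-1}$. \item $\Phi$ of type $C_\ell$ ($\ell\ge3$ odd), $j=\ell$: type $BC_{(\ell-1)/2}$. \item $\Phi$ of type $C_\ell$ ($\ell\ge4$ even), $j=\ell$: type $C_{\ell/2}$. \item $\Phi$ of type $D_\ell$ ($\ell\ge4$), $j=1$: type $B_{\ell-2}$. \item $\Phi$ of type $D_\ell$ ($\ell\ge4$ even), $j\in\{\ell-1,\ell\}$: type $C_{\ell/2}$. \item $\Phi$ of type $D_\ell$ ($\ell\ge5$ odd), $j\in\{\ell-1,\ell\}$: type $BC_{(\ell-3)/2}$. \item $\Phi$ of type $E_6$, $j\in\{1,6\}$: type $G_2$. \item $\Phi$ of type $E_7$, $j=7$: type $F_4$. \end{itemize}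
   Context: Root systems are finite, not containing $0$, spanning the ambient Euclidean space, stable under reflections and with integral Cartan numbers, but not necessarily reduced; the empty set is a root system in $\{0\}$. Type $BC_r$ denotes the irreducible non-reduced root system of rank $r$ (unique up to isomorphism); $C_2$ means $B_2$. Setting: $\Phi$ is an irreducible reduced root system in a Euclidean space $E$ with basis $\Delta=\{\alpha_1,\dots,\alpha_\ell\}$ (simple roots numbered as in Bourbaki), Weyl group $W$ and highest root $\tilde\alpha=\sum_{i=1}^\ell n_i\alpha_i$. Put $\alpha_0=-\tilde\alpha$, $n_0=1$, $I=\{0,\dots,\ell\}$, $J=\{i\in I:n_i=1\}$. ($J=\{0\}$ for types $E_8,F_4,G_2$; in all other types $J\setminus\{0\}$ is: $\{1,\dots,\ell\}$ for $A_\ell$, $\{1\}$ for $B_\ell$, $\{\ell\}$ for $C_\ell$, $\{1,\ell-1,\ell\}$ for $D_\ell$, $\{1,6\}$ for $E_6$, $\{7\}$ for $E_7$.) For $j\in J$ let $w_j$ be the longest element of the subgroup of $W$ generated by the reflections $s_{\alpha_i}$, $i\in\{1,\dots,\ell\}\setminus\{j\}$ (so $w_0$ is the longest element of $W$), and $\omega_j=w_jw_0\in W$. For $\omega=\omega_j$ of order $o(\omega)$ and $x\in E$ put $x^\omega=\frac1{o(\omega)}\sum_{t=1}^{o(\omega)}\omega^t(x)$; it lies in $E^\omega=\{x\in E:\omega(x)=x\}$, and $\Phi_{\mathrm{re}}^\omega$ is regarded as a root system in $E^\omega$. *)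

theory Defs
  imports "HOL-Analysis.Analysis"
begin

definition reflection :: "'a::euclidean_space \<Rightarrow> 'a \<Rightarrow> 'a" where
  "reflection a x = x - (2 * (x \<bullet> a) / (a \<bullet> a)) *\<^sub>R a"

text \<open>The Cartan number of the pair \<open>(a, b)\<close> in Bourbaki's convention:
  \<open>a\<close> paired with the coroot of \<open>b\<close>.\<close>

definition cartan_number :: "'a::euclidean_space \<Rightarrow> 'a \<Rightarrow> real" where
  "cartan_number a b = 2 * (a \<bullet> b) / (b \<bullet> b)"

text \<open>\<open>R\<close> is a root system, not necessarily reduced, in the linear subspace \<open>V\<close> of the ambient
  Euclidean space. The condition \<open>span R = V\<close> forces \<open>V\<close> to be a subspace; the empty set is a
  root system in \<open>{0}\<close>.\<close>

definition root_system :: "'a::euclidean_space set \<Rightarrow> 'a set \<Rightarrow> bool" where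
  "root_system V R \<longleftrightarrow>
     finite R \<and> 0 \<notin> R \<and> span R = V \<and>
     (\<forall>a\<in>R. \<forall>b\<in>R. reflection a b \<in> R) \<and>
     (\<forall>a\<in>R. \<forall>b\<in>R. cartan_number a b \<in> \<int>)"

definition reduced_rs :: "'a::euclidean_space set \<Rightarrow> bool" where
  "reduced_rs R \<longleftrightarrow> (\<forall>a\<in>R. \<forall>c. c *\<^sub>R a \<in> R \<longrightarrow> c = 1 \<or> c = -1)"

definition irreducible_rs :: "'a::euclidean_space set \<Rightarrow> bool" where
  "irreducible_rs R \<longleftrightarrow>
     R \<noteq> {} \<and>
     \<not> (\<exists>R1 R2. R1 \<noteq> {} \<and> R2 \<noteq> {} \<and> R1 \<union> R2 = R \<and> (\<forall>a\<in>R1. \<forall>b\<in>R2. a \<bullet> b = 0))"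

text \<open>Simple roots are numbered \<open>\<alpha> 1, \<dots>, \<alpha> l\<close>; other values of \<open>\<alpha>\<close> are irrelevant.\<close>

definition root_basis :: "'a::euclidean_space set \<Rightarrow> 'a set \<Rightarrow> nat \<Rightarrow> (nat \<Rightarrow> 'a) \<Rightarrow> bool" where
  "root_basis V R l \<alpha> \<longleftrightarrow>
     \<alpha> ` {1..l} \<subseteq> R \<and> inj_on \<alpha> {1..l} \<and>
     independent (\<alpha> ` {1..l}) \<and> span (\<alpha> ` {1..l}) = V \<and>
     (\<forall>\<beta>\<in>R. \<exists>c :: nat \<Rightarrow> nat.
        \<beta> = (\<Sum>i=1..l. real (c i) *\<^sub>R \<alpha> i) \<or> \<beta> = - (\<Sum>i=1..l. real (c i) *\<^sub>R \<alpha> i))"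

definition highest_root :: "'a::euclidean_space set \<Rightarrow> nat \<Rightarrow> (nat \<Rightarrow> 'a) \<Rightarrow> 'a \<Rightarrow> bool" where
  "highest_root R l \<alpha> \<theta> \<longleftrightarrow>
     \<theta> \<in> R \<and> (\<forall>\<beta>\<in>R. \<exists>c :: nat \<Rightarrow> nat. \<theta> - \<beta> = (\<Sum>i=1..l. real (c i) *\<^sub>R \<alpha> i))"

datatype dynkin =
  Type_A nat | Type_B nat | Type_C nat | Type_D nat | Type_E nat | Type_F4 | Type_G2

fun dynkin_rank :: "dynkin \<Rightarrow> nat" where
  "dynkin_rank (Type_A l) = l"
| "dynkin_rank (Type_B l) = l"
| "dynkin_rank (Type_C l) = l"
| "dynkin_rank (Type_D l) = l"
| "dynkin_rank (Type_E l) = l"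
| "dynkin_rank Type_F4 = 4"
| "dynkin_rank Type_G2 = 2"

text \<open>The Cartan matrix of a simply laced Dynkin diagram, each edge being listed in one of its
  two orientations.\<close>

definition simply_laced :: "(nat \<Rightarrow> nat \<Rightarrow> bool) \<Rightarrow> nat \<Rightarrow> nat \<Rightarrow> int" where
  "simply_laced edge i j = (if i = j then 2 else if edge i j \<or> edge j i then -1 else 0)"

abbreviation chain :: "nat \<Rightarrow> nat \<Rightarrow> int" where
  "chain \<equiv> simply_laced (\<lambda>i j. j = i + 1)"

text \<open>Entries for \<open>1 \<le> i, j \<le> l\<close> of the Cartan matrices with Bourbaki's numbering; the
  \<open>(i, j)\<close> entry is the Cartan number of \<open>(\<alpha> i, \<alpha> j)\<close>. Thus \<open>\<alpha> l\<close> is the short simple root in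
  type \<open>B\<close> and the long one in type \<open>C\<close>, \<open>\<alpha> 3\<close> and \<open>\<alpha> 4\<close> are short in type \<open>F4\<close>, and \<open>\<alpha> 1\<close> is
  short in type \<open>G2\<close>. In type \<open>E\<close> the diagram is the chain 1, 3, 4, \dots, l with 2 attached
  to 4.\<close>

fun cartan_matrix :: "dynkin \<Rightarrow> nat \<Rightarrow> nat \<Rightarrow> int" where
  "cartan_matrix (Type_A l) i j = chain i j"
| "cartan_matrix (Type_B l) i j = (if i + 1 = l \<and> j = l then -2 else chain i j)"
| "cartan_matrix (Type_C l) i j = (if i = l \<and> j + 1 = l then -2 else chain i j)"
| "cartan_matrix (Type_D l) i j =
     simply_laced (\<lambda>i j. j = i + 1 \<and> j < l \<or> i + 2 = l \<and> j = l) i j"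
| "cartan_matrix (Type_E l) i j =
     simply_laced (\<lambda>i j. i = 1 \<and> j = 3 \<or> i = 2 \<and> j = 4 \<or> 3 \<le> i \<and> j = i + 1) i j"
| "cartan_matrix Type_F4 i j = (if i = 2 \<and> j = 3 then -2 else chain i j)"
| "cartan_matrix Type_G2 i j = (if i = 2 \<and> j = 1 then -3 else chain i j)"

definition bourbaki_basis ::
    "'a::euclidean_space set \<Rightarrow> 'a set \<Rightarrow> dynkin \<Rightarrow> (nat \<Rightarrow> 'a) \<Rightarrow> bool" where
  "bourbaki_basis V R X \<alpha> \<longleftrightarrow>
     root_basis V R (dynkin_rank X) \<alpha> \<and>
     (\<forall>i\<in>{1..dynkin_rank X}. \<forall>j\<in>{1..dynkin_rank X}.
        cartan_number (\<alpha> i) (\<alpha> j) = of_int (cartan_matrix X i j))"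

definition has_type :: "'a::euclidean_space set \<Rightarrow> 'a set \<Rightarrow> dynkin \<Rightarrow> bool" where
  "has_type V R X \<longleftrightarrow> root_system V R \<and> reduced_rs R \<and> (\<exists>\<alpha>. bourbaki_basis V R X \<alpha>)"

definition has_type_BC :: "'a::euclidean_space set \<Rightarrow> 'a set \<Rightarrow> nat \<Rightarrow> bool" where
  "has_type_BC V R r \<longleftrightarrow> root_system V R \<and> irreducible_rs R \<and> \<not> reduced_rs R \<and> dim V = r"

text \<open>Since \<open>has_type\<close> allows any numbering, type \<open>C\<close> of rank 2 is the same as type \<open>B\<close> of
  rank 2: the two Cartan matrices differ by exchanging the indices 1 and 2.\<close>

lemma cartan_matrix_C2:
  assumes "i \<in> {1, 2}" and "j \<in> {1, 2}"
  shows "cartan_matrix (Type_C 2) i j = cartan_matrix (Type_B 2) (3 - i) (3 - j)"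
proof -
  have "i = 1 \<or> i = 2" and "j = 1 \<or> j = 2"
    using assms by auto
  then show ?thesis
    by (elim disjE; simp add: simply_laced_def)
qed

definition refl_word :: "(nat \<Rightarrow> 'a::euclidean_space) \<Rightarrow> nat list \<Rightarrow> 'a \<Rightarrow> 'a" where
  "refl_word \<alpha> is = foldr (\<lambda>i f. reflection (\<alpha> i) \<circ> f) is id"

text \<open>The group generated by the reflections in the \<open>\<alpha> i\<close> with \<open>i \<in> S\<close>. Reflections are
  involutions, so no inverses are needed.\<close>

definition refl_group :: "(nat \<Rightarrow> 'a::euclidean_space) \<Rightarrow> nat set \<Rightarrow> ('a \<Rightarrow> 'a) set" where
  "refl_group \<alpha> S = {refl_word \<alpha> is | is. set is \<subseteq> S}"

definition refl_length :: "(nat \<Rightarrow> 'a::euclidean_space) \<Rightarrow> nat set \<Rightarrow> ('a \<Rightarrow> 'a) \<Rightarrow> nat" where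
  "refl_length \<alpha> S w = (LEAST n. \<exists>is. set is \<subseteq> S \<and> length is = n \<and> refl_word \<alpha> is = w)"

definition longest_element :: "(nat \<Rightarrow> 'a::euclidean_space) \<Rightarrow> nat set \<Rightarrow> 'a \<Rightarrow> 'a" where
  "longest_element \<alpha> S =
     (THE w. w \<in> refl_group \<alpha> S \<and>
        (\<forall>v\<in>refl_group \<alpha> S. refl_length \<alpha> S v \<le> refl_length \<alpha> S w))"

definition w_elt :: "nat \<Rightarrow> (nat \<Rightarrow> 'a::euclidean_space) \<Rightarrow> nat \<Rightarrow> 'a \<Rightarrow> 'a" where
  "w_elt l \<alpha> j = longest_element \<alpha> ({1..l} - {j})"

definition omega_elt :: "nat \<Rightarrow> (nat \<Rightarrow> 'a::euclidean_space) \<Rightarrow> nat \<Rightarrow> 'a \<Rightarrow> 'a" where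
  "omega_elt l \<alpha> j = w_elt l \<alpha> j \<circ> w_elt l \<alpha> 0"

definition map_order :: "('a \<Rightarrow> 'a) \<Rightarrow> nat" where
  "map_order f = (LEAST k. 0 < k \<and> f ^^ k = id)"

definition average :: "('a::euclidean_space \<Rightarrow> 'a) \<Rightarrow> 'a \<Rightarrow> 'a" where
  "average \<omega> x = (1 / real (map_order \<omega>)) *\<^sub>R (\<Sum>t=1..map_order \<omega>. (\<omega> ^^ t) x)"

definition fixed_space :: "('a \<Rightarrow> 'a) \<Rightarrow> 'a set" where
  "fixed_space \<omega> = {x. \<omega> x = x}"

definition Phi_re :: "('a::euclidean_space \<Rightarrow> 'a) \<Rightarrow> 'a set \<Rightarrow> 'a set" where
  "Phi_re \<omega> \<Phi> = {average \<omega> \<beta> | \<beta>. \<beta> \<in> \<Phi> \<and> average \<omega> \<beta> \<noteq> 0}"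

end

theory Submission
  imports Defs
begin

text \<open>The longest element of a parabolic subgroup is its only element sending all simple roots of the
  parabolic to negative roots. In the classical types the Weyl group acts by (signed) permutations of
  vectors \<open>e 1, e 2, \<dots>\<close> that are reconstructed from the Cartan matrix, and comparing heights of the
  images of the \<open>e i\<close> determines \<open>w_j\<close> and \<open>w_0\<close> as order-reversing signed permutations; in type \<open>D\<close>
  the remaining sign is fixed by the action on weights modulo roots. Hence \<open>\<omega>_j\<close> is a rotation in type
  \<open>A\<close>, and up to signs the identity or the reversal of the \<open>e i\<close> in the other classical types, and
  averaging sends every \<open>e i\<close> to \<open>0\<close> or, up to sign, to a member of a smaller family of the same kind. In
  types \<open>E6\<close> and \<open>E7\<close> explicit words for \<open>w_j\<close> and \<open>w_0\<close> and the lists of positive roots reduce the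
  claim to integer computations. Since the average is a projection onto the fixed space, the averaged
  roots always span it.\<close>

section \<open>Reflection groups and longest elements\<close>

declare One_nat_def [simp del]

lemma reflection_0 [simp]: "reflection a 0 = 0"
  by (simp add: reflection_def)

lemma reflection_self [simp]: "reflection a a = - a"
  by (cases "a = 0") (simp_all add: reflection_def scaleR_2)

lemma linear_reflection: "linear (reflection a)"
  by (rule linearI) (simp_all add: reflection_def inner_add_left algebra_simps add_divide_distrib)

lemma reflection_add: "reflection a (x + y) = reflection a x + reflection a y"
  by (rule linear_add[OF linear_reflection])

lemma reflection_diff: "reflection a (x - y) = reflection a x - reflection a y"
  by (rule linear_diff[OF linear_reflection])

lemma reflection_minus: "reflection a (- x) = - reflection a x"
  by (rule linear_neg[OF linear_reflection])

lemma reflection_scaleR: "reflection a (c *\<^sub>R x) = c *\<^sub>R reflection a x"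
  by (rule linear_cmul[OF linear_reflection])

lemma reflection_eq_cartan: "reflection a x = x - cartan_number x a *\<^sub>R a"
  by (simp add: reflection_def cartan_number_def)

lemma reflection_inner: "reflection a x \<bullet> reflection a y = x \<bullet> y"
proof (cases "a = 0")
  case False
  then have "a \<bullet> a \<noteq> 0" by simp
  then show ?thesis
    by (simp add: reflection_def inner_diff_left inner_diff_right inner_commute field_simps)
qed (simp add: reflection_def)

lemma reflection_invol [simp]: "reflection a (reflection a x) = x"
  by (cases "a = 0") (simp_all add: reflection_def inner_diff_left algebra_simps)

lemma refl_word_Nil [simp]: "refl_word \<alpha> [] = id"
  by (simp add: refl_word_def)

lemma refl_word_Cons: "refl_word \<alpha> (i # is) = reflection (\<alpha> i) \<circ> refl_word \<alpha> is"
  by (simp add: refl_word_def)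

lemma refl_word_append: "refl_word \<alpha> (is @ js) = refl_word \<alpha> is \<circ> refl_word \<alpha> js"
  by (induction "is") (simp_all add: refl_word_Cons o_assoc)

lemma linear_refl_word: "linear (refl_word \<alpha> is)"
proof (induction "is")
  case Nil
  show ?case by (simp add: linear_iff)
next
  case (Cons i "is")
  then show ?case
    unfolding refl_word_Cons by (rule linear_compose[OF _ linear_reflection])
qed

lemma refl_word_inner: "refl_word \<alpha> is x \<bullet> refl_word \<alpha> is y = x \<bullet> y"
  by (induction "is") (simp_all add: refl_word_Cons reflection_inner)

lemma refl_word_rev: "refl_word \<alpha> (rev is) (refl_word \<alpha> is x) = x"
  by (induction "is" arbitrary: x) (simp_all add: refl_word_Cons refl_word_append)

lemma refl_word_rev': "refl_word \<alpha> is (refl_word \<alpha> (rev is) x) = x"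
  using refl_word_rev[of \<alpha> "rev is"] by simp

lemma refl_word_reindex: "refl_word (\<lambda>i. \<alpha> (\<pi> i)) is = refl_word \<alpha> (map \<pi> is)"
  by (induction "is") (simp_all add: refl_word_Cons)

lemma inner_refl_word: "refl_word \<alpha> is x \<bullet> y = x \<bullet> refl_word \<alpha> (rev is) y"
  using refl_word_inner[of \<alpha> "is" x "refl_word \<alpha> (rev is) y"] by (simp add: refl_word_rev')

lemma reflection_isometry:
  assumes "linear u" and "\<And>x y. u x \<bullet> u y = x \<bullet> y"
  shows "reflection (u a) (u x) = u (reflection a x)"
  by (simp add: reflection_def assms linear_diff linear_cmul)

lemma reflection_refl_word:
  "reflection (refl_word \<alpha> is a) x = refl_word \<alpha> is (reflection a (refl_word \<alpha> (rev is) x))"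
  using reflection_isometry[OF linear_refl_word refl_word_inner, of \<alpha> "is" a "refl_word \<alpha> (rev is) x"]
  by (simp add: refl_word_rev')

lemma cartan_number_refl_word:
  "cartan_number x (refl_word \<alpha> is a) = cartan_number (refl_word \<alpha> (rev is) x) a"
  using inner_refl_word[of \<alpha> "rev is" x a]
  by (simp add: cartan_number_def refl_word_inner)

lemma refl_group_iff: "w \<in> refl_group \<alpha> S \<longleftrightarrow> (\<exists>is. set is \<subseteq> S \<and> w = refl_word \<alpha> is)"
  by (auto simp: refl_group_def)

lemma refl_group_mono: "S \<subseteq> T \<Longrightarrow> refl_group \<alpha> S \<subseteq> refl_group \<alpha> T"
  unfolding refl_group_def by blast

lemma refl_group_fixes:
  assumes "w \<in> refl_group \<alpha> S" "\<And>i. i \<in> S \<Longrightarrow> x \<bullet> \<alpha> i = 0"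
  shows "w x = x"
proof -
  obtain "is" where "set is \<subseteq> S" "w = refl_word \<alpha> is" using assms by (auto simp: refl_group_iff)
  moreover have "set is \<subseteq> S \<Longrightarrow> refl_word \<alpha> is x = x" for "is"
    by (induction "is") (auto simp: refl_word_Cons reflection_def assms(2))
  ultimately show ?thesis by blast
qed

inductive_set orb :: "(nat \<Rightarrow> 'a::euclidean_space) \<Rightarrow> nat \<Rightarrow> 'a set" for \<alpha> r where
  orb_simple: "i \<in> {1..r} \<Longrightarrow> \<alpha> i \<in> orb \<alpha> r"
| orb_reflection: "x \<in> orb \<alpha> r \<Longrightarrow> i \<in> {1..r} \<Longrightarrow> reflection (\<alpha> i) x \<in> orb \<alpha> r"

lemma orb_word:
  assumes "x \<in> orb \<alpha> r"
  obtains "is" i where "set is \<subseteq> {1..r}" "i \<in> {1..r}" "x = refl_word \<alpha> is (\<alpha> i)"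
proof -
  have "\<exists>is i. set is \<subseteq> {1..r} \<and> i \<in> {1..r} \<and> x = refl_word \<alpha> is (\<alpha> i)"
    using assms
  proof induction
    case (orb_simple i)
    then show ?case by (intro exI[of _ "[]"] exI[of _ i]) simp
  next
    case (orb_reflection x k)
    then obtain "is" i where *: "set is \<subseteq> {1..r}" "i \<in> {1..r}" "x = refl_word \<alpha> is (\<alpha> i)"
      by blast
    then show ?case
      using orb_reflection by (intro exI[of _ "k # is"] exI[of _ i]) (simp add: refl_word_Cons)
  qed
  with that show ?thesis by blast
qed

lemma refl_word_orb:
  assumes "x \<in> orb \<alpha> r" "set is \<subseteq> {1..r}"
  shows "refl_word \<alpha> is x \<in> orb \<alpha> r"
  using assms(2) by (induction "is") (auto simp: refl_word_Cons assms(1) intro: orb.intros)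

lemma orb_minus: "x \<in> orb \<alpha> r \<Longrightarrow> - x \<in> orb \<alpha> r"
proof (induction rule: orb.induct)
  case (orb_simple i)
  then show ?case by (metis orb.orb_simple orb.orb_reflection reflection_self)
next
  case (orb_reflection x i)
  then show ?case by (metis orb.orb_reflection reflection_minus)
qed

lemma dual_vectors:
  fixes \<alpha> :: "nat \<Rightarrow> 'a::euclidean_space" and v :: "nat \<Rightarrow> real"
  assumes "independent (\<alpha> ` {1..l})" and "inj_on \<alpha> {1..l}"
  obtains x where "\<And>k. k \<in> {1..l} \<Longrightarrow> x \<bullet> \<alpha> k = v k"
proof -
  obtain g :: "'a \<Rightarrow> real" where g: "linear g"
      "\<forall>x\<in>\<alpha> ` {1..l}. g x = (v \<circ> the_inv_into {1..l} \<alpha>) x"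
    using linear_independent_extend[OF assms(1)] by blast
  have "adjoint g 1 \<bullet> \<alpha> k = v k" if "k \<in> {1..l}" for k
  proof -
    have "adjoint g 1 \<bullet> \<alpha> k = g (\<alpha> k)"
      by (simp add: adjoint_clauses(2)[OF g(1)])
    also have "\<dots> = v k"
      using g(2) the_inv_into_f_f[OF assms(2) that] that by simp
    finally show ?thesis .
  qed
  with that show ?thesis by blast
qed

lemma eq_if_inner_eq:
  assumes "span (\<alpha> ` {1..l}) = UNIV" and "\<And>k. k \<in> {1..l} \<Longrightarrow> x \<bullet> \<alpha> k = y \<bullet> (\<alpha> k :: 'a::euclidean_space)"
  shows "x = y"
proof -
  have "(x - y) \<bullet> z = 0" for z
  proof -
    have "z \<in> span (\<alpha> ` {1..l})" using assms(1) by simp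
    then show ?thesis
      by (induction rule: span_induct_alt)
         (use assms(2) in \<open>auto simp: inner_add_right inner_diff_left\<close>)
  qed
  from this[of "x - y"] show ?thesis by simp
qed

lemma linear_eq_on_simple:
  fixes f :: "'a::euclidean_space \<Rightarrow> 'b::real_vector"
  assumes "linear f" "linear g" "span (\<alpha> ` {1..l}) = UNIV" "\<And>i. i \<in> {1..l} \<Longrightarrow> f (\<alpha> i) = g (\<alpha> i)"
  shows "f = g"
proof
  fix x
  show "f x = g x"
    by (rule linear_eq_on_span[OF assms(1,2), where B = "\<alpha> ` {1..l}"]) (use assms(3,4) in auto)
qed

locale rbase =
  fixes \<Phi> :: "'a::euclidean_space set" and \<alpha> :: "nat \<Rightarrow> 'a" and l :: nat
  assumes rs: "root_system UNIV \<Phi>" and red: "reduced_rs \<Phi>" and base: "root_basis UNIV \<Phi> l \<alpha>"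
begin

lemma finite_roots: "finite \<Phi>" and zero_not_root: "0 \<notin> \<Phi>"
  and root_reflection: "\<beta> \<in> \<Phi> \<Longrightarrow> \<gamma> \<in> \<Phi> \<Longrightarrow> reflection \<beta> \<gamma> \<in> \<Phi>"
  and cartan_Ints: "\<beta> \<in> \<Phi> \<Longrightarrow> \<gamma> \<in> \<Phi> \<Longrightarrow> cartan_number \<beta> \<gamma> \<in> \<int>"
  using rs by (auto simp: root_system_def)

lemma span_roots: "span \<Phi> = UNIV"
  using rs by (auto simp: root_system_def)

lemma simple_root: "i \<in> {1..l} \<Longrightarrow> \<alpha> i \<in> \<Phi>"
  and inj_simple: "inj_on \<alpha> {1..l}" and indep_simple: "independent (\<alpha> ` {1..l})"
  and span_simple: "span (\<alpha> ` {1..l}) = UNIV"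
  using base by (auto simp: root_basis_def)

lemma simple_nonzero: "i \<in> {1..l} \<Longrightarrow> \<alpha> i \<noteq> 0"
  using simple_root zero_not_root by metis

lemma root_minus: "\<beta> \<in> \<Phi> \<Longrightarrow> - \<beta> \<in> \<Phi>"
  using root_reflection[of \<beta> \<beta>] by simp

definition pos :: "'a set" where
  "pos = {\<beta> \<in> \<Phi>. \<exists>c :: nat \<Rightarrow> nat. \<beta> = (\<Sum>i=1..l. real (c i) *\<^sub>R \<alpha> i)}"

definition lam :: "nat \<Rightarrow> 'a" where
  "lam k = (SOME x. \<forall>i\<in>{1..l}. x \<bullet> \<alpha> i = (if i = k then 1 else 0))"

lemma lam: "i \<in> {1..l} \<Longrightarrow> \<alpha> i \<bullet> lam k = (if i = k then 1 else 0)"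
proof -
  obtain x where "\<And>i. i \<in> {1..l} \<Longrightarrow> x \<bullet> \<alpha> i = (if i = k then 1 else 0)"
    using dual_vectors[OF indep_simple inj_simple, of "\<lambda>i. if i = k then 1 else 0"] by blast
  then have "\<forall>i\<in>{1..l}. x \<bullet> \<alpha> i = (if i = k then 1 else 0)" by blast
  then have "\<forall>i\<in>{1..l}. lam k \<bullet> \<alpha> i = (if i = k then 1 else 0)"
    unfolding lam_def by (rule someI)
  then show "i \<in> {1..l} \<Longrightarrow> \<alpha> i \<bullet> lam k = (if i = k then 1 else 0)"
    by (simp add: inner_commute)
qed

lemma comb_lam: "k \<in> {1..l} \<Longrightarrow> (\<Sum>i=1..l. c i *\<^sub>R \<alpha> i) \<bullet> lam k = c k"
proof -
  assume k: "k \<in> {1..l}"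
  have "(\<Sum>i=1..l. c i *\<^sub>R \<alpha> i) \<bullet> lam k = (\<Sum>i=1..l. if i = k then c i else 0)"
    unfolding inner_sum_left by (intro sum.cong) (auto simp: lam)
  then show ?thesis using k by simp
qed

lemma expand: "x = (\<Sum>i=1..l. (x \<bullet> lam i) *\<^sub>R \<alpha> i)"
proof -
  have lin: "linear (\<lambda>x. \<Sum>i=1..l. (x \<bullet> lam i) *\<^sub>R \<alpha> i)"
    by (rule linearI) (simp_all add: inner_add_left scaleR_add_left sum.distrib scaleR_sum_right)
  have "linear (\<lambda>x::'a. x)" by (simp add: linear_iff)
  then have "(\<lambda>x. x) = (\<lambda>x. \<Sum>i=1..l. (x \<bullet> lam i) *\<^sub>R \<alpha> i)"
    using lin span_simple
  proof (rule linear_eq_on_simple)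
    fix i assume i: "i \<in> {1..l}"
    have "(\<Sum>k=1..l. (\<alpha> i \<bullet> lam k) *\<^sub>R \<alpha> k) = (\<Sum>k=1..l. if i = k then \<alpha> k else 0)"
      by (intro sum.cong) (auto simp: lam[OF i])
    then show "\<alpha> i = (\<Sum>k=1..l. (\<alpha> i \<bullet> lam k) *\<^sub>R \<alpha> k)" using i by simp
  qed
  then show ?thesis by metis
qed

lemma root_cases: "\<beta> \<in> \<Phi> \<Longrightarrow> \<beta> \<in> pos \<or> - \<beta> \<in> pos"
proof -
  assume b: "\<beta> \<in> \<Phi>"
  then obtain c :: "nat \<Rightarrow> nat" where
    "\<beta> = (\<Sum>i=1..l. real (c i) *\<^sub>R \<alpha> i) \<or> \<beta> = - (\<Sum>i=1..l. real (c i) *\<^sub>R \<alpha> i)"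
    using base unfolding root_basis_def by blast
  then show ?thesis
    unfolding pos_def using b root_minus[OF b] by (metis (mono_tags, lifting) mem_Collect_eq minus_minus)
qed

lemma pos_root: "\<beta> \<in> pos \<Longrightarrow> \<beta> \<in> \<Phi>"
  by (simp add: pos_def)

lemma pos_coeff:
  assumes "\<beta> \<in> pos" and "k \<in> {1..l}"
  shows "\<beta> \<bullet> lam k \<ge> 0" and "\<beta> \<bullet> lam k \<in> \<int>"
  using assms unfolding pos_def by (auto simp: comb_lam)

lemma pos_nonneg_inner:
  assumes "\<beta> \<in> pos" and "\<And>i. i \<in> {1..l} \<Longrightarrow> \<alpha> i \<bullet> \<rho> > 0"
  shows "\<beta> \<bullet> \<rho> > 0"
proof -
  have eq: "\<beta> \<bullet> \<rho> = (\<Sum>i=1..l. (\<beta> \<bullet> lam i) * (\<alpha> i \<bullet> \<rho>))"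
    by (subst expand) (simp add: inner_sum_left)
  have nn: "(\<beta> \<bullet> lam i) * (\<alpha> i \<bullet> \<rho>) \<ge> 0" if "i \<in> {1..l}" for i
    using pos_coeff[OF assms(1) that] assms(2)[OF that] by simp
  have "\<exists>i\<in>{1..l}. \<beta> \<bullet> lam i \<noteq> 0"
  proof (rule ccontr)
    assume "\<not> ?thesis"
    then have "\<beta> = 0" by (subst expand) simp
    then show False using assms(1) pos_root zero_not_root by blast
  qed
  then obtain i where i: "i \<in> {1..l}" "\<beta> \<bullet> lam i \<noteq> 0" by blast
  then have "(\<beta> \<bullet> lam i) * (\<alpha> i \<bullet> \<rho>) > 0"
    using pos_coeff[OF assms(1) i(1)] assms(2)[OF i(1)] by (simp add: less_le)
  then show ?thesis
    unfolding eq using nn i(1) by (intro sum_pos2[of _ i]) auto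
qed

lemma pos_not_neg: "\<beta> \<in> pos \<Longrightarrow> - \<beta> \<notin> pos"
proof
  assume b: "\<beta> \<in> pos" "- \<beta> \<in> pos"
  obtain \<rho> where r: "\<And>k. k \<in> {1..l} \<Longrightarrow> \<rho> \<bullet> \<alpha> k = 1"
    using dual_vectors[OF indep_simple inj_simple, of "\<lambda>i. 1"] by blast
  then have r': "\<alpha> k \<bullet> \<rho> > 0" if "k \<in> {1..l}" for k using that by (simp add: inner_commute)
  show False
    using pos_nonneg_inner[OF b(1) r'] pos_nonneg_inner[OF b(2) r'] by simp
qed

lemma simple_pos: "i \<in> {1..l} \<Longrightarrow> \<alpha> i \<in> pos"
proof -
  assume i: "i \<in> {1..l}"
  have "(\<Sum>k=1..l. real (if k = i then 1 else 0) *\<^sub>R \<alpha> k) = (\<Sum>k=1..l. if i = k then \<alpha> k else 0)"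
    by (intro sum.cong) auto
  then show ?thesis using i simple_root[OF i]
    unfolding pos_def by (intro CollectI conjI exI[of _ "\<lambda>k. if k = i then 1 else 0"]) auto
qed

lemma reflection_lam:
  "i \<in> {1..l} \<Longrightarrow> k \<noteq> i \<Longrightarrow> reflection (\<alpha> i) x \<bullet> lam k = x \<bullet> lam k"
  by (simp add: reflection_def inner_diff_left lam)

text \<open>A positive root other than \<open>\<alpha> i\<close> involves a further simple root, since \<open>\<Phi>\<close> is reduced, and the
  reflection does not change its coefficient.\<close>

lemma reflection_pos:
  assumes "\<beta> \<in> pos" "i \<in> {1..l}" "\<beta> \<noteq> \<alpha> i"
  shows "reflection (\<alpha> i) \<beta> \<in> pos"
proof -
  have "\<exists>k\<in>{1..l}. k \<noteq> i \<and> \<beta> \<bullet> lam k \<noteq> 0"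
  proof (rule ccontr)
    assume *: "\<not> ?thesis"
    have "\<beta> = (\<Sum>k=1..l. if i = k then (\<beta> \<bullet> lam i) *\<^sub>R \<alpha> i else 0)"
      by (subst expand) (intro sum.cong, use * in auto)
    then have b: "\<beta> = (\<beta> \<bullet> lam i) *\<^sub>R \<alpha> i" using assms(2) by simp
    then have "(\<beta> \<bullet> lam i) *\<^sub>R \<alpha> i \<in> \<Phi>" using assms(1) pos_root by metis
    then have "\<beta> \<bullet> lam i = 1 \<or> \<beta> \<bullet> lam i = -1"
      using red simple_root[OF assms(2)] unfolding reduced_rs_def by blast
    moreover have "\<beta> \<bullet> lam i \<ge> 0" using pos_coeff assms by blast
    ultimately have "\<beta> \<bullet> lam i = 1" by auto
    with b assms(3) show False by simp
  qed
  then obtain k where k: "k \<in> {1..l}" "k \<noteq> i" "\<beta> \<bullet> lam k \<noteq> 0" by blast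
  then have "\<beta> \<bullet> lam k > 0" using pos_coeff(1)[OF assms(1) k(1)] by simp
  then have gt: "reflection (\<alpha> i) \<beta> \<bullet> lam k > 0" using k assms(2) by (simp add: reflection_lam)
  have "reflection (\<alpha> i) \<beta> \<in> \<Phi>" using root_reflection simple_root pos_root assms by blast
  moreover have "- reflection (\<alpha> i) \<beta> \<notin> pos"
    using gt pos_coeff(1)[of "- reflection (\<alpha> i) \<beta>" k] k(1) by auto
  ultimately show ?thesis using root_cases by blast
qed

lemma pos_in_orb: "\<beta> \<in> pos \<Longrightarrow> \<beta> \<in> orb \<alpha> l"
proof (induction "nat \<lfloor>\<Sum>i=1..l. \<beta> \<bullet> lam i\<rfloor>" arbitrary: \<beta> rule: less_induct)
  case less
  show ?case
  proof (cases "\<exists>i\<in>{1..l}. \<beta> = \<alpha> i")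
    case True
    then show ?thesis by (auto intro: orb.intros)
  next
    case False
    have "\<exists>i\<in>{1..l}. \<beta> \<bullet> \<alpha> i > 0"
    proof (rule ccontr)
      assume *: "\<not> ?thesis"
      have "\<beta> \<bullet> \<beta> = (\<Sum>i=1..l. (\<beta> \<bullet> lam i) * (\<beta> \<bullet> \<alpha> i))"
        by (subst (2) expand) (simp add: inner_sum_right)
      also have "\<dots> \<le> 0"
        using * pos_coeff(1)[OF less.prems] by (intro sum_nonpos) (auto simp: mult_le_0_iff not_less)
      finally have "\<beta> = 0" by (metis inner_eq_zero_iff inner_ge_zero order_antisym)
      then show False using less.prems pos_root zero_not_root by blast
    qed
    then obtain i where i: "i \<in> {1..l}" "\<beta> \<bullet> \<alpha> i > 0" by blast
    let ?\<gamma> = "reflection (\<alpha> i) \<beta>"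
    have g: "?\<gamma> \<in> pos" using reflection_pos less.prems i False by blast
    have "(\<Sum>k=1..l. ?\<gamma> \<bullet> lam k) =
        (\<Sum>k=1..l. \<beta> \<bullet> lam k - (if k = i then cartan_number \<beta> (\<alpha> i) else 0))"
      using i(1) by (intro sum.cong) (auto simp: reflection_eq_cartan inner_diff_left lam)
    moreover have "cartan_number \<beta> (\<alpha> i) > 0"
      using i simple_nonzero[OF i(1)] by (simp add: cartan_number_def)
    ultimately have lt: "(\<Sum>k=1..l. ?\<gamma> \<bullet> lam k) < (\<Sum>k=1..l. \<beta> \<bullet> lam k)"
      using i(1) by (simp add: sum_subtractf)
    have "(\<Sum>k=1..l. ?\<gamma> \<bullet> lam k) \<ge> 0" "(\<Sum>k=1..l. ?\<gamma> \<bullet> lam k) \<in> \<int>" "(\<Sum>k=1..l. \<beta> \<bullet> lam k) \<in> \<int>"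
      using pos_coeff[OF g] pos_coeff[OF less.prems] by (auto intro: sum_nonneg Ints_sum)
    then have "nat \<lfloor>\<Sum>k=1..l. ?\<gamma> \<bullet> lam k\<rfloor> < nat \<lfloor>\<Sum>k=1..l. \<beta> \<bullet> lam k\<rfloor>"
      using lt by (auto elim!: Ints_cases)
    then have "?\<gamma> \<in> orb \<alpha> l" using less.hyps g by blast
    then have "reflection (\<alpha> i) ?\<gamma> \<in> orb \<alpha> l" using i(1) by (rule orb.intros)
    then show ?thesis by simp
  qed
qed

theorem roots_eq_orb: "\<Phi> = orb \<alpha> l"
proof
  show "\<Phi> \<subseteq> orb \<alpha> l"
    using root_cases pos_in_orb orb_minus[of "- _"] by fastforce
  show "orb \<alpha> l \<subseteq> \<Phi>"
  proof
    fix x assume "x \<in> orb \<alpha> l"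
    then show "x \<in> \<Phi>" by induction (blast intro: simple_root root_reflection)+
  qed
qed

lemma refl_word_root: "set is \<subseteq> {1..l} \<Longrightarrow> \<beta> \<in> \<Phi> \<Longrightarrow> refl_word \<alpha> is \<beta> \<in> \<Phi>"
  by (metis roots_eq_orb refl_word_orb)

lemma exchange:
  assumes "set is \<subseteq> {1..l}" "i \<in> {1..l}" "- refl_word \<alpha> is (\<alpha> i) \<in> pos"
  shows "\<exists>js. set js \<subseteq> set is \<and> length js < length is \<and>
           refl_word \<alpha> is \<circ> reflection (\<alpha> i) = refl_word \<alpha> js"
  using assms
proof (induction "is")
  case Nil
  then show ?case using pos_not_neg[OF simple_pos] by auto
next
  case (Cons k "is")
  show ?case
  proof (cases "- refl_word \<alpha> is (\<alpha> i) \<in> pos")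
    case True
    then obtain js where js: "set js \<subseteq> set is" "length js < length is"
        "refl_word \<alpha> is \<circ> reflection (\<alpha> i) = refl_word \<alpha> js"
      using Cons.IH Cons.prems(1,2) by (meson set_subset_Cons subset_trans)
    then show ?thesis
      by (intro exI[of _ "k # js"]) (auto simp: refl_word_Cons fun_eq_iff)
  next
    case False
    then have p: "refl_word \<alpha> is (\<alpha> i) \<in> pos"
      using root_cases refl_word_root simple_root Cons.prems by (meson set_subset_Cons subset_trans)
    have eq: "refl_word \<alpha> is (\<alpha> i) = \<alpha> k"
    proof (rule ccontr)
      assume "\<not> ?thesis"
      then have "reflection (\<alpha> k) (refl_word \<alpha> is (\<alpha> i)) \<in> pos"
        using reflection_pos[OF p] Cons.prems(1) by auto
      then show False using Cons.prems(3) pos_not_neg by (auto simp: refl_word_Cons)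
    qed
    have "reflection (\<alpha> k) (refl_word \<alpha> is (reflection (\<alpha> i) x)) = refl_word \<alpha> is x" for x
      using reflection_isometry[OF linear_refl_word refl_word_inner, of \<alpha> "is" "\<alpha> i" "reflection (\<alpha> i) x"]
      by (simp add: eq)
    then show ?thesis
      by (intro exI[of _ "is"]) (auto simp: refl_word_Cons fun_eq_iff)
  qed
qed

definition inversions :: "('a \<Rightarrow> 'a) \<Rightarrow> 'a set" where
  "inversions w = {\<beta> \<in> pos. - w \<beta> \<in> pos}"

lemma finite_inversions: "finite (inversions w)"
  by (rule finite_subset[OF _ finite_roots]) (auto simp: inversions_def pos_root)

lemma inversions_reflection:
  assumes "i \<in> {1..l}"
  shows "inversions (w \<circ> reflection (\<alpha> i)) - {\<alpha> i} = reflection (\<alpha> i) ` (inversions w - {\<alpha> i})"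
    (is "?A = ?B")
proof
  have ne: "reflection (\<alpha> i) \<beta> \<noteq> \<alpha> i" if "\<beta> \<in> pos" for \<beta>
    using that pos_not_neg[OF simple_pos[OF assms]]
    by (metis reflection_invol reflection_self)
  show "?A \<subseteq> ?B"
  proof
    fix \<beta> assume "\<beta> \<in> ?A"
    then have "reflection (\<alpha> i) \<beta> \<in> inversions w - {\<alpha> i}"
      using reflection_pos assms ne by (auto simp: inversions_def)
    then have "reflection (\<alpha> i) (reflection (\<alpha> i) \<beta>) \<in> ?B" by (rule imageI)
    then show "\<beta> \<in> ?B" by simp
  qed
  show "?B \<subseteq> ?A"
    using reflection_pos assms ne by (auto simp: inversions_def)
qed

lemma card_inversions_reflection:
  assumes "i \<in> {1..l}"
  shows "card (inversions (w \<circ> reflection (\<alpha> i)) - {\<alpha> i}) = card (inversions w - {\<alpha> i})"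
  unfolding inversions_reflection[OF assms]
  by (rule card_image) (metis inj_onI reflection_invol)

lemma card_inversions_pos:
  assumes "i \<in> {1..l}" "w (\<alpha> i) \<in> pos" "linear w"
  shows "card (inversions (w \<circ> reflection (\<alpha> i))) = Suc (card (inversions w))"
proof -
  have "\<alpha> i \<notin> inversions w" using assms pos_not_neg by (auto simp: inversions_def)
  moreover have "\<alpha> i \<in> inversions (w \<circ> reflection (\<alpha> i))"
    using assms simple_pos by (auto simp: inversions_def linear_neg)
  ultimately show ?thesis
    using card_inversions_reflection[OF assms(1), of w] finite_inversions
    by (metis Diff_empty Diff_insert0 card_Suc_Diff1)
qed

lemma card_inversions_neg:
  assumes "i \<in> {1..l}" "- w (\<alpha> i) \<in> pos" "linear w"
  shows "card (inversions w) = Suc (card (inversions (w \<circ> reflection (\<alpha> i))))"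
proof -
  have "w \<circ> reflection (\<alpha> i) \<circ> reflection (\<alpha> i) = w" by (auto simp: fun_eq_iff)
  moreover have "(w \<circ> reflection (\<alpha> i)) (\<alpha> i) \<in> pos" using assms by (simp add: linear_neg)
  ultimately show ?thesis
    using card_inversions_pos[OF assms(1), of "w \<circ> reflection (\<alpha> i)"]
      linear_compose[OF linear_reflection assms(3)] by metis
qed

context
  fixes S :: "nat set"
  assumes S: "S \<subseteq> {1..l}"
begin

lemma refl_group_root: "w \<in> refl_group \<alpha> S \<Longrightarrow> \<beta> \<in> \<Phi> \<Longrightarrow> w \<beta> \<in> \<Phi>"
  using S refl_word_root by (auto simp: refl_group_iff)

lemma refl_group_linear: "w \<in> refl_group \<alpha> S \<Longrightarrow> linear w"
  by (auto simp: refl_group_iff linear_refl_word)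

lemma refl_group_reflection:
  "w \<in> refl_group \<alpha> S \<Longrightarrow> i \<in> S \<Longrightarrow> w \<circ> reflection (\<alpha> i) \<in> refl_group \<alpha> S"
proof -
  assume "w \<in> refl_group \<alpha> S" "i \<in> S"
  then obtain "is" where "set is \<subseteq> S" "w = refl_word \<alpha> is" by (auto simp: refl_group_iff)
  with \<open>i \<in> S\<close> show ?thesis
    unfolding refl_group_iff
    by (intro exI[of _ "is @ [i]"]) (simp add: refl_word_append refl_word_Cons)
qed

lemma refl_group_pos_id:
  assumes "w \<in> refl_group \<alpha> S" "\<And>i. i \<in> S \<Longrightarrow> w (\<alpha> i) \<in> pos"
  shows "w = id"
proof -
  let ?P = "\<lambda>is. set is \<subseteq> S \<and> w = refl_word \<alpha> is"
  obtain ks where "?P ks" using assms(1) by (auto simp: refl_group_iff)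
  then obtain "is" where P: "?P is" and min: "\<And>js. ?P js \<Longrightarrow> length is \<le> length js"
    using ex_has_least_nat[of ?P ks length] by blast
  have "is = []"
  proof (rule ccontr)
    assume "is \<noteq> []"
    then obtain ks i where iks: "is = ks @ [i]" by (metis rev_exhaust)
    then have i: "i \<in> S" "set ks \<subseteq> S" using P by auto
    have eq: "w = refl_word \<alpha> ks \<circ> reflection (\<alpha> i)"
      using P iks by (simp add: refl_word_append refl_word_Cons)
    have "- refl_word \<alpha> ks (\<alpha> i) \<in> pos"
      using assms(2)[OF i(1)] by (simp add: eq linear_neg[OF linear_refl_word])
    then obtain js where "set js \<subseteq> set ks" "length js < length ks" "w = refl_word \<alpha> js"
      using exchange[of ks i] i S eq by (metis subset_iff)
    then show False using min[of js] i(2) iks by auto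
  qed
  with P show ?thesis by simp
qed

lemma refl_length_eq:
  assumes "w \<in> refl_group \<alpha> S"
  shows "refl_length \<alpha> S w = card (inversions w)"
proof -
  have le: "card (inversions (refl_word \<alpha> is)) \<le> length is" if "set is \<subseteq> S" for "is"
    using that
  proof (induction "is" rule: rev_induct)
    case Nil
    have "inversions (refl_word \<alpha> []) = {}" using pos_not_neg by (auto simp: inversions_def)
    then show ?case by (simp only: card.empty list.size)
  next
    case (snoc i "is")
    let ?w = "refl_word \<alpha> is"
    have i: "i \<in> {1..l}" using snoc.prems S by auto
    have "?w (\<alpha> i) \<in> \<Phi>" using refl_word_root simple_root i snoc.prems S by auto
    then have "card (inversions (?w \<circ> reflection (\<alpha> i))) \<le> Suc (card (inversions ?w))"
      using card_inversions_pos[OF i _ linear_refl_word] card_inversions_neg[OF i _ linear_refl_word]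
        root_cases by (metis Suc_leD le_SucI order_refl)
    moreover have "refl_word \<alpha> (is @ [i]) = ?w \<circ> reflection (\<alpha> i)"
      by (simp add: refl_word_append refl_word_Cons)
    moreover have "card (inversions ?w) \<le> length is" using snoc by simp
    ultimately show ?case by (simp only: length_append list.size)
  qed
  have ge: "\<exists>is. set is \<subseteq> S \<and> length is = card (inversions w) \<and> refl_word \<alpha> is = w"
    using assms
  proof (induction "card (inversions w)" arbitrary: w)
    case 0
    have "w (\<alpha> i) \<in> pos" if "i \<in> S" for i
      using 0 that simple_pos[of i] root_cases[OF refl_group_root, of w "\<alpha> i"] simple_root[of i] S
        finite_inversions by (force simp: inversions_def)
    then have "w = id" using refl_group_pos_id 0 by blast
    then show ?case using 0 by (intro exI[of _ "[]"]) simp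
  next
    case (Suc n)
    have "\<exists>i\<in>S. - w (\<alpha> i) \<in> pos"
    proof (rule ccontr)
      assume "\<not> ?thesis"
      then have "w = id"
        using refl_group_pos_id[OF Suc.prems] root_cases refl_group_root[OF Suc.prems] simple_root S
        by blast
      then have "inversions w = {}" using pos_not_neg by (auto simp: inversions_def)
      then show False using Suc by simp
    qed
    then obtain i where i: "i \<in> S" "- w (\<alpha> i) \<in> pos" by blast
    have "n = card (inversions (w \<circ> reflection (\<alpha> i)))"
      using card_inversions_neg[of i w] i S Suc refl_group_linear by auto
    then obtain "is" where "is": "set is \<subseteq> S" "length is = n" "refl_word \<alpha> is = w \<circ> reflection (\<alpha> i)"
      using Suc.hyps(1) refl_group_reflection[OF Suc.prems i(1)] by metis
    have "refl_word \<alpha> (is @ [i]) = w"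
      by (simp add: refl_word_append refl_word_Cons "is"(3) fun_eq_iff)
    with "is" i Suc(2) show ?case by (intro exI[of _ "is @ [i]"]) auto
  qed
  show ?thesis
    unfolding refl_length_def by (rule Least_equality) (use ge le in auto)
qed

lemma refl_group_comp: "v \<in> refl_group \<alpha> S \<Longrightarrow> w \<in> refl_group \<alpha> S \<Longrightarrow> v \<circ> w \<in> refl_group \<alpha> S"
  by (metis (no_types, lifting) refl_group_iff refl_word_append set_append sup.bounded_iff)

definition pos_part :: "'a set" where
  "pos_part = {\<beta> \<in> pos. \<forall>k\<in>{1..l} - S. \<beta> \<bullet> lam k = 0}"

lemma refl_group_lam:
  assumes "w \<in> refl_group \<alpha> S" "k \<notin> S"
  shows "w x \<bullet> lam k = x \<bullet> lam k"
proof -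
  obtain "is" where "set is \<subseteq> S" "w = refl_word \<alpha> is" using assms by (auto simp: refl_group_iff)
  moreover have "set is \<subseteq> S \<Longrightarrow> refl_word \<alpha> is x \<bullet> lam k = x \<bullet> lam k" for "is"
    using S assms(2) by (induction "is") (auto simp: refl_word_Cons, metis atLeastAtMost_iff reflection_lam subsetD)
  ultimately show ?thesis by blast
qed

lemma inversions_subset: "w \<in> refl_group \<alpha> S \<Longrightarrow> inversions w \<subseteq> pos_part"
proof
  fix \<beta> assume w: "w \<in> refl_group \<alpha> S" and b: "\<beta> \<in> inversions w"
  have "\<beta> \<bullet> lam k = 0" if "k \<in> {1..l} - S" for k
    using b pos_coeff(1)[of \<beta> k] pos_coeff(1)[of "- w \<beta>" k] that refl_group_lam[OF w, of k \<beta>]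
    by (auto simp: inversions_def)
  with b show "\<beta> \<in> pos_part" by (auto simp: pos_part_def inversions_def)
qed

lemma inversions_eq_pos_part:
  assumes "w \<in> refl_group \<alpha> S" "\<And>i. i \<in> S \<Longrightarrow> - w (\<alpha> i) \<in> pos"
  shows "inversions w = pos_part"
proof
  show "inversions w \<subseteq> pos_part" using inversions_subset assms(1) by blast
  show "pos_part \<subseteq> inversions w"
  proof
    fix \<beta> assume b: "\<beta> \<in> pos_part"
    then have bp: "\<beta> \<in> pos" by (simp add: pos_part_def)
    have "w \<beta> \<in> \<Phi>" using refl_group_root assms(1) bp pos_root by blast
    moreover have "w \<beta> \<notin> pos"
    proof
      assume wp: "w \<beta> \<in> pos"
      obtain \<rho> where r: "\<And>k. k \<in> {1..l} \<Longrightarrow> \<rho> \<bullet> \<alpha> k = 1"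
        using dual_vectors[OF indep_simple inj_simple, of "\<lambda>i. 1"] by blast
      then have r': "\<alpha> k \<bullet> \<rho> > 0" if "k \<in> {1..l}" for k using that by (simp add: inner_commute)
      have "w \<beta> = (\<Sum>i=1..l. (\<beta> \<bullet> lam i) *\<^sub>R w (\<alpha> i))"
        using refl_group_linear[OF assms(1)]
        by (subst expand) (simp add: linear_sum linear_cmul)
      then have "w \<beta> \<bullet> \<rho> = (\<Sum>i=1..l. (\<beta> \<bullet> lam i) * (w (\<alpha> i) \<bullet> \<rho>))"
        by (simp add: inner_sum_left)
      also have "\<dots> \<le> 0"
      proof (rule sum_nonpos)
        fix i assume i: "i \<in> {1..l}"
        show "(\<beta> \<bullet> lam i) * (w (\<alpha> i) \<bullet> \<rho>) \<le> 0"
        proof (cases "i \<in> S")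
          case True
          then have "w (\<alpha> i) \<bullet> \<rho> < 0"
            using pos_nonneg_inner[OF assms(2) r', of i] by simp
          then show ?thesis using pos_coeff(1)[OF bp i] by (simp add: mult_nonneg_nonpos)
        next
          case False
          then show ?thesis using b i by (simp add: pos_part_def)
        qed
      qed
      finally show False using pos_nonneg_inner[OF wp r'] by simp
    qed
    ultimately show "\<beta> \<in> inversions w" using bp root_cases by (auto simp: inversions_def)
  qed
qed

lemma refl_group_inverse:
  assumes "w \<in> refl_group \<alpha> S"
  obtains w' where "w' \<in> refl_group \<alpha> S" "\<And>x. w (w' x) = x" "\<And>x. w' (w x) = x"
proof -
  obtain "is" where "is": "set is \<subseteq> S" "w = refl_word \<alpha> is" using assms by (auto simp: refl_group_iff)
  then have "refl_word \<alpha> (rev is) \<in> refl_group \<alpha> S"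
    unfolding refl_group_iff by (metis set_rev)
  then show ?thesis
    using "is"(2) by (intro that) (auto simp: refl_word_rev refl_word_rev')
qed

lemma finite_pos_part: "finite pos_part"
  by (rule finite_subset[OF _ finite_roots]) (auto simp: pos_part_def pos_root)

theorem longest_element_eq:
  assumes w: "w \<in> refl_group \<alpha> S" "\<And>i. i \<in> S \<Longrightarrow> - w (\<alpha> i) \<in> pos"
  shows "longest_element \<alpha> S = w"
  unfolding longest_element_def
proof (rule the_equality)
  show "w \<in> refl_group \<alpha> S \<and> (\<forall>v\<in>refl_group \<alpha> S. refl_length \<alpha> S v \<le> refl_length \<alpha> S w)"
    using w(1) inversions_subset card_mono[OF finite_pos_part]
    by (auto simp: refl_length_eq inversions_eq_pos_part[OF w])
  fix v assume v: "v \<in> refl_group \<alpha> S \<and> (\<forall>u\<in>refl_group \<alpha> S. refl_length \<alpha> S u \<le> refl_length \<alpha> S v)"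
  then have "card pos_part \<le> card (inversions v)"
    using w(1) refl_length_eq inversions_eq_pos_part[OF w] by metis
  then have iv: "inversions v = pos_part"
    using card_seteq[OF finite_pos_part inversions_subset] v by blast
  obtain w' where w': "w' \<in> refl_group \<alpha> S" "\<And>x. w (w' x) = x" "\<And>x. w' (w x) = x"
    using refl_group_inverse[OF w(1)] by blast
  have "v \<circ> w' = id"
  proof (rule refl_group_pos_id)
    show "v \<circ> w' \<in> refl_group \<alpha> S" using refl_group_comp v w'(1) by blast
    fix i assume i: "i \<in> S"
    then have il: "i \<in> {1..l}" using S by auto
    let ?\<beta> = "w' (\<alpha> i)"
    have lin: "linear w" "linear v" "linear w'" using refl_group_linear w v w' by auto
    have b: "?\<beta> \<in> \<Phi>" using refl_group_root[OF w'(1)] simple_root il by blast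
    have k: "?\<beta> \<bullet> lam k = 0" if "k \<in> {1..l} - S" for k
      using that refl_group_lam[OF w'(1), of k] lam[OF il, of k] i by auto
    have "?\<beta> \<notin> pos"
    proof
      assume "?\<beta> \<in> pos"
      then have "?\<beta> \<in> inversions w" using k inversions_eq_pos_part[OF w] by (auto simp: pos_part_def)
      then show False using pos_not_neg[OF simple_pos[OF il]] w'(2) by (auto simp: inversions_def)
    qed
    then have "- ?\<beta> \<in> pos_part" using b root_cases k by (auto simp: pos_part_def)
    then have "- v (- ?\<beta>) \<in> pos" using iv by (auto simp: inversions_def)
    then show "(v \<circ> w') (\<alpha> i) \<in> pos" using lin by (simp add: linear_neg)
  qed
  then show "v = w" using w'(3) by (metis comp_apply ext id_apply)
qed

theorem longest_element:
  shows "longest_element \<alpha> S \<in> refl_group \<alpha> S"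
    and "i \<in> S \<Longrightarrow> - longest_element \<alpha> S (\<alpha> i) \<in> pos"
proof -
  let ?P = "\<lambda>w. w \<in> refl_group \<alpha> S"
  have "?P id" unfolding refl_group_iff by (intro exI[of _ "[]"]) simp
  moreover have "card (inversions w) < Suc (card pos_part)" if "?P w" for w
    using card_mono[OF finite_pos_part inversions_subset[OF that]] by simp
  ultimately obtain w where w: "?P w" and max: "\<And>v. ?P v \<Longrightarrow> card (inversions v) \<le> card (inversions w)"
    using ex_has_greatest_nat[of ?P id "\<lambda>w. card (inversions w)"] by blast
  have neg: "- w (\<alpha> i) \<in> pos" if "i \<in> S" for i
  proof (rule ccontr)
    assume "\<not> ?thesis"
    then have "w (\<alpha> i) \<in> pos" using root_cases refl_group_root[OF w] simple_root that S by blast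
    then have "card (inversions (w \<circ> reflection (\<alpha> i))) = Suc (card (inversions w))"
      using card_inversions_pos refl_group_linear[OF w] that S by blast
    then show False using max[OF refl_group_reflection[OF w that]] by simp
  qed
  have "longest_element \<alpha> S = w" using longest_element_eq[OF w neg] .
  with w neg show "longest_element \<alpha> S \<in> refl_group \<alpha> S"
    and "i \<in> S \<Longrightarrow> - longest_element \<alpha> S (\<alpha> i) \<in> pos" by auto
qed

end

lemma parabolic_subset: "{1..l} - {j} \<subseteq> {1..l}"
  by auto

lemma w_elt:
  shows "w_elt l \<alpha> j \<in> refl_group \<alpha> ({1..l} - {j})"
    and "i \<in> {1..l} \<Longrightarrow> i \<noteq> j \<Longrightarrow> - w_elt l \<alpha> j (\<alpha> i) \<in> pos"
  unfolding w_elt_def using longest_element[OF parabolic_subset[of j]] by auto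

lemma w_elt_in_group: "w_elt l \<alpha> j \<in> refl_group \<alpha> {1..l}"
  using w_elt(1)[of j] refl_group_mono[OF parabolic_subset[of j]] by blast

lemma w_elt_linear: "linear (w_elt l \<alpha> j)"
  using refl_group_linear w_elt(1) parabolic_subset by blast

lemma w_elt_decreasing:
  assumes "\<And>i. i \<in> {1..l} \<Longrightarrow> \<alpha> i \<bullet> \<rho> > 0" "i \<in> {1..l}" "i \<noteq> j"
  shows "w_elt l \<alpha> j (\<alpha> i) \<bullet> \<rho> < 0"
  using pos_nonneg_inner[OF w_elt(2)[OF assms(2,3)] assms(1)] by simp

lemma omega_refl_group: "omega_elt l \<alpha> j \<in> refl_group \<alpha> {1..l}"
  unfolding omega_elt_def using refl_group_comp[of "{1..l}"] w_elt_in_group by simp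

end

section \<open>Averaging and recognition of root systems\<close>

lemma funpow_invariant: "f ` A \<subseteq> A \<Longrightarrow> x \<in> A \<Longrightarrow> (f ^^ n) x \<in> A"
  by (induction n) auto

lemma linear_funpow:
  fixes f :: "'a::real_vector \<Rightarrow> 'a"
  shows "linear f \<Longrightarrow> linear (f ^^ n)"
proof (induction n)
  case 0
  show ?case by (simp add: linear_iff)
next
  case (Suc n)
  then have "linear (f \<circ> f ^^ n)" using linear_compose by blast
  then show ?case by (simp add: comp_def)
qed

lemma finite_order_if_invariant:
  fixes f :: "'a::euclidean_space \<Rightarrow> 'a"
  assumes "linear f" "inj f" "finite \<Phi>" "span \<Phi> = UNIV" "f ` \<Phi> \<subseteq> \<Phi>"
  shows "\<exists>k>0. f ^^ k = id"
proof -
  have "range (\<lambda>n. restrict (f ^^ n) \<Phi>) \<subseteq> \<Phi> \<rightarrow>\<^sub>E \<Phi>"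
    using funpow_invariant[OF assms(5)] by auto
  then have "finite (range (\<lambda>n. restrict (f ^^ n) \<Phi>))"
    by (rule finite_subset) (simp add: finite_PiE assms(3))
  then have "\<not> inj (\<lambda>n. restrict (f ^^ n) \<Phi>)"
    using finite_imageD infinite_UNIV_nat by blast
  then obtain a b where "restrict (f ^^ a) \<Phi> = restrict (f ^^ b) \<Phi>" "a < b"
    unfolding inj_def by (metis nat_neq_iff)
  then have eq: "(f ^^ a) x = (f ^^ b) x" if "x \<in> \<Phi>" for x
    using that by (metis restrict_apply')
  have "f ^^ (b - a) = id"
  proof
    fix x
    have "(f ^^ (b - a)) x = id x"
    proof (rule linear_eq_on_span[of "f ^^ (b - a)" id \<Phi> x])
      show "linear (f ^^ (b - a))" by (rule linear_funpow[OF assms(1)])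
      show "linear (id :: 'a \<Rightarrow> 'a)" by (simp add: linear_iff)
      fix y assume y: "y \<in> \<Phi>"
      have "(f ^^ a) ((f ^^ (b - a)) y) = (f ^^ a) y"
        using eq[OF y] \<open>a < b\<close> by (metis comp_apply funpow_add le_add_diff_inverse less_imp_le)
      moreover have "inj (f ^^ a)" using assms(2) by (rule inj_fn)
      ultimately show "(f ^^ (b - a)) y = id y" by (simp add: inj_eq)
    qed (use assms(4) in auto)
    then show "(f ^^ (b - a)) x = id x" .
  qed
  with \<open>a < b\<close> show ?thesis by (intro exI[of _ "b - a"]) simp
qed

locale finite_order_map =
  fixes \<omega> :: "'a::euclidean_space \<Rightarrow> 'a"
  assumes lin: "linear \<omega>" and fin: "\<exists>k>0. \<omega> ^^ k = id"
begin

lemma map_order_pos: "0 < map_order \<omega>" and funpow_map_order: "\<omega> ^^ map_order \<omega> = id"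
proof -
  have "0 < map_order \<omega> \<and> \<omega> ^^ map_order \<omega> = id"
    unfolding map_order_def using LeastI_ex[OF fin] .
  then show "0 < map_order \<omega>" "\<omega> ^^ map_order \<omega> = id" by auto
qed

lemma average_add: "average \<omega> (x + y) = average \<omega> x + average \<omega> y"
  by (simp add: average_def linear_add[OF linear_funpow[OF lin]] sum.distrib scaleR_add_right)

lemma average_scaleR: "average \<omega> (c *\<^sub>R x) = c *\<^sub>R average \<omega> x"
  by (simp add: average_def linear_cmul[OF linear_funpow[OF lin]] scaleR_sum_right[symmetric])

lemma linear_average: "linear (average \<omega>)"
  by (rule linearI) (simp_all add: average_add average_scaleR)

lemma average_shift: "(\<Sum>t=1..map_order \<omega>. (\<omega> ^^ Suc t) x) = (\<Sum>t=1..map_order \<omega>. (\<omega> ^^ t) x)"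
proof -
  let ?N = "map_order \<omega>"
  have "(\<Sum>t=1..?N. (\<omega> ^^ Suc t) x) = (\<Sum>t=Suc 1..Suc ?N. (\<omega> ^^ t) x)"
    by (rule sum.shift_bounds_cl_Suc_ivl[symmetric])
  also have "\<dots> + \<omega> x = (\<Sum>t=1..Suc ?N. (\<omega> ^^ t) x)"
    using map_order_pos by (subst (2) sum.atLeast_Suc_atMost) (simp_all add: add.commute One_nat_def)
  also have "\<dots> = (\<Sum>t=1..?N. (\<omega> ^^ t) x) + \<omega> x"
    using map_order_pos funpow_map_order by (simp add: fun_eq_iff)
  finally show ?thesis by simp
qed

lemma map_average: "\<omega> (average \<omega> x) = average \<omega> x"
  using average_shift[of x] by (simp add: average_def linear_cmul[OF lin] linear_sum[OF lin])

lemma average_map: "average \<omega> (\<omega> x) = average \<omega> x"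
  using average_shift[of x] by (simp add: average_def funpow_swap1)

lemma average_fixed: "\<omega> x = x \<Longrightarrow> average \<omega> x = x"
proof -
  assume x: "\<omega> x = x"
  have "(\<omega> ^^ t) x = x" for t by (induction t) (simp_all add: x)
  then show ?thesis using map_order_pos by (simp add: average_def sum_constant_scaleR)
qed

lemma average_funpow: "average \<omega> ((\<omega> ^^ t) x) = average \<omega> x"
  by (induction t) (simp_all add: average_map)

lemma average_eq:
  assumes "(\<omega> ^^ k) x = x" "0 < k"
  shows "average \<omega> x = (1 / real k) *\<^sub>R (\<Sum>t<k. (\<omega> ^^ t) x)" (is "_ = ?y")
proof -
  obtain m where k: "k = Suc m" using assms(2) gr0_implies_Suc by blast
  have "(\<Sum>t<k. (\<omega> ^^ Suc t) x) + (\<omega> ^^ 0) x = (\<Sum>t<Suc k. (\<omega> ^^ t) x)"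
    by (subst sum.lessThan_Suc_shift) (simp add: add.commute)
  then have "(\<Sum>t<k. (\<omega> ^^ Suc t) x) = (\<Sum>t<k. (\<omega> ^^ t) x)"
    using assms(1) by simp
  then have "\<omega> ?y = ?y" by (simp add: linear_cmul[OF lin] linear_sum[OF lin])
  then have "?y = average \<omega> ?y" by (rule average_fixed[symmetric])
  also have "\<dots> = average \<omega> x"
    using assms(2) by (simp add: average_scaleR linear_sum[OF linear_average] average_funpow
      sum_constant_scaleR)
  finally show ?thesis ..
qed

lemma average_involution: "\<omega> (\<omega> x) = x \<Longrightarrow> average \<omega> x = (1 / 2) *\<^sub>R (x + \<omega> x)"
  using average_eq[of 2 x] by (simp add: numeral_2_eq_2)

lemma fixed_space_eq_range: "fixed_space \<omega> = range (average \<omega>)"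
  by (auto simp: fixed_space_def map_average) (metis average_fixed rangeI)

lemma span_Phi_re:
  assumes "span \<Phi> = UNIV"
  shows "span (Phi_re \<omega> \<Phi>) = fixed_space \<omega>"
proof -
  have "Phi_re \<omega> \<Phi> = average \<omega> ` \<Phi> - {0}" by (auto simp: Phi_re_def)
  then have "span (Phi_re \<omega> \<Phi>) = span (average \<omega> ` \<Phi>)" by simp
  also have "\<dots> = average \<omega> ` span \<Phi>" by (rule span_linear_image[OF linear_average])
  finally show ?thesis by (simp add: assms fixed_space_eq_range)
qed

end

lemma cartan_number_add: "cartan_number (x + y) b = cartan_number x b + cartan_number y b"
  by (simp add: cartan_number_def inner_add_left add_divide_distrib algebra_simps)

lemma cartan_number_sum: "cartan_number (\<Sum>i\<in>A. f i) b = (\<Sum>i\<in>A. cartan_number (f i) b)"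
  by (simp add: cartan_number_def inner_sum_left sum_distrib_left sum_divide_distrib)

lemma cartan_number_scaleR: "cartan_number (c *\<^sub>R x) b = c * cartan_number x b"
  by (simp add: cartan_number_def)

lemma cartan_number_minus: "cartan_number (- x) b = - cartan_number x b"
  by (simp add: cartan_number_def)

lemma indep_comb_eq:
  fixes \<delta> :: "nat \<Rightarrow> 'a::euclidean_space"
  assumes "independent (\<delta> ` {1..r})" "inj_on \<delta> {1..r}" "i \<in> {1..r}"
    and "c *\<^sub>R \<delta> i = (\<Sum>k=1..r. d k *\<^sub>R \<delta> k)"
  shows "c = d i"
proof -
  obtain x where x: "\<And>k. k \<in> {1..r} \<Longrightarrow> x \<bullet> \<delta> k = (if k = i then 1 else 0)"
    using dual_vectors[OF assms(1,2), of "\<lambda>k. if k = i then 1 else 0"] by blast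
  have "c = x \<bullet> (c *\<^sub>R \<delta> i)" using x assms(3) by simp
  also have "\<dots> = (\<Sum>k=1..r. d k * (x \<bullet> \<delta> k))" unfolding assms(4) by (simp add: inner_sum_right)
  also have "\<dots> = (\<Sum>k=1..r. if k = i then d k else 0)" by (intro sum.cong) (auto simp: x)
  finally show ?thesis using assms(3) by simp
qed

lemma has_typeI:
  fixes \<delta> :: "nat \<Rightarrow> 'a::euclidean_space"
  assumes R: "R = orb \<delta> r" and fin: "finite R" and r: "r = dynkin_rank X"
    and cartan: "\<And>i j. i \<in> {1..r} \<Longrightarrow> j \<in> {1..r} \<Longrightarrow>
      cartan_number (\<delta> i) (\<delta> j) = of_int (cartan_matrix X i j)"
    and indep: "independent (\<delta> ` {1..r})" "inj_on \<delta> {1..r}"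
    and comb: "\<And>x. x \<in> R \<Longrightarrow>
      \<exists>c :: nat \<Rightarrow> nat. x = (\<Sum>i=1..r. real (c i) *\<^sub>R \<delta> i) \<or> x = - (\<Sum>i=1..r. real (c i) *\<^sub>R \<delta> i)"
    and V: "span R = V"
  shows "has_type V R X"
proof -
  have \<delta>0: "\<delta> i \<noteq> 0" if "i \<in> {1..r}" for i
    using indep(1) that dependent_zero by (metis imageI)
  have \<delta>R: "\<delta> i \<in> R" if "i \<in> {1..r}" for i using that R by (auto intro: orb.intros)
  have word: "refl_word \<delta> is x \<in> R" if "set is \<subseteq> {1..r}" "x \<in> R" for "is" x
    using that R refl_word_orb by blast
  have zero: "0 \<notin> R"
  proof
    assume "0 \<in> R"
    then obtain "is" i where "i \<in> {1..r}" "0 = refl_word \<delta> is (\<delta> i)"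
      unfolding R by (elim orb_word) blast
    then have "\<delta> i = 0"
      by (metis inner_eq_zero_iff refl_word_inner inner_zero_left)
    then show False using \<delta>0 \<open>i \<in> {1..r}\<close> by blast
  qed
  have int: "cartan_number x (\<delta> j) \<in> \<int>" if "x \<in> R" "j \<in> {1..r}" for x j
  proof -
    have "cartan_number (\<Sum>i=1..r. real (c i) *\<^sub>R \<delta> i) (\<delta> j) \<in> \<int>" for c :: "nat \<Rightarrow> nat"
      unfolding cartan_number_sum cartan_number_scaleR
      by (intro Ints_sum Ints_mult) (use cartan that(2) in auto)
    then show ?thesis using comb[OF that(1)] by (auto simp: cartan_number_minus)
  qed
  have refl: "reflection a b \<in> R" and cart: "cartan_number b a \<in> \<int>" if a: "a \<in> R" and b: "b \<in> R" for a b
  proof -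
    obtain "is" i where i: "set is \<subseteq> {1..r}" "i \<in> {1..r}" "a = refl_word \<delta> is (\<delta> i)"
      using a unfolding R by (elim orb_word) blast
    have b': "refl_word \<delta> (rev is) b \<in> R" using word b i(1) by simp
    then have "reflection (\<delta> i) (refl_word \<delta> (rev is) b) \<in> R"
      using i(2) orb.orb_reflection unfolding R by blast
    then show "reflection a b \<in> R"
      unfolding i(3) reflection_refl_word using word i(1) by blast
    show "cartan_number b a \<in> \<int>"
      unfolding i(3) cartan_number_refl_word using int[OF b' i(2)] .
  qed
  have mult: "c \<in> \<int>" if "a \<in> R" "c *\<^sub>R a \<in> R" for a c
  proof -
    obtain "is" i where i: "set is \<subseteq> {1..r}" "i \<in> {1..r}" "a = refl_word \<delta> is (\<delta> i)"
      using \<open>a \<in> R\<close> unfolding R by (elim orb_word) blast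
    have "refl_word \<delta> (rev is) (c *\<^sub>R a) \<in> R" using word that(2) i(1) by simp
    then have cR: "c *\<^sub>R \<delta> i \<in> R"
      by (simp add: i(3) linear_cmul[OF linear_refl_word] refl_word_rev)
    then obtain d :: "nat \<Rightarrow> nat" where
      "c *\<^sub>R \<delta> i = (\<Sum>i=1..r. real (d i) *\<^sub>R \<delta> i) \<or> c *\<^sub>R \<delta> i = - (\<Sum>i=1..r. real (d i) *\<^sub>R \<delta> i)"
      using comb[OF cR] by blast
    moreover have "- (\<Sum>i=1..r. real (d i) *\<^sub>R \<delta> i) = (\<Sum>i=1..r. (- real (d i)) *\<^sub>R \<delta> i)"
      by (simp add: sum_negf)
    ultimately have "c = real (d i) \<or> c = - real (d i)"
      using indep_comb_eq[OF indep i(2)] by metis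
    then show ?thesis by auto
  qed
  have red: "c = 1 \<or> c = -1" if "a \<in> R" "c *\<^sub>R a \<in> R" for a c
  proof -
    have c0: "c \<noteq> 0" using that zero by auto
    have "(1 / c) *\<^sub>R (c *\<^sub>R a) \<in> R" using that c0 by simp
    then have "1 / c \<in> \<int>" "c \<in> \<int>" using mult that by blast+
    then obtain m n :: int where mn: "c = of_int m" "1 / c = of_int n" by (auto elim!: Ints_cases)
    then have "real_of_int (m * n) = 1" using c0 by (metis nonzero_mult_div_cancel_left of_int_mult times_divide_eq_right mult.right_neutral)
    then have "m * n = 1" by linarith
    then have "m = 1 \<or> m = -1" using zmult_eq_1_iff by auto
    then show ?thesis using mn by auto
  qed
  have "R \<subseteq> span (\<delta> ` {1..r})"
  proof
    fix x assume "x \<in> R"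
    have "(\<Sum>i=1..r. real (c i) *\<^sub>R \<delta> i) \<in> span (\<delta> ` {1..r})" for c :: "nat \<Rightarrow> nat"
      by (intro span_sum span_scale span_base) simp
    then show "x \<in> span (\<delta> ` {1..r})" using comb[OF \<open>x \<in> R\<close>] span_neg by auto
  qed
  then have sp: "span (\<delta> ` {1..r}) = V"
    unfolding V[symmetric] using \<delta>R by (intro span_eq[THEN iffD2] conjI) (auto intro: span_base)
  have "root_system V R" unfolding root_system_def using fin zero V refl cart by blast
  moreover have "reduced_rs R" unfolding reduced_rs_def using red by blast
  moreover have "bourbaki_basis V R X \<delta>"
    unfolding bourbaki_basis_def root_basis_def r[symmetric]
    using \<delta>R indep sp comb cartan by auto
  ultimately show ?thesis unfolding has_type_def by blast
qed

lemma independent_if_dual: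
  fixes \<delta> :: "nat \<Rightarrow> 'a::euclidean_space"
  assumes "\<And>i k. i \<in> {1..r} \<Longrightarrow> k \<in> {1..r} \<Longrightarrow> \<delta> i \<bullet> \<mu> k = 0 \<longleftrightarrow> i \<noteq> k"
  shows "inj_on \<delta> {1..r}" and "independent (\<delta> ` {1..r})"
proof -
  show inj: "inj_on \<delta> {1..r}"
  proof (rule inj_onI)
    fix i k assume "i \<in> {1..r}" "k \<in> {1..r}" "\<delta> i = \<delta> k"
    then show "i = k" using assms[of i k] assms[of k k] by auto
  qed
  show "independent (\<delta> ` {1..r})"
  proof (rule independent_if_scalars_zero)
    fix f x assume s: "(\<Sum>x\<in>\<delta> ` {1..r}. f x *\<^sub>R x) = 0" and "x \<in> \<delta> ` {1..r}"
    then obtain k where k: "k \<in> {1..r}" "x = \<delta> k" by blast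
    have "0 = (\<Sum>i=1..r. f (\<delta> i) *\<^sub>R \<delta> i) \<bullet> \<mu> k" using s by (simp add: sum.reindex[OF inj])
    also have "\<dots> = (\<Sum>i=1..r. if i = k then f (\<delta> k) * (\<delta> k \<bullet> \<mu> k) else 0)"
      unfolding inner_sum_left by (intro sum.cong) (use assms[OF _ k(1)] in auto)
    finally show "f x = 0" using k assms[OF k(1) k(1)] by simp
  qed simp
qed

section \<open>Classical root systems\<close>

lemma reflection_scale: "k \<noteq> 0 \<Longrightarrow> reflection (k *\<^sub>R a) x = reflection a x"
  by (simp add: reflection_def divide_simps)

lemma int_abs_eq_iff: "\<bar>a\<bar> = \<bar>b\<bar> \<longleftrightarrow> a = b \<or> a = - b" for a b :: int
  by linarith

definition ncomb :: "(nat \<Rightarrow> 'a::real_vector) \<Rightarrow> nat \<Rightarrow> 'a set" where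
  "ncomb \<delta> r = {\<Sum>i=1..r. real (c i) *\<^sub>R \<delta> i | c :: nat \<Rightarrow> nat. True}"

lemma ncomb_iff: "x \<in> ncomb \<delta> r \<longleftrightarrow> (\<exists>c :: nat \<Rightarrow> nat. x = (\<Sum>i=1..r. real (c i) *\<^sub>R \<delta> i))"
  by (auto simp: ncomb_def)

lemma ncomb_0: "0 \<in> ncomb \<delta> r"
  unfolding ncomb_iff by (rule exI[of _ "\<lambda>_. 0"]) simp

lemma ncomb_add: "x \<in> ncomb \<delta> r \<Longrightarrow> y \<in> ncomb \<delta> r \<Longrightarrow> x + y \<in> ncomb \<delta> r"
proof -
  assume "x \<in> ncomb \<delta> r" "y \<in> ncomb \<delta> r"
  then obtain c d :: "nat \<Rightarrow> nat" where
    "x = (\<Sum>i=1..r. real (c i) *\<^sub>R \<delta> i)" "y = (\<Sum>i=1..r. real (d i) *\<^sub>R \<delta> i)"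
    by (auto simp: ncomb_iff)
  then have "x + y = (\<Sum>i=1..r. real (c i + d i) *\<^sub>R \<delta> i)"
    by (simp add: scaleR_add_left sum.distrib)
  then show ?thesis unfolding ncomb_iff by (rule exI[of _ "\<lambda>i. c i + d i"])
qed

lemma ncomb_simple: "i \<in> {1..r} \<Longrightarrow> \<delta> i \<in> ncomb \<delta> r"
proof -
  assume i: "i \<in> {1..r}"
  have "\<delta> i = (\<Sum>k=1..r. if i = k then \<delta> k else 0)" using i by simp
  also have "\<dots> = (\<Sum>k=1..r. real (if i = k then 1 else 0) *\<^sub>R \<delta> k)" by (intro sum.cong) auto
  finally show ?thesis unfolding ncomb_iff by (rule exI[of _ "\<lambda>k. if i = k then 1 else 0"])
qed

text \<open>The Gram matrix of orthogonal vectors of squared norm \<open>c\<close> (\<open>d = 0\<close>), and of their projections to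
  the complement of their sum (\<open>d < 0\<close>), as in the usual coordinates for type \<open>A\<close>.\<close>

definition simplex_family :: "(nat \<Rightarrow> 'a::euclidean_space) \<Rightarrow> nat \<Rightarrow> real \<Rightarrow> real \<Rightarrow> bool" where
  "simplex_family e r c d \<longleftrightarrow>
     c > 0 \<and> (\<forall>i\<in>{1..r}. \<forall>k\<in>{1..r}. e i \<bullet> e k = d + (if i = k then c else 0))"

abbreviation orthogonal_family :: "(nat \<Rightarrow> 'a::euclidean_space) \<Rightarrow> nat \<Rightarrow> real \<Rightarrow> bool" where
  "orthogonal_family e r c \<equiv> simplex_family e r c 0"

lemma simplex_familyD:
  "simplex_family e r c d \<Longrightarrow> i \<in> {1..r} \<Longrightarrow> k \<in> {1..r} \<Longrightarrow> e i \<bullet> e k = d + (if i = k then c else 0)"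
  by (simp add: simplex_family_def)

lemma reflection_diff_family:
  assumes f: "simplex_family e r c d" and "k \<in> {1..r}" "m \<in> {1..r}" "k \<noteq> m" "x \<in> {1..r}"
  shows "reflection (e k - e m) (e x) = (if x = k then e m else if x = m then e k else e x)"
proof -
  have "(e k - e m) \<bullet> (e k - e m) = 2 * c" "c > 0"
    using f assms(2-4) by (auto simp: simplex_familyD[OF f] inner_diff_left inner_diff_right simplex_family_def)
  moreover have "e x \<bullet> (e k - e m) = (if x = k then c else if x = m then - c else 0)"
    using assms by (auto simp: simplex_familyD[OF f] inner_diff_right)
  ultimately show ?thesis by (auto simp: reflection_def)
qed

definition chain_system :: "(nat \<Rightarrow> 'a::euclidean_space) \<Rightarrow> 'a \<Rightarrow> nat \<Rightarrow> nat \<Rightarrow> 'a" where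
  "chain_system e z r i = (if i < r then e i - e (Suc i) else z)"

lemma diff_in_orb:
  assumes f: "simplex_family e m c d" and \<delta>: "\<And>j. 1 \<le> j \<Longrightarrow> j < m \<Longrightarrow> \<delta> j = e j - e (Suc j)"
    and "m \<le> Suc r" "1 \<le> i"
  shows "i < k \<Longrightarrow> k \<le> m \<Longrightarrow> e i - e k \<in> orb \<delta> r"
proof (induction k)
  case (Suc k)
  show ?case
  proof (cases "i = k")
    case True
    then have "e i - e (Suc k) = \<delta> i" using \<delta> assms(4) Suc.prems by simp
    moreover have "i \<in> {1..r}" using assms(3,4) Suc.prems by auto
    ultimately show ?thesis by (metis orb_simple)
  next
    case False
    then have "e i - e k \<in> orb \<delta> r" "k \<in> {1..r}" using Suc assms by auto
    then have "reflection (\<delta> k) (e i - e k) \<in> orb \<delta> r" by (rule orb.intros)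
    moreover have "reflection (\<delta> k) (e i - e k) = e i - e (Suc k)"
      using Suc.prems False assms(4)
      by (simp add: \<delta> reflection_diff reflection_diff_family[OF f])
    ultimately show ?thesis by simp
  qed
qed simp

lemma plus_in_orb:
  assumes f: "simplex_family e m c d" and \<delta>: "\<And>j. 1 \<le> j \<Longrightarrow> j < m \<Longrightarrow> \<delta> j = e j - e (Suc j)"
    and "m \<le> Suc r" "1 \<le> i" and top: "e i + e m \<in> orb \<delta> r" and "i < k" "k \<le> m"
  shows "e i + e k \<in> orb \<delta> r"
  using \<open>k \<le> m\<close> \<open>i < k\<close>
proof (induction k rule: inc_induct)
  case base
  show ?case by (rule top)
next
  case (step k)
  then have "e i + e (Suc k) \<in> orb \<delta> r" "k \<in> {1..r}" using assms by auto
  then have "reflection (\<delta> k) (e i + e (Suc k)) \<in> orb \<delta> r" by (rule orb.intros)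
  moreover have "reflection (\<delta> k) (e i + e (Suc k)) = e i + e k"
    using step assms(4)
    by (simp add: \<delta> reflection_add reflection_diff_family[OF f])
  ultimately show ?case by simp
qed

lemma single_in_orb:
  assumes f: "simplex_family e m c d" and \<delta>: "\<And>j. 1 \<le> j \<Longrightarrow> j < m \<Longrightarrow> \<delta> j = e j - e (Suc j)"
    and "m \<le> Suc r" and top: "s *\<^sub>R e m \<in> orb \<delta> r" and "1 \<le> k" "k \<le> m"
  shows "s *\<^sub>R e k \<in> orb \<delta> r"
  using \<open>k \<le> m\<close> \<open>1 \<le> k\<close>
proof (induction k rule: inc_induct)
  case base
  show ?case by (rule top)
next
  case (step k)
  then have "s *\<^sub>R e (Suc k) \<in> orb \<delta> r" "k \<in> {1..r}" using assms by auto
  then have "reflection (\<delta> k) (s *\<^sub>R e (Suc k)) \<in> orb \<delta> r" by (rule orb.intros)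
  moreover have "reflection (\<delta> k) (s *\<^sub>R e (Suc k)) = s *\<^sub>R e k"
    using step by (simp add: \<delta> reflection_scaleR reflection_diff_family[OF f])
  ultimately show ?case by simp
qed

lemma diff_in_ncomb:
  assumes \<delta>: "\<And>j. 1 \<le> j \<Longrightarrow> j < m \<Longrightarrow> \<delta> j = e j - e (Suc j)" and "m \<le> Suc r" "1 \<le> i"
  shows "i \<le> k \<Longrightarrow> k \<le> m \<Longrightarrow> e i - e k \<in> ncomb \<delta> r"
proof (induction k rule: dec_induct)
  case base
  show ?case by (simp add: ncomb_0)
next
  case (step k)
  then have "e i - e k + \<delta> k \<in> ncomb \<delta> r"
    using assms by (intro ncomb_add ncomb_simple) auto
  then show ?case using step assms by simp
qed

lemma partial_sum_dual:
  assumes f: "simplex_family e m c d" and "i \<in> {1..m}" "k \<le> m"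
  shows "e i \<bullet> (\<Sum>j=1..k. e j) = real k * d + (if i \<le> k then c else 0)"
proof -
  have "e i \<bullet> (\<Sum>j=1..k. e j) = (\<Sum>j=1..k. d + (if i = j then c else 0))"
    unfolding inner_sum_right
    by (rule sum.cong[OF refl], rule simplex_familyD[OF f]) (use assms in auto)
  then show ?thesis using assms by (simp add: sum.distrib)
qed

definition differences :: "(nat \<Rightarrow> 'a::ab_group_add) \<Rightarrow> nat \<Rightarrow> 'a set" where
  "differences e m = {e a - e b | a b. a \<in> {1..m} \<and> b \<in> {1..m} \<and> a \<noteq> b}"

lemma orb_A:
  assumes f: "simplex_family e (Suc r) c d" and \<delta>: "\<And>j. 1 \<le> j \<Longrightarrow> j < Suc r \<Longrightarrow> \<delta> j = e j - e (Suc j)"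
  shows "orb \<delta> r = differences e (Suc r)"
proof
  show "orb \<delta> r \<subseteq> differences e (Suc r)"
  proof
    fix x assume "x \<in> orb \<delta> r"
    then show "x \<in> differences e (Suc r)"
    proof induction
      case (orb_simple i)
      then show ?case unfolding differences_def
        by (intro CollectI exI[of _ i] exI[of _ "Suc i"]) (auto simp: \<delta>)
    next
      case (orb_reflection x i)
      then obtain a b where x: "x = e a - e b" "a \<in> {1..Suc r}" "b \<in> {1..Suc r}" "a \<noteq> b"
        by (auto simp: differences_def)
      let ?t = "\<lambda>y. if y = i then Suc i else if y = Suc i then i else y"
      have i: "\<delta> i = e i - e (Suc i)" "i \<in> {1..Suc r}" "Suc i \<in> {1..Suc r}"
        using orb_reflection(2) \<delta>[of i] by auto
      have "reflection (\<delta> i) x = e (?t a) - e (?t b)"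
        unfolding i(1) x(1) reflection_diff
        using reflection_diff_family[OF f i(2,3) _ x(2)] reflection_diff_family[OF f i(2,3) _ x(3)]
        by simp
      moreover have "?t a \<in> {1..Suc r}" "?t b \<in> {1..Suc r}" "?t a \<noteq> ?t b" using i x by auto
      ultimately show ?case unfolding differences_def by blast
    qed
  qed
  show "differences e (Suc r) \<subseteq> orb \<delta> r"
  proof
    fix x assume "x \<in> differences e (Suc r)"
    then obtain a b where x: "x = e a - e b" "a \<in> {1..Suc r}" "b \<in> {1..Suc r}" "a \<noteq> b"
      by (auto simp: differences_def)
    show "x \<in> orb \<delta> r"
    proof (cases "a < b")
      case True
      then show ?thesis using diff_in_orb[OF f \<delta>, of r a b] x by auto
    next
      case False
      then have "e b - e a \<in> orb \<delta> r" using diff_in_orb[OF f \<delta>, of r b a] x by auto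
      from orb_minus[OF this] show ?thesis using x by simp
    qed
  qed
qed

lemma finite_differences: "finite (differences e m)"
proof -
  have "differences e m \<subseteq> (\<lambda>(a, b). e a - e b) ` ({1..m} \<times> {1..m})"
    by (auto simp: differences_def)
  then show ?thesis by (rule finite_subset) simp
qed

lemma chain_cartan:
  assumes f: "simplex_family e m c d" and "i \<in> {1..<m}" "k \<in> {1..<m}"
  shows "cartan_number (e i - e (Suc i)) (e k - e (Suc k)) = of_int (chain i k)"
proof -
  have "c > 0" using f by (simp add: simplex_family_def)
  then show ?thesis
    using assms by (auto simp: cartan_number_def inner_diff_left inner_diff_right simplex_familyD[OF f]
      simply_laced_def)
qed

lemma has_type_A:
  assumes f: "simplex_family e (Suc r) c d"
  shows "has_type (span (differences e (Suc r))) (differences e (Suc r)) (Type_A r)"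
proof -
  define \<delta> where "\<delta> = (\<lambda>j. e j - e (Suc j))"
  show ?thesis
  proof (rule has_typeI)
    show "differences e (Suc r) = orb \<delta> r" using orb_A[OF f, of \<delta>] by (simp add: \<delta>_def)
    show "cartan_number (\<delta> i) (\<delta> j) = of_int (cartan_matrix (Type_A r) i j)"
      if "i \<in> {1..r}" "j \<in> {1..r}" for i j
      using chain_cartan[OF f, of i j] that by (simp add: \<delta>_def)
    have "\<delta> i \<bullet> (\<Sum>j=1..k. e j) = 0 \<longleftrightarrow> i \<noteq> k" if "i \<in> {1..r}" "k \<in> {1..r}" for i k
      using that f partial_sum_dual[OF f, of i k] partial_sum_dual[OF f, of "Suc i" k]
      by (auto simp: \<delta>_def inner_diff_left simplex_family_def)
    from independent_if_dual[OF this]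
    show "independent (\<delta> ` {1..r})" "inj_on \<delta> {1..r}" by auto
    fix x assume "x \<in> differences e (Suc r)"
    then obtain a b where x: "x = e a - e b" "a \<in> {1..Suc r}" "b \<in> {1..Suc r}"
      by (auto simp: differences_def)
    have "e a - e b \<in> ncomb \<delta> r \<or> e b - e a \<in> ncomb \<delta> r"
      using diff_in_ncomb[of "Suc r" \<delta> e r a b] diff_in_ncomb[of "Suc r" \<delta> e r b a] x
      by (cases "a \<le> b") (auto simp: \<delta>_def)
    then have "x \<in> ncomb \<delta> r \<or> - x \<in> ncomb \<delta> r" using x by simp
    then show "\<exists>c :: nat \<Rightarrow> nat. x = (\<Sum>i=1..r. real (c i) *\<^sub>R \<delta> i) \<or> x = - (\<Sum>i=1..r. real (c i) *\<^sub>R \<delta> i)"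
      unfolding ncomb_iff by (metis minus_minus)
  qed (simp_all add: finite_differences)
qed

text \<open>Signed indices: \<open>sg e (- i) = - e i\<close> and \<open>sg e 0 = 0\<close>.\<close>

definition sg :: "(nat \<Rightarrow> 'a::real_vector) \<Rightarrow> int \<Rightarrow> 'a" where
  "sg e a = of_int (sgn a) *\<^sub>R e (nat \<bar>a\<bar>)"

lemma sg_0 [simp]: "sg e 0 = 0" and sg_minus: "sg e (- a) = - sg e a"
  and sg_int: "0 < i \<Longrightarrow> sg e (int i) = e i"
  by (auto simp: sg_def sgn_if)

lemma sg_inner:
  assumes f: "orthogonal_family e r c" and "\<bar>a\<bar> \<le> int r" "\<bar>b\<bar> \<le> int r"
  shows "sg e a \<bullet> sg e b = (if a = 0 then 0 else if a = b then c else if a = - b then - c else 0)"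
proof (cases "a = 0 \<or> b = 0")
  case False
  then have "nat \<bar>a\<bar> \<in> {1..r}" "nat \<bar>b\<bar> \<in> {1..r}" using assms by auto
  from simplex_familyD[OF f this] have "e (nat \<bar>a\<bar>) \<bullet> e (nat \<bar>b\<bar>) = (if \<bar>a\<bar> = \<bar>b\<bar> then c else 0)"
    by (simp add: nat_eq_iff)
  then show ?thesis using False by (auto simp: sg_def sgn_if)
qed auto

definition rsums :: "(int \<Rightarrow> int \<Rightarrow> bool) \<Rightarrow> (nat \<Rightarrow> 'a::real_vector) \<Rightarrow> nat \<Rightarrow> 'a set" where
  "rsums P e r = {sg e a + sg e b | a b. \<bar>a\<bar> \<le> int r \<and> \<bar>b\<bar> \<le> int r \<and> P a b}"

lemma rsumsI: "P a b \<Longrightarrow> \<bar>a\<bar> \<le> int r \<Longrightarrow> \<bar>b\<bar> \<le> int r \<Longrightarrow> x = sg e a + sg e b \<Longrightarrow> x \<in> rsums P e r"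
  by (auto simp: rsums_def)

definition cond_B :: "int \<Rightarrow> int \<Rightarrow> bool" where "cond_B a b \<longleftrightarrow> \<bar>a\<bar> \<noteq> \<bar>b\<bar>"
definition cond_C :: "int \<Rightarrow> int \<Rightarrow> bool" where "cond_C a b \<longleftrightarrow> a \<noteq> 0 \<and> b \<noteq> 0 \<and> a \<noteq> - b"
definition cond_D :: "int \<Rightarrow> int \<Rightarrow> bool" where "cond_D a b \<longleftrightarrow> a \<noteq> 0 \<and> b \<noteq> 0 \<and> \<bar>a\<bar> \<noteq> \<bar>b\<bar>"
definition cond_BC :: "int \<Rightarrow> int \<Rightarrow> bool" where "cond_BC a b \<longleftrightarrow> a \<noteq> - b"

definition signed_perm :: "nat \<Rightarrow> (int \<Rightarrow> int) \<Rightarrow> bool" where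
  "signed_perm r p \<longleftrightarrow> inj p \<and> (\<forall>a. p (- a) = - p a) \<and> (\<forall>a. \<bar>a\<bar> \<le> int r \<longrightarrow> \<bar>p a\<bar> \<le> int r)"

lemma signed_perm_minus: "signed_perm r p \<Longrightarrow> p (- a) = - p a"
  and signed_perm_le: "signed_perm r p \<Longrightarrow> \<bar>a\<bar> \<le> int r \<Longrightarrow> \<bar>p a\<bar> \<le> int r"
  and signed_perm_eq_iff: "signed_perm r p \<Longrightarrow> p a = p b \<longleftrightarrow> a = b"
  by (auto simp: signed_perm_def inj_eq)

lemma signed_perm_0: "signed_perm r p \<Longrightarrow> p 0 = 0"
  using signed_perm_minus[of r p 0] by simp

lemma signed_perm_id: "signed_perm r id"
  by (simp add: signed_perm_def)

lemma signed_perm_comp: "signed_perm r p \<Longrightarrow> signed_perm r q \<Longrightarrow> signed_perm r (p \<circ> q)"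
  by (auto simp: signed_perm_def intro: inj_compose)

lemma signed_perm_cond:
  assumes "signed_perm r p"
  shows "cond_B a b \<Longrightarrow> cond_B (p a) (p b)" "cond_C a b \<Longrightarrow> cond_C (p a) (p b)"
    "cond_D a b \<Longrightarrow> cond_D (p a) (p b)" "cond_BC a b \<Longrightarrow> cond_BC (p a) (p b)"
proof -
  have "p x = 0 \<longleftrightarrow> x = 0" "p x = - p y \<longleftrightarrow> x = - y" "p x = p y \<longleftrightarrow> x = y" for x y
    using signed_perm_eq_iff[OF assms, of x 0] signed_perm_eq_iff[OF assms, of x "- y"]
      signed_perm_eq_iff[OF assms, of x y] signed_perm_0[OF assms] signed_perm_minus[OF assms, of y]
    by auto
  then show "cond_B a b \<Longrightarrow> cond_B (p a) (p b)" "cond_C a b \<Longrightarrow> cond_C (p a) (p b)"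
    "cond_D a b \<Longrightarrow> cond_D (p a) (p b)" "cond_BC a b \<Longrightarrow> cond_BC (p a) (p b)"
    by (auto simp: cond_B_def cond_C_def cond_D_def cond_BC_def int_abs_eq_iff)
qed

definition signed_swap :: "int \<Rightarrow> int \<Rightarrow> int \<Rightarrow> int" where
  "signed_swap p q a = (if a = p then q else if a = q then p
     else if a = - p then - q else if a = - q then - p else a)"

lemma signed_perm_swap:
  assumes "p \<noteq> 0" "q \<noteq> 0" "\<bar>p\<bar> \<le> int r" "\<bar>q\<bar> \<le> int r"
  shows "signed_perm r (signed_swap p q)"
proof -
  have "signed_swap p q (signed_swap p q a) = a" for a
    using assms by (auto simp: signed_swap_def)
  then have "inj (signed_swap p q)" by (metis injI)
  then show ?thesis using assms by (auto simp: signed_perm_def signed_swap_def)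
qed

lemma reflection_swap:
  assumes f: "orthogonal_family e r c" and "p \<noteq> 0" "q \<noteq> 0" "p \<noteq> q"
    and "\<bar>p\<bar> \<le> int r" "\<bar>q\<bar> \<le> int r" "\<bar>a\<bar> \<le> int r"
  shows "reflection (sg e p - sg e q) (sg e a) = sg e (signed_swap p q a)"
proof -
  have c: "c > 0" using f by (simp add: simplex_family_def)
  let ?v = "sg e p - sg e q"
  have vv: "?v \<bullet> ?v = (if p = - q then 4 * c else 2 * c)"
    using assms by (auto simp: inner_diff_left inner_diff_right sg_inner[OF f])
  have av: "sg e a \<bullet> ?v = sg e a \<bullet> sg e p - sg e a \<bullet> sg e q" by (simp add: inner_diff_right)
  show ?thesis
    unfolding reflection_def vv av
    using assms c by (auto simp: sg_inner[OF f] signed_swap_def sg_minus scaleR_2)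
qed

lemma reflection_sum:
  assumes f: "orthogonal_family e r c" and ab: "cond_BC a b" "\<bar>a\<bar> \<le> int r" "\<bar>b\<bar> \<le> int r"
  obtains (perm) p where "signed_perm r p" "\<And>x. \<bar>x\<bar> \<le> int r \<Longrightarrow> reflection (sg e a + sg e b) (sg e x) = sg e (p x)"
proof -
  have single: ?thesis if "y \<noteq> 0" "\<bar>y\<bar> \<le> int r" "sg e a + sg e b = sg e y" for y
  proof (rule perm)
    show "signed_perm r (signed_swap y (- y))" using that by (intro signed_perm_swap) auto
    fix x assume x: "\<bar>x\<bar> \<le> int r"
    have "reflection (sg e y - sg e (- y)) (sg e x) = sg e (signed_swap y (- y) x)"
      using that x by (intro reflection_swap[OF f]) auto
    moreover have "sg e y - sg e (- y) = 2 *\<^sub>R sg e y" by (simp add: sg_minus scaleR_2)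
    ultimately show "reflection (sg e a + sg e b) (sg e x) = sg e (signed_swap y (- y) x)"
      by (simp add: reflection_scale that)
  qed
  consider "a = 0" | "b = 0" | "a \<noteq> 0" "b \<noteq> 0" by blast
  then show ?thesis
  proof cases
    case 1
    then show ?thesis using single[of b] ab by (simp add: cond_BC_def)
  next
    case 2
    then show ?thesis using single[of a] ab by (simp add: cond_BC_def)
  next
    case 3
    show ?thesis
    proof (rule perm)
      show "signed_perm r (signed_swap a (- b))" using 3 ab by (intro signed_perm_swap) auto
      fix x assume "\<bar>x\<bar> \<le> int r"
      then show "reflection (sg e a + sg e b) (sg e x) = sg e (signed_swap a (- b) x)"
        using reflection_swap[OF f, of a "- b" x] 3 ab by (simp add: cond_BC_def sg_minus)
    qed
  qed
qed

definition good_cond :: "(int \<Rightarrow> int \<Rightarrow> bool) \<Rightarrow> bool" where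
  "good_cond P \<longleftrightarrow> (\<forall>r p a b. signed_perm r p \<longrightarrow> P a b \<longrightarrow> P (p a) (p b)) \<and>
     (\<forall>a b. P a b \<longrightarrow> P b a) \<and> (\<forall>a. \<not> P a (- a)) \<and> (\<forall>a b. P a b \<longrightarrow> cond_BC a b)"

lemma good_cond: "good_cond cond_B" "good_cond cond_C" "good_cond cond_D" "good_cond cond_BC"
  unfolding good_cond_def
  by (intro conjI allI impI; (erule (1) signed_perm_cond)?;
      auto simp: cond_B_def cond_C_def cond_D_def cond_BC_def)+

lemma sums_reflection:
  assumes f: "orthogonal_family e r c" and P: "good_cond P"
    and x: "x \<in> rsums cond_BC e r" and y: "y \<in> rsums P e r"
  shows "reflection x y \<in> rsums P e r"
proof -
  obtain a b where ab: "x = sg e a + sg e b" "cond_BC a b" "\<bar>a\<bar> \<le> int r" "\<bar>b\<bar> \<le> int r"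
    using x unfolding rsums_def by blast
  obtain p where p: "signed_perm r p" "\<And>x. \<bar>x\<bar> \<le> int r \<Longrightarrow> reflection (sg e a + sg e b) (sg e x) = sg e (p x)"
    using reflection_sum[OF f ab(2-4)] by blast
  obtain u v where uv: "y = sg e u + sg e v" "\<bar>u\<bar> \<le> int r" "\<bar>v\<bar> \<le> int r" "P u v"
    using y unfolding rsums_def by blast
  have "reflection x y = sg e (p u) + sg e (p v)"
    using p uv ab by (simp add: reflection_add)
  moreover have "P (p u) (p v)" using P p(1) uv(4) unfolding good_cond_def by blast
  ultimately show ?thesis
    unfolding rsums_def using signed_perm_le[OF p(1)] uv by blast
qed

lemma sums_BC_superset: "good_cond P \<Longrightarrow> rsums P e r \<subseteq> rsums cond_BC e r"
  unfolding rsums_def good_cond_def by blast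

lemma finite_sums: "finite (rsums P e r)"
proof -
  have "rsums P e r \<subseteq> (\<lambda>(a, b). sg e a + sg e b) ` ({- int r..int r} \<times> {- int r..int r})"
    by (auto simp: rsums_def abs_le_iff)
  then show ?thesis by (rule finite_subset) simp
qed

lemma sums_cases:
  assumes "x \<in> rsums P e r" and P: "good_cond P"
    and neg: "\<And>x. Q x \<Longrightarrow> Q (- x)"
    and plus: "\<And>i k. 1 \<le> i \<Longrightarrow> i < k \<Longrightarrow> k \<le> r \<Longrightarrow> P (int i) (int k) \<Longrightarrow> Q (e i + e k)"
    and minus: "\<And>i k. 1 \<le> i \<Longrightarrow> i < k \<Longrightarrow> k \<le> r \<Longrightarrow> Q (e i - e k)"
    and single: "\<And>k. 1 \<le> k \<Longrightarrow> k \<le> r \<Longrightarrow> P 0 (int k) \<Longrightarrow> Q (e k)"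
    and double: "\<And>k. 1 \<le> k \<Longrightarrow> k \<le> r \<Longrightarrow> P (int k) (int k) \<Longrightarrow> Q (2 *\<^sub>R e k)"
  shows "Q x"
proof -
  have sym: "P a b \<Longrightarrow> P b a" for a b using P by (auto simp: good_cond_def)
  have "signed_perm 0 uminus" by (simp add: signed_perm_def)
  then have negP: "P a b \<Longrightarrow> P (- a) (- b)" for a b using P unfolding good_cond_def by metis
  have anti: "\<not> P a (- a)" for a using P by (auto simp: good_cond_def)
  have nonneg: "Q (sg e a + sg e b)" if nn: "0 \<le> a" "a \<le> \<bar>b\<bar>" "\<bar>b\<bar> \<le> int r" "P a b" for a b
  proof -
    obtain i where i: "a = int i" using \<open>0 \<le> a\<close> by (metis nonneg_int_cases)
    obtain k where k: "b = int k \<or> b = - int k" by (metis int_cases2)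
    have k0: "0 < k" using that i k anti[of 0] by (cases "k = 0") auto
    show ?thesis
    proof (cases "i = 0")
      case True
      then have "P 0 (int k)" using that(4) i k negP[of 0 b] by auto
      then have "Q (e k)" using single k0 k that by auto
      then show ?thesis using neg[of "e k"] True i k k0 by (auto simp: sg_minus sg_int)
    next
      case False
      consider "i < k" | "i = k" using nn i k by force
      then show ?thesis
      proof cases
        case 1
        then have "Q (e i - e k)" using minus False k that by auto
        moreover have "Q (e i + e k)" if "b = int k"
          using plus[of i k] False k \<open>\<bar>b\<bar> \<le> int r\<close> \<open>P a b\<close> i 1 that by auto
        ultimately show ?thesis using i k False k0 by (auto simp: sg_minus sg_int)
      next
        case 2
        then have b: "b = int k" using k anti[of a] that(4) i by auto
        then have "Q (2 *\<^sub>R e k)" using double[of k] that i 2 k0 by auto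
        then show ?thesis using i b 2 k0 by (simp add: sg_int scaleR_2)
      qed
    qed
  qed
  have le: "Q (sg e a + sg e b)" if "\<bar>a\<bar> \<le> \<bar>b\<bar>" "\<bar>b\<bar> \<le> int r" "P a b" for a b
  proof (cases "0 \<le> a")
    case True
    then show ?thesis using nonneg that by simp
  next
    case False
    then have "Q (sg e (- a) + sg e (- b))" using nonneg[of "- a" "- b"] negP that by simp
    moreover have "- (sg e (- a) + sg e (- b)) = sg e a + sg e b" by (simp add: sg_minus)
    ultimately show ?thesis using neg by metis
  qed
  obtain a b where ab: "x = sg e a + sg e b" "\<bar>a\<bar> \<le> int r" "\<bar>b\<bar> \<le> int r" "P a b"
    using assms(1) unfolding rsums_def by blast
  show ?thesis
  proof (cases "\<bar>a\<bar> \<le> \<bar>b\<bar>")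
    case True
    then show ?thesis using le ab by simp
  next
    case False
    then have "Q (sg e b + sg e a)" using le[of b a] sym ab by simp
    then show ?thesis using ab(1) by (simp add: add.commute)
  qed
qed

lemma chain_in_sums:
  assumes P: "good_cond P" and d: "\<And>a b. cond_D a b \<Longrightarrow> P a b" and "1 \<le> i" "i < r"
  shows "e i - e (Suc i) \<in> rsums P e r"
proof -
  have "e i - e (Suc i) = sg e (int i) + sg e (- int (Suc i))"
    using assms(3) by (simp only: sg_minus) (simp add: sg_int del: of_nat_Suc)
  moreover have "P (int i) (- int (Suc i))" using assms by (intro d) (auto simp: cond_D_def)
  ultimately show ?thesis
    using assms(4) by (intro rsumsI[of P "int i" "- int (Suc i)"]) auto
qed

lemma orb_subset_sums:
  assumes f: "orthogonal_family e r c" and P: "good_cond P" and d: "\<And>a b. cond_D a b \<Longrightarrow> P a b"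
    and z: "z \<in> rsums P e r"
  shows "orb (chain_system e z r) r \<subseteq> rsums P e r"
proof
  have simple: "chain_system e z r i \<in> rsums P e r" if "i \<in> {1..r}" for i
    using that z chain_in_sums[OF P d, of i r e] by (auto simp: chain_system_def)
  fix x assume "x \<in> orb (chain_system e z r) r"
  then show "x \<in> rsums P e r"
    by induction (use simple sums_BC_superset[OF P, of e r] sums_reflection[OF f P] in blast)+
qed

lemma chain_system_diff: "1 \<le> j \<Longrightarrow> j < r \<Longrightarrow> chain_system e z r j = e j - e (Suc j)"
  and chain_system_last: "chain_system e z r r = z"
  by (simp_all add: chain_system_def)

lemma reflection_last:
  assumes f: "orthogonal_family e r c" and "k \<in> {1..r}" "i \<in> {1..r}" "s \<noteq> 0"
  shows "reflection (s *\<^sub>R e k) (e i) = (if i = k then - e k else e i)"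
  using assms by (auto simp: reflection_scale reflection_def simplex_familyD[OF f] simplex_family_def scaleR_2)

lemma plus_in_orb_single:
  assumes f: "orthogonal_family e r c" and "1 \<le> i" "i < k" "k \<le> r" "s \<noteq> 0"
  shows "e i + e k \<in> orb (chain_system e (s *\<^sub>R e r) r) r"
proof -
  let ?\<delta> = "chain_system e (s *\<^sub>R e r) r"
  have "e i - e r \<in> orb ?\<delta> r"
    by (rule diff_in_orb[OF f chain_system_diff]) (use assms in auto)
  then have "reflection (?\<delta> r) (e i - e r) \<in> orb ?\<delta> r" using assms by (intro orb.intros) auto
  moreover have "reflection (?\<delta> r) (e i - e r) = e i + e r"
    using assms by (simp add: chain_system_last reflection_diff reflection_last[OF f])
  ultimately show ?thesis
    using plus_in_orb[OF f chain_system_diff, where r = r] assms by auto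
qed

text \<open>Types \<open>B\<close> and \<open>C\<close> differ in the length of the last simple root only.\<close>

lemma orb_single:
  assumes f: "orthogonal_family e r c" and r: "1 \<le> r"
    and sP: "s = 1 \<and> P = cond_B \<or> s = 2 \<and> P = cond_C"
  shows "orb (chain_system e (s *\<^sub>R e r) r) r = rsums P e r"
proof
  have P: "good_cond P" using sP good_cond by auto
  have "s *\<^sub>R e r \<in> rsums P e r"
    using sP r by (auto simp: cond_B_def cond_C_def sg_int scaleR_2
      intro: rsumsI[of _ "int r" 0] rsumsI[of _ "int r" "int r"])
  then show "orb (chain_system e (s *\<^sub>R e r) r) r \<subseteq> rsums P e r"
    using sP by (intro orb_subset_sums[OF f P]) (auto simp: cond_B_def cond_C_def cond_D_def)
  let ?O = "orb (chain_system e (s *\<^sub>R e r) r) r"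
  have last: "s *\<^sub>R e r \<in> ?O"
    using orb_simple[of r r "chain_system e (s *\<^sub>R e r) r"] r by (simp add: chain_system_last)
  have single: "s *\<^sub>R e k \<in> ?O" if "1 \<le> k" "k \<le> r" for k
    by (rule single_in_orb[OF f chain_system_diff _ last]) (use that in auto)
  show "rsums P e r \<subseteq> ?O"
  proof
    fix x assume "x \<in> rsums P e r"
    then show "x \<in> ?O"
      using P
    proof (rule sums_cases)
      fix i k assume "1 \<le> i" "i < k" "k \<le> r"
      then show "e i + e k \<in> ?O" "e i - e k \<in> ?O"
        using plus_in_orb_single[OF f, of i k s] diff_in_orb[OF f chain_system_diff] sP by auto
    next
      fix k assume "1 \<le> k" "k \<le> r" "P 0 (int k)"
      then show "e k \<in> ?O" using single[of k] sP by (auto simp: cond_C_def)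
    next
      fix k assume "1 \<le> k" "k \<le> r" "P (int k) (int k)"
      then show "2 *\<^sub>R e k \<in> ?O" using single[of k] sP by (auto simp: cond_B_def)
    qed (rule orb_minus)
  qed
qed

lemma orb_D:
  assumes f: "orthogonal_family e r c" and "2 \<le> r"
  shows "orb (chain_system e (e (r - 1) + e r) r) r = rsums cond_D e r"
proof
  let ?z = "e (r - 1) + e r"
  have "?z = sg e (int (r - 1)) + sg e (int r)" using assms by (simp add: sg_int del: of_nat_diff)
  then have "?z \<in> rsums cond_D e r"
    using assms by (intro rsumsI[of _ "int (r - 1)" "int r"]) (auto simp: cond_D_def)
  then show "orb (chain_system e ?z r) r \<subseteq> rsums cond_D e r"
    by (intro orb_subset_sums[OF f] good_cond) (auto simp: cond_D_def)
  let ?O = "orb (chain_system e ?z r) r"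
  have z: "chain_system e ?z r r = ?z" by (simp add: chain_system_last)
  have top: "e i + e r \<in> ?O" if i: "1 \<le> i" "i < r" for i
  proof (cases "i = r - 1")
    case True
    then show ?thesis using orb_simple[of r r "chain_system e ?z r"] assms z by simp
  next
    case False
    then have "e i - e (r - 1) \<in> ?O"
      using i by (intro diff_in_orb[OF f chain_system_diff]) auto
    then have "reflection ?z (e i - e (r - 1)) \<in> ?O"
      using orb_reflection[of _ "chain_system e ?z r" r r] assms z by simp
    moreover have "reflection ?z (e i - e (r - 1)) = e i + e r"
    proof -
      have sw: "reflection ?z (e k) = sg e (signed_swap (int (r - 1)) (- int r) (int k))"
        if "k \<in> {1..r}" for k
        using reflection_swap[OF f, of "int (r - 1)" "- int r" "int k"] assms that
        by (simp add: sg_minus sg_int del: of_nat_diff)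
      show ?thesis
        unfolding reflection_diff using i False assms
        by (simp add: sw signed_swap_def sg_minus sg_int del: of_nat_diff)
    qed
    ultimately show ?thesis by simp
  qed
  show "rsums cond_D e r \<subseteq> ?O"
  proof
    fix x assume "x \<in> rsums cond_D e r"
    then show "x \<in> ?O"
    proof (rule sums_cases[OF _ good_cond(3)])
      fix i k assume ik: "1 \<le> i" "i < k" "k \<le> r"
      show "e i - e k \<in> ?O"
        by (rule diff_in_orb[OF f chain_system_diff]) (use ik in auto)
      have "e i + e r \<in> ?O" using top ik by simp
      then show "e i + e k \<in> ?O"
        by (rule plus_in_orb[OF f chain_system_diff, rotated 4]) (use ik in auto)
    qed (auto simp: cond_D_def intro: orb_minus)
  qed
qed

lemma chain_system_dual:
  assumes f: "orthogonal_family e r c" and s: "s \<noteq> 0" and "i \<in> {1..r}" "k \<in> {1..r}"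
  shows "chain_system e (s *\<^sub>R e r) r i \<bullet> (\<Sum>j=1..k. e j) = 0 \<longleftrightarrow> i \<noteq> k"
proof -
  have c: "c > 0" using f by (simp add: simplex_family_def)
  show ?thesis
  proof (cases "i < r")
    case True
    then show ?thesis
      using assms c partial_sum_dual[OF f, of i k] partial_sum_dual[OF f, of "Suc i" k]
      by (auto simp: chain_system_def inner_diff_left)
  next
    case False
    then show ?thesis
      using assms c partial_sum_dual[OF f, of r k] by (auto simp: chain_system_def)
  qed
qed

lemma ncomb_sums:
  assumes P: "good_cond P" and f: "orthogonal_family e r c" and x: "x \<in> rsums P e r"
    and s: "s *\<^sub>R e r = z" "s = 1 \<or> s = 2" "\<not> P 0 1 \<or> s = 1" and r: "1 \<le> r"
  shows "x \<in> ncomb (chain_system e z r) r \<or> - x \<in> ncomb (chain_system e z r) r"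
proof -
  let ?C = "ncomb (chain_system e z r) r"
  have diff: "e i - e k \<in> ?C" if "1 \<le> i" "i \<le> k" "k \<le> r" for i k
    by (rule diff_in_ncomb[OF chain_system_diff]) (use that in auto)
  have "z \<in> ?C" using ncomb_simple[of r r "chain_system e z r"] r by (simp add: chain_system_last)
  then have z2: "2 *\<^sub>R e r \<in> ?C"
    using s(1,2) ncomb_add[of "e r" "chain_system e z r" r "e r"] by (auto simp: scaleR_2)
  have plus: "e i + e k \<in> ?C" if "1 \<le> i" "i \<le> r" "1 \<le> k" "k \<le> r" for i k
  proof -
    have "(e i - e r) + (e k - e r) + 2 *\<^sub>R e r \<in> ?C"
      using that by (intro ncomb_add diff z2) auto
    then show ?thesis by (simp add: scaleR_2 algebra_simps)
  qed
  show ?thesis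
    using x P
  proof (rule sums_cases)
    fix k assume k: "1 \<le> k" "k \<le> r" "P 0 (int k)"
    have "signed_perm k (signed_swap (int k) 1)" using k by (intro signed_perm_swap) auto
    then have "P (signed_swap (int k) 1 0) (signed_swap (int k) 1 (int k))"
      using P k(3) unfolding good_cond_def by blast
    then have "P 0 1" using k by (simp add: signed_swap_def)
    then have "e r \<in> ?C" using s \<open>z \<in> ?C\<close> by auto
    then have "(e k - e r) + e r \<in> ?C" using k by (intro ncomb_add diff) auto
    then show "e k \<in> ?C \<or> - e k \<in> ?C" by simp
  next
    fix k assume "1 \<le> k" "k \<le> r"
    then show "2 *\<^sub>R e k \<in> ?C \<or> - (2 *\<^sub>R e k) \<in> ?C" using plus[of k k] by (simp add: scaleR_2)
  qed (use diff plus in auto)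
qed

lemma has_type_single:
  fixes s :: real
  assumes f: "orthogonal_family e r c" and r: "1 \<le> r"
    and sP: "s = 1 \<and> P = cond_B \<and> X = Type_B r \<or> s = 2 \<and> P = cond_C \<and> X = Type_C r"
  shows "has_type (span (rsums P e r)) (rsums P e r) X"
proof -
  let ?\<delta> = "chain_system e (s *\<^sub>R e r) r"
  have c: "c > 0" using f by (simp add: simplex_family_def)
  have P: "good_cond P" and s: "s = 1 \<or> s = 2" "s \<noteq> 0" "\<not> P 0 1 \<or> s = 1"
    using sP good_cond by (auto simp: cond_C_def)
  show ?thesis
  proof (rule has_typeI)
    show "rsums P e r = orb ?\<delta> r" using orb_single[OF f r] sP by blast
    show "r = dynkin_rank X" using sP by auto
    show "cartan_number (?\<delta> i) (?\<delta> j) = of_int (cartan_matrix X i j)"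
      if "i \<in> {1..r}" "j \<in> {1..r}" for i j
      using that c sP by (elim disjE) (auto simp: chain_system_def cartan_number_def simply_laced_def
        inner_diff_left inner_diff_right simplex_familyD[OF f])
    show "independent (?\<delta> ` {1..r})" "inj_on ?\<delta> {1..r}"
      using independent_if_dual[of r ?\<delta> "\<lambda>k. \<Sum>j=1..k. e j"] chain_system_dual[OF f s(2)] by auto
    fix x assume "x \<in> rsums P e r"
    then have "x \<in> ncomb ?\<delta> r \<or> - x \<in> ncomb ?\<delta> r"
      using ncomb_sums[OF P f _ refl s(1,3) r] by blast
    then show "\<exists>c :: nat \<Rightarrow> nat. x = (\<Sum>i=1..r. real (c i) *\<^sub>R ?\<delta> i) \<or> x = - (\<Sum>i=1..r. real (c i) *\<^sub>R ?\<delta> i)"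
      unfolding ncomb_iff by (metis minus_minus)
  qed (simp_all add: finite_sums)
qed

lemma has_type_B: "orthogonal_family e r c \<Longrightarrow> 1 \<le> r \<Longrightarrow>
    has_type (span (rsums cond_B e r)) (rsums cond_B e r) (Type_B r)"
  and has_type_C: "orthogonal_family e r c \<Longrightarrow> 1 \<le> r \<Longrightarrow>
    has_type (span (rsums cond_C e r)) (rsums cond_C e r) (Type_C r)"
  using has_type_single[of e r c 1 cond_B] has_type_single[of e r c 2 cond_C] by auto

lemma has_type_BC_sums:
  assumes f: "orthogonal_family e r c" and r: "1 \<le> r"
  shows "has_type_BC (span (rsums cond_BC e r)) (rsums cond_BC e r) r"
proof -
  let ?R = "rsums cond_BC e r"
  have c: "c > 0" using f by (simp add: simplex_family_def)
  have inner: "(sg e a + sg e b) \<bullet> (sg e u + sg e v) =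
      sg e a \<bullet> sg e u + sg e a \<bullet> sg e v + sg e b \<bullet> sg e u + sg e b \<bullet> sg e v" for a b u v
    by (simp add: inner_add_left inner_add_right)
  have norm: "(sg e a + sg e b) \<bullet> (sg e a + sg e b) = c * (if a = b then 4 else if a = 0 \<or> b = 0 then 1 else 2)"
    if "\<bar>a\<bar> \<le> int r" "\<bar>b\<bar> \<le> int r" "cond_BC a b" for a b
    using that unfolding inner by (auto simp: sg_inner[OF f] cond_BC_def)
  have zero: "0 \<notin> ?R"
  proof
    assume "0 \<in> ?R"
    then obtain a b where "sg e a + sg e b = 0" "\<bar>a\<bar> \<le> int r" "\<bar>b\<bar> \<le> int r" "cond_BC a b"
      unfolding rsums_def by force
    then show False using norm[of a b] c by (auto split: if_splits)
  qed
  have single: "e i \<in> ?R" if "i \<in> {1..r}" for i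
  proof -
    have "e i = sg e (int i) + sg e 0" using that by (simp add: sg_int)
    then show ?thesis
      using that by (intro rsumsI[of _ "int i" 0]) (auto simp: cond_BC_def)
  qed
  have plus: "e i + e k \<in> ?R" if "i \<in> {1..r}" "k \<in> {1..r}" for i k
  proof -
    have "e i + e k = sg e (int i) + sg e (int k)" using that by (simp add: sg_int)
    then show ?thesis
      using that by (intro rsumsI[of _ "int i" "int k"]) (auto simp: cond_BC_def)
  qed
  have int: "cartan_number x y \<in> \<int>" if xR: "x \<in> ?R" and yR: "y \<in> ?R" for x y
  proof -
    obtain a b where ab: "x = sg e a + sg e b" "\<bar>a\<bar> \<le> int r" "\<bar>b\<bar> \<le> int r"
      using xR unfolding rsums_def by blast
    obtain u v where uv: "y = sg e u + sg e v" "\<bar>u\<bar> \<le> int r" "\<bar>v\<bar> \<le> int r" "cond_BC u v"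
      using yR unfolding rsums_def by blast
    have *: "\<exists>n::int. sg e a \<bullet> sg e b = c * of_int n" if "\<bar>a\<bar> \<le> int r" "\<bar>b\<bar> \<le> int r" for a b
    proof -
      have "sg e a \<bullet> sg e b = c * of_int (if a = 0 then 0 else if a = b then 1 else if a = - b then - 1 else 0)"
        using that by (simp add: sg_inner[OF f])
      then show ?thesis by blast
    qed
    obtain n1 n2 n3 n4 :: int where n: "sg e a \<bullet> sg e u = c * of_int n1" "sg e a \<bullet> sg e v = c * of_int n2"
        "sg e b \<bullet> sg e u = c * of_int n3" "sg e b \<bullet> sg e v = c * of_int n4"
      using *[OF ab(2) uv(2)] *[OF ab(2) uv(3)] *[OF ab(3) uv(2)] *[OF ab(3) uv(3)] by blast
    have xy: "x \<bullet> y = c * of_int (n1 + n2 + n3 + n4)"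
      unfolding ab(1) uv(1) inner n by (simp add: algebra_simps)
    have eq: "u = v \<Longrightarrow> of_int (n1 + n2 + n3 + n4) = (2 * of_int (n1 + n3) :: real)"
      using n c by simp
    show ?thesis
    proof (cases "u = v")
      case True
      then have "cartan_number x y = of_int (n1 + n3)"
        unfolding cartan_number_def xy eq[OF True] using norm[OF uv(2-4)] c uv(1) by simp
      then show ?thesis by simp
    next
      case False
      then have "cartan_number x y = of_int (n1 + n2 + n3 + n4) \<or> cartan_number x y = of_int (2 * (n1 + n2 + n3 + n4))"
        unfolding cartan_number_def xy using norm[OF uv(2-4)] c uv(1) by auto
      then show ?thesis by (metis Ints_of_int)
    qed
  qed
  have "root_system (span ?R) ?R"
    unfolding root_system_def
    using zero int sums_reflection[OF f good_cond(4)] finite_sums by blast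
  moreover have "\<not> reduced_rs ?R"
  proof
    assume red: "reduced_rs ?R"
    have "2 *\<^sub>R e 1 \<in> ?R" using plus[of 1 1] r by (simp add: scaleR_2)
    with red have "(2::real) = 1 \<or> (2::real) = -1"
      unfolding reduced_rs_def using single[of 1] r by (metis atLeastAtMost_iff le_refl)
    then show False by simp
  qed
  moreover have "irreducible_rs ?R"
    unfolding irreducible_rs_def
  proof
    show "?R \<noteq> {}" using single[of 1] r by auto
    show "\<not> (\<exists>R1 R2. R1 \<noteq> {} \<and> R2 \<noteq> {} \<and> R1 \<union> R2 = ?R \<and> (\<forall>a\<in>R1. \<forall>b\<in>R2. a \<bullet> b = 0))"
    proof
      assume "\<exists>R1 R2. R1 \<noteq> {} \<and> R2 \<noteq> {} \<and> R1 \<union> R2 = ?R \<and> (\<forall>a\<in>R1. \<forall>b\<in>R2. a \<bullet> b = 0)"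
      then obtain R1 R2 where R: "R1 \<noteq> {}" "R2 \<noteq> {}" "R1 \<union> R2 = ?R"
        and orth: "\<forall>a\<in>R1. \<forall>b\<in>R2. a \<bullet> b = 0"
        by (elim exE conjE)
      have imp: "b \<in> R1" if "b \<in> ?R" "a \<bullet> b \<noteq> 0" "a \<in> R1" for a b
        using that(1) unfolding R(3)[symmetric] using orth that(2,3) by blast
      have link: "a \<in> R1 \<longleftrightarrow> b \<in> R1" if "a \<in> ?R" "b \<in> ?R" "a \<bullet> b \<noteq> 0" for a b
        using imp[of b a] imp[of a b] that by (auto simp: inner_commute[of b a])
      have e1: "e i \<in> R1 \<longleftrightarrow> e 1 \<in> R1" if i: "i \<in> {1..r}" for i
      proof -
        have 1: "1 \<in> {1..r}" using r by simp
        have ne: "e i \<bullet> (e i + e 1) \<noteq> 0" "(e i + e 1) \<bullet> e 1 \<noteq> 0"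
          using simplex_familyD[OF f i i] simplex_familyD[OF f i 1] simplex_familyD[OF f 1 1] c
          by (auto simp: inner_add_left inner_add_right)
        have "e i \<in> R1 \<longleftrightarrow> e i + e 1 \<in> R1"
          using link[OF single[OF i] plus[OF i 1] ne(1)] .
        also have "\<dots> \<longleftrightarrow> e 1 \<in> R1"
          using link[OF plus[OF i 1] single[OF 1] ne(2)] .
        finally show ?thesis .
      qed
      have all: "x \<in> R1 \<longleftrightarrow> e 1 \<in> R1" if x: "x \<in> ?R" for x
      proof -
        obtain a b where ab: "x = sg e a + sg e b" "\<bar>a\<bar> \<le> int r" "\<bar>b\<bar> \<le> int r" "cond_BC a b"
          using x unfolding rsums_def by blast
        have "a \<noteq> 0 \<or> b \<noteq> 0" using ab(4) by (auto simp: cond_BC_def)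
        then obtain u where u: "u = a \<or> u = b" "u \<noteq> 0" by blast
        define i where "i = nat \<bar>u\<bar>"
        have i: "i \<in> {1..r}" using u ab by (auto simp: i_def)
        have "e i = sg e u \<or> e i = - sg e u" using u(2) by (simp add: i_def sg_def sgn_if)
        moreover have "x \<bullet> sg e u \<noteq> 0"
        proof -
          have "\<bar>u\<bar> \<le> int r" using u(1) ab by auto
          then have "x \<bullet> sg e u = (if a = 0 then 0 else if a = u then c else if a = - u then - c else 0)
              + (if b = 0 then 0 else if b = u then c else if b = - u then - c else 0)"
            unfolding ab(1) inner_add_left using ab(2,3) by (simp only: sg_inner[OF f])
          then show ?thesis using u ab(4) c by (auto simp: cond_BC_def)
        qed
        ultimately have "x \<bullet> e i \<noteq> 0" by auto
        then show ?thesis using link[OF x single[OF i]] e1[OF i] by simp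
      qed
      obtain x1 x2 where x12: "x1 \<in> R1" "x2 \<in> R2" using R by blast
      then have "x2 \<in> R1" using all R(3) by blast
      then have "x2 \<bullet> x2 = 0" using orth x12 by blast
      then show False using zero x12 R(3) by auto
    qed
  qed
  moreover have "dim (span ?R) = r"
  proof -
    have "span ?R = span (e ` {1..r})"
    proof (rule span_eq[THEN iffD2], intro conjI)
      show "?R \<subseteq> span (e ` {1..r})"
      proof
        fix x assume "x \<in> ?R"
        then obtain a b where ab: "x = sg e a + sg e b" "\<bar>a\<bar> \<le> int r" "\<bar>b\<bar> \<le> int r"
          by (auto simp: rsums_def)
        have "sg e a \<in> span (e ` {1..r})" if "\<bar>a\<bar> \<le> int r" for a
        proof (cases "a = 0")
          case False
          then have "nat \<bar>a\<bar> \<in> {1..r}" using that by auto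
          then show ?thesis unfolding sg_def by (intro span_scale span_base) blast
        qed (simp add: span_zero)
        then show "x \<in> span (e ` {1..r})" using ab by (simp add: span_add)
      qed
      show "e ` {1..r} \<subseteq> span ?R" using single by (auto intro: span_base)
    qed
    moreover have "e i \<bullet> e k = 0 \<longleftrightarrow> i \<noteq> k" if "i \<in> {1..r}" "k \<in> {1..r}" for i k
      using that c by (simp add: simplex_familyD[OF f])
    then have "independent (e ` {1..r})" "inj_on e {1..r}"
      using independent_if_dual[of r e e] by auto
    ultimately show ?thesis
      by (simp add: dim_span dim_eq_card_independent card_image)
  qed
  ultimately show ?thesis unfolding has_type_BC_def by blast
qed

section \<open>Longest elements in types B, C and D\<close>

lemma orb_cong: 
  assumes "\<And>i. i \<in> {1..r} \<Longrightarrow> \<alpha> i = \<beta> i"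
  shows "orb \<alpha> r = orb \<beta> r"
proof -
  have "x \<in> orb \<beta> r" if "x \<in> orb \<alpha> r" "\<And>i. i \<in> {1..r} \<Longrightarrow> \<alpha> i = \<beta> i" for x \<alpha> \<beta>
    using that(1) by induction (use that(2) orb.intros in metis)+
  then show ?thesis using assms by (metis subsetI subset_antisym)
qed

lemma chain_norms:
  assumes "\<And>k. k \<in> {1..<n} \<Longrightarrow> cartan_number (\<alpha> k) (\<alpha> (Suc k)) = -1 \<and> cartan_number (\<alpha> (Suc k)) (\<alpha> k) = -1"
  shows "1 \<le> k \<Longrightarrow> k \<le> n \<Longrightarrow> \<alpha> k \<bullet> \<alpha> k = \<alpha> 1 \<bullet> \<alpha> 1"
proof (induction k rule: dec_induct)
  case (step k)
  then have "cartan_number (\<alpha> k) (\<alpha> (Suc k)) = -1" "cartan_number (\<alpha> (Suc k)) (\<alpha> k) = -1"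
    using assms[of k] by auto
  then have "\<alpha> k \<bullet> \<alpha> k = \<alpha> (Suc k) \<bullet> \<alpha> (Suc k)"
    by (auto simp: cartan_number_def inner_commute divide_eq_eq split: if_splits)
  then show ?case using step by simp
qed simp

lemma inner_eq_cartan: "b \<noteq> 0 \<Longrightarrow> a \<bullet> b = cartan_number a b * (b \<bullet> b) / 2"
  by (simp add: cartan_number_def)

lemma simplex_realization:
  fixes \<alpha> :: "nat \<Rightarrow> 'a::euclidean_space"
  assumes indep: "independent (\<alpha> ` {1..l})" "inj_on \<alpha> {1..l}" and sp: "span (\<alpha> ` {1..l}) = UNIV"
    and c: "c > 0"
    and gram: "\<And>i k. i \<in> {1..l} \<Longrightarrow> k \<in> {1..l} \<Longrightarrow> \<alpha> i \<bullet> \<alpha> k = c * of_int (chain i k)"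
  obtains e d where "simplex_family e (Suc l) c d" "\<And>i. i \<in> {1..l} \<Longrightarrow> \<alpha> i = e i - e (Suc i)"
proof -
  have "\<exists>x. \<forall>k\<in>{1..l}. x \<bullet> \<alpha> k = c * ((if m = k then 1 else 0) - (if m = Suc k then 1 else 0))" for m
    using dual_vectors[OF indep, of "\<lambda>k. c * ((if m = k then 1 else 0) - (if m = Suc k then 1 else 0))"]
    by metis
  then obtain e where e: "\<And>m k. k \<in> {1..l} \<Longrightarrow>
      e m \<bullet> \<alpha> k = c * ((if m = k then 1 else 0) - (if m = Suc k then 1 else 0))"
    by metis
  have \<alpha>: "\<alpha> i = e i - e (Suc i)" if i: "i \<in> {1..l}" for i
  proof (rule eq_if_inner_eq[OF sp])
    fix k assume "k \<in> {1..l}"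
    then show "\<alpha> i \<bullet> \<alpha> k = (e i - e (Suc i)) \<bullet> \<alpha> k"
      using i by (auto simp: gram inner_diff_left e simply_laced_def)
  qed
  define D where "D = (\<lambda>m n. e m \<bullet> e n - (if m = n then c else 0))"
  have step: "D m (Suc n) = D m n" if "n \<in> {1..l}" for m n
    using e[OF that, of m] \<alpha>[OF that] by (auto simp: D_def inner_diff_right)
  have D1: "n \<le> Suc l \<Longrightarrow> D m n = D m 1" if "1 \<le> n" for m n
    using that by (induction n rule: dec_induct) (auto simp: step)
  have sym: "D m n = D n m" for m n by (auto simp: D_def inner_commute)
  have "D m n = D 1 1" if "m \<in> {1..Suc l}" "n \<in> {1..Suc l}" for m n
    using D1[of n m] D1[of m 1] sym[of m 1] that by auto
  then have "simplex_family e (Suc l) c (D 1 1)"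
    using c unfolding simplex_family_def D_def by (auto simp: algebra_simps)
  with \<alpha> show ?thesis using that by blast
qed

lemma orthogonal_realization:
  fixes \<alpha> :: "nat \<Rightarrow> 'a::euclidean_space"
  assumes indep: "independent (\<alpha> ` {1..l})" "inj_on \<alpha> {1..l}" and sp: "span (\<alpha> ` {1..l}) = UNIV"
    and c: "c > 0" and l: "2 \<le> l" and st: "s + t \<noteq> 0"
    and gram: "\<And>i k. i \<in> {1..<l} \<Longrightarrow> k \<in> {1..<l} \<Longrightarrow> \<alpha> i \<bullet> \<alpha> k = c * of_int (chain i k)"
      "\<And>i. i \<in> {1..<l} \<Longrightarrow> \<alpha> i \<bullet> \<alpha> l = c * ((if Suc i = l then t - s else 0) - (if i + 2 = l then t else 0))"
      "\<alpha> l \<bullet> \<alpha> l = c * (s\<^sup>2 + t\<^sup>2)"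
  obtains e where "orthogonal_family e l c"
    "\<And>i. i \<in> {1..l} \<Longrightarrow> \<alpha> i = chain_system e (s *\<^sub>R e l + t *\<^sub>R e (l - 1)) l i"
proof -
  define v where "v m k = c * (if k < l then (if m = k then 1 else 0) - (if m = Suc k then 1 else 0)
      else (if m = l then s else 0) + (if Suc m = l then t else 0))" for m k
  have "\<exists>x. \<forall>k\<in>{1..l}. x \<bullet> \<alpha> k = v m k" for m
    using dual_vectors[OF indep, of "v m"] by metis
  then obtain e where e: "\<And>m k. k \<in> {1..l} \<Longrightarrow> e m \<bullet> \<alpha> k = v m k"
    by metis
  have \<alpha>: "\<alpha> i = e i - e (Suc i)" if i: "i \<in> {1..<l}" for i
  proof (rule eq_if_inner_eq[OF sp])
    fix k assume k: "k \<in> {1..l}"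
    show "\<alpha> i \<bullet> \<alpha> k = (e i - e (Suc i)) \<bullet> \<alpha> k"
    proof (cases "k = l")
      case True
      then show ?thesis using i gram(2)[OF i] e[OF k, of i] e[OF k, of "Suc i"]
        by (auto simp: inner_diff_left v_def algebra_simps)
    next
      case False
      then show ?thesis using i k gram(1)[OF i, of k] e[OF k, of i] e[OF k, of "Suc i"]
        by (auto simp: inner_diff_left v_def simply_laced_def)
    qed
  qed
  have \<alpha>l: "\<alpha> l = s *\<^sub>R e l + t *\<^sub>R e (l - 1)"
  proof (rule eq_if_inner_eq[OF sp])
    fix k assume k: "k \<in> {1..l}"
    show "\<alpha> l \<bullet> \<alpha> k = (s *\<^sub>R e l + t *\<^sub>R e (l - 1)) \<bullet> \<alpha> k"
    proof (cases "k = l")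
      case True
      then show ?thesis using l gram(3) e[OF k, of l] e[OF k, of "l - 1"]
        by (auto simp: inner_add_left v_def power2_eq_square algebra_simps)
    next
      case False
      have "l - 1 = k \<longleftrightarrow> Suc k = l" "l - 1 = Suc k \<longleftrightarrow> Suc (Suc k) = l" using l by auto
      moreover have "k \<in> {1..<l}" using k False by simp
      ultimately show ?thesis
        unfolding inner_add_left inner_scaleR_left e[OF k] inner_commute[of "\<alpha> l"] gram(2)[OF \<open>k \<in> {1..<l}\<close>]
        using k l by (auto simp: v_def algebra_simps)
    qed
  qed
  have "l - 1 \<in> {1..<l}" "Suc (l - 1) = l" using l by auto
  then have "e (l - 1) = e l + \<alpha> (l - 1)" using \<alpha>[of "l - 1"] by simp
  then have "(s + t) *\<^sub>R e l = \<alpha> l - t *\<^sub>R \<alpha> (l - 1)"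
    by (simp add: \<alpha>l scaleR_add_left scaleR_add_right)
  then have eq: "(s + t) * (e m \<bullet> e l) = v m l - t * v m (l - 1)" for m
  proof -
    have "l \<in> {1..l}" "l - 1 \<in> {1..l}" using l by auto
    note e = this[THEN e]
    have "(s + t) * (e m \<bullet> e l) = e m \<bullet> ((s + t) *\<^sub>R e l)" by simp
    also have "\<dots> = v m l - t * v m (l - 1)"
      unfolding \<open>(s + t) *\<^sub>R e l = \<alpha> l - t *\<^sub>R \<alpha> (l - 1)\<close> by (simp add: inner_diff_right e)
    finally show ?thesis .
  qed
  have base: "e m \<bullet> e l = (if m = l then c else 0)" for m
  proof -
    have "l - 1 < l" "m = l - 1 \<longleftrightarrow> Suc m = l" using l by auto
    then have "(s + t) * (e m \<bullet> e l) = (s + t) * (if m = l then c else 0)"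
      using l unfolding eq by (auto simp: v_def algebra_simps)
    then show ?thesis using st by simp
  qed
  have "1 \<le> n \<Longrightarrow> e m \<bullet> e n = (if m = n then c else 0)" if "n \<le> l" for m n
    using that
  proof (induction n rule: inc_induct)
    case (step n)
    then have "e n = e (Suc n) + \<alpha> n" using \<alpha>[of n] by simp
    then show ?case using step e[of n m] by (auto simp: inner_add_right v_def)
  qed (rule base)
  then have "orthogonal_family e l c"
    using c unfolding simplex_family_def by auto
  with \<alpha> \<alpha>l show ?thesis by (intro that) (auto simp: chain_system_def)
qed

lemma interval_id:
  fixes q :: "nat \<Rightarrow> int"
  assumes "\<And>i. i \<in> {j..<u} \<Longrightarrow> q i < q (Suc i)" "int j \<le> q j" "q u \<le> int u" "i \<in> {j..u}"
  shows "q i = int i"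
proof -
  have "int k \<le> q k" if "j \<le> k" "k \<le> u" for k
    using that by (induction k rule: dec_induct) (use assms(1,2) in fastforce)+
  moreover have "q k \<le> int k" if "k \<le> u" "j \<le> k" for k
    using that by (induction k rule: inc_induct) (use assms(1,3) in fastforce)+
  ultimately show ?thesis using assms(4) by (simp add: order_antisym)
qed

lemma interval_rev:
  fixes q :: "nat \<Rightarrow> int"
  assumes "\<And>i. i \<in> {j..<u} \<Longrightarrow> q (Suc i) < q i" "q j \<le> int u" "int j \<le> q u" "i \<in> {j..u}"
  shows "q i = int j + int u - int i"
  using interval_id[of j u "\<lambda>i. int j + int u - q i" i] assms by fastforce

locale classical = rbase +
  fixes e :: "nat \<Rightarrow> 'a" and c :: real and z :: 'a
  assumes e: "orthogonal_family e l c" and simple: "\<And>i. i \<in> {1..l} \<Longrightarrow> \<alpha> i = chain_system e z l i"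
    and z: "z \<in> rsums cond_BC e l" and l2: "2 \<le> l"
begin

lemma c_pos: "c > 0"
  using e by (simp add: simplex_family_def)

lemma e_inner: "i \<in> {1..l} \<Longrightarrow> k \<in> {1..l} \<Longrightarrow> e i \<bullet> e k = (if i = k then c else 0)"
  using simplex_familyD[OF e] by simp

lemma roots_eq: "\<Phi> = orb (chain_system e z l) l"
  using roots_eq_orb orb_cong[of l \<alpha>] simple by metis

lemma simple_diff: "1 \<le> i \<Longrightarrow> i < l \<Longrightarrow> \<alpha> i = e i - e (Suc i)"
  using simple[of i] by (simp add: chain_system_def)

lemma simple_last: "\<alpha> l = z"
  using simple[of l] l2 by (simp add: chain_system_def)

lemma simple_rsums: "i \<in> {1..l} \<Longrightarrow> \<alpha> i \<in> rsums cond_BC e l"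
proof (cases "i = l")
  case False
  assume "i \<in> {1..l}"
  moreover have "cond_D a b \<Longrightarrow> cond_BC a b" for a b by (auto simp: cond_D_def cond_BC_def)
  ultimately show ?thesis
    using False chain_in_sums[OF good_cond(4), of i l e] simple_diff[of i] by auto
qed (simp add: z simple_last)

lemma sg_inj: "\<bar>a\<bar> \<le> int l \<Longrightarrow> \<bar>b\<bar> \<le> int l \<Longrightarrow> sg e a = sg e b \<longleftrightarrow> a = b"
  using sg_inner[OF e, of a a] sg_inner[OF e, of a b] sg_inner[OF e, of b b] c_pos
  by (auto split: if_splits)

lemma refl_group_action:
  assumes "w \<in> refl_group \<alpha> {1..l}"
  obtains (perm) p where "signed_perm l p" "\<And>a. \<bar>a\<bar> \<le> int l \<Longrightarrow> w (sg e a) = sg e (p a)"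
proof -
  obtain "is" where "set is \<subseteq> {1..l}" "w = refl_word \<alpha> is" using assms by (auto simp: refl_group_iff)
  moreover have "set is \<subseteq> {1..l} \<Longrightarrow>
      \<exists>p. signed_perm l p \<and> (\<forall>a. \<bar>a\<bar> \<le> int l \<longrightarrow> refl_word \<alpha> is (sg e a) = sg e (p a))" for "is"
  proof (induction "is")
    case Nil
    show ?case by (intro exI[of _ id]) (simp add: signed_perm_id[unfolded id_def])
  next
    case (Cons i "is")
    then obtain p where p: "signed_perm l p" "\<forall>a. \<bar>a\<bar> \<le> int l \<longrightarrow> refl_word \<alpha> is (sg e a) = sg e (p a)"
      by auto
    obtain a b where ab: "\<alpha> i = sg e a + sg e b" "cond_BC a b" "\<bar>a\<bar> \<le> int l" "\<bar>b\<bar> \<le> int l"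
      using simple_rsums[of i] Cons.prems unfolding rsums_def by auto
    obtain q where q: "signed_perm l q" "\<And>x. \<bar>x\<bar> \<le> int l \<Longrightarrow> reflection (\<alpha> i) (sg e x) = sg e (q x)"
      using reflection_sum[OF e ab(2-4)] unfolding ab(1) by blast
    show ?case
      using p q signed_perm_le[OF p(1)]
      by (intro exI[of _ "q \<circ> p"]) (simp add: refl_word_Cons signed_perm_comp[unfolded comp_def])
  qed
  ultimately show ?thesis using perm by blast
qed

definition height_vector :: "nat \<Rightarrow> 'a" where
  "height_vector N = (\<Sum>k=1..l. (real N - real k) *\<^sub>R e k)"

lemma height_vector_inner:
  assumes "\<bar>a\<bar> \<le> int l"
  shows "sg e a \<bullet> height_vector N = c * of_int (sgn a * (int N - \<bar>a\<bar>))"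
proof (cases "a = 0")
  case False
  then have n: "nat \<bar>a\<bar> \<in> {1..l}" using assms by auto
  have "e (nat \<bar>a\<bar>) \<bullet> height_vector N = (\<Sum>k=1..l. if nat \<bar>a\<bar> = k then (real N - real k) * c else 0)"
    unfolding height_vector_def inner_sum_right by (intro sum.cong) (use n in \<open>auto simp: e_inner\<close>)
  also have "\<dots> = (real N - of_int \<bar>a\<bar>) * c" using n by simp
  finally show ?thesis by (simp add: sg_def)
qed simp

lemma w_elt_action:
  obtains (perm) p where "signed_perm l p" "\<And>a. \<bar>a\<bar> \<le> int l \<Longrightarrow> w_elt l \<alpha> j (sg e a) = sg e (p a)"
  using refl_group_action[OF w_elt_in_group] by blast

lemma simple_height:
  assumes "z \<bullet> height_vector N > 0" "i \<in> {1..l}"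
  shows "\<alpha> i \<bullet> height_vector N > 0"
proof (cases "i = l")
  case False
  then have "\<alpha> i \<bullet> height_vector N = sg e (int i) \<bullet> height_vector N - sg e (int (Suc i)) \<bullet> height_vector N"
    using assms(2) by (simp add: simple_diff inner_diff_left sg_int del: of_nat_Suc)
  also have "\<dots> = c"
    using assms(2) False by (subst (1 2) height_vector_inner) (auto simp: algebra_simps)
  finally show ?thesis using c_pos by simp
qed (simp add: assms simple_last)

lemma w_elt_chain:
  assumes p: "signed_perm l p" "\<And>a. \<bar>a\<bar> \<le> int l \<Longrightarrow> w_elt l \<alpha> j (sg e a) = sg e (p a)"
    and N: "z \<bullet> height_vector N > 0" and i: "1 \<le> i" "i < l" "i \<noteq> j"
  shows "sgn (p (int i)) * (int N - \<bar>p (int i)\<bar>) < sgn (p (int (Suc i))) * (int N - \<bar>p (int (Suc i))\<bar>)"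
proof -
  have "w_elt l \<alpha> j (\<alpha> i) = sg e (p (int i)) - sg e (p (int (Suc i)))"
    using i p(2)[of "int i"] p(2)[of "int (Suc i)"]
    by (simp add: simple_diff linear_diff[OF w_elt_linear] sg_int del: of_nat_Suc)
  then have "(sg e (p (int i)) - sg e (p (int (Suc i)))) \<bullet> height_vector N < 0"
    using w_elt_decreasing[OF simple_height[OF N], of i j] i by simp
  moreover have "\<bar>p (int i)\<bar> \<le> int l" "\<bar>p (int (Suc i))\<bar> \<le> int l"
    using i by (auto intro!: signed_perm_le[OF p(1)])
  ultimately have "c * of_int (sgn (p (int i)) * (int N - \<bar>p (int i)\<bar>)) <
      c * of_int (sgn (p (int (Suc i))) * (int N - \<bar>p (int (Suc i))\<bar>))"
    by (simp only: inner_diff_left height_vector_inner diff_less_0_iff_less)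
  then show ?thesis using c_pos by (simp only: mult_less_cancel_left_pos of_int_less_iff)
qed

lemma w_elt_fixes_e1:
  assumes "\<And>i. i \<in> {2..l} \<Longrightarrow> e 1 \<bullet> \<alpha> i = 0"
  shows "w_elt l \<alpha> 1 (e 1) = e 1"
  by (rule refl_group_fixes[OF w_elt(1)]) (use assms in auto)

lemma e1_orthogonal:
  assumes "e 1 \<bullet> z = 0" "i \<in> {2..l}"
  shows "e 1 \<bullet> \<alpha> i = 0"
  using assms l2 by (cases "i = l") (auto simp: simple_last simple_diff inner_diff_right e_inner)

text \<open>The images of the \<open>e i\<close>, ordered by height, can only be the opposites in the same order.\<close>

lemma w_elt_neg_upto:
  assumes p: "signed_perm l p" "\<And>a. \<bar>a\<bar> \<le> int l \<Longrightarrow> w_elt l \<alpha> j (sg e a) = sg e (p a)"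
    and N: "z \<bullet> height_vector N > 0" and j: "j \<le> 1" "j = 1 \<Longrightarrow> e 1 \<bullet> z = 0"
    and u: "Suc j \<le> u" "u \<le> l" "l \<le> N" "N = Suc u"
    and last: "sgn (p (int u)) * (int N - \<bar>p (int u)\<bar>) < 0"
    and i: "i \<in> {Suc j..u}"
  shows "p (int i) = - int i"
proof -
  let ?h = "\<lambda>i. sgn (p (int i)) * (int N - \<bar>p (int i)\<bar>)"
  have chain: "?h i < ?h (Suc i)" if "i \<in> {Suc j..<u}" for i
    by (rule w_elt_chain[OF p N]) (use that u in auto)
  have neg: "?h k < 0" if "k \<le> u" "Suc j \<le> k" for k
    using that
  proof (induction k rule: inc_induct)
    case (step k)
    then have "?h (Suc k) < 0" "k \<in> {Suc j..<u}" by auto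
    then show ?case using chain[of k] by linarith
  qed (rule last)
  have p0: "p (int k) \<noteq> 0" if "1 \<le> k" for k
    using signed_perm_eq_iff[OF p(1), of "int k" 0] signed_perm_0[OF p(1)] that by simp
  have low: "int (Suc j) \<le> \<bar>p (int k)\<bar>" if "Suc j \<le> k" for k
  proof (cases "j = 0")
    case True
    then show ?thesis using p0[of k] that by simp
  next
    case False
    then have j1: "j = 1" using j by simp
    have "w_elt l \<alpha> 1 (e 1) = e 1" using w_elt_fixes_e1 e1_orthogonal j j1 by blast
    then have "sg e (p 1) = sg e 1" using p(2)[of 1] l2 sg_int[of 1 e] j1 by simp
    then have p1: "p 1 = 1" using sg_inj signed_perm_le[OF p(1), of 1] l2 by simp
    then have "p (int k) \<noteq> 1" "p (int k) \<noteq> - 1"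
      using signed_perm_eq_iff[OF p(1), of "int k" 1] signed_perm_eq_iff[OF p(1), of "int k" "- 1"]
        signed_perm_minus[OF p(1), of 1] that j1 by auto
    then show ?thesis using p0[of k] that j1 by auto
  qed
  have p_neg: "p (int k) < 0" if k: "k \<in> {Suc j..u}" for k
  proof (rule ccontr)
    assume "\<not> ?thesis"
    then have pos: "p (int k) > 0" using p0[of k] k by simp
    have "?h k < 0" using neg k by simp
    moreover have "p (int k) \<le> int l" using signed_perm_le[OF p(1), of "int k"] k u by simp
    ultimately show False using pos u by simp
  qed
  have "- p (int i) = int i"
  proof (rule interval_id[where q = "\<lambda>k. - p (int k)", OF _ _ _ i])
    show "- p (int k) < - p (int (Suc k))" if "k \<in> {Suc j..<u}" for k
      using chain[OF that] p_neg[of k] p_neg[of "Suc k"] that by simp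
    show "int (Suc j) \<le> - p (int (Suc j))" using low[of "Suc j"] p_neg[of "Suc j"] u by simp
    show "- p (int u) \<le> int u" using last p_neg[of u] u by simp
  qed
  then show ?thesis by simp
qed

lemma w_elt_last:
  assumes p: "\<And>a. \<bar>a\<bar> \<le> int l \<Longrightarrow> w_elt l \<alpha> j (sg e a) = sg e (p a)"
    and N: "z \<bullet> height_vector N > 0" and "j \<noteq> l" "z = s *\<^sub>R e l + t *\<^sub>R e (l - 1)"
  shows "(s *\<^sub>R sg e (p (int l)) + t *\<^sub>R sg e (p (int (l - 1)))) \<bullet> height_vector N < 0"
proof -
  have "w_elt l \<alpha> j z = s *\<^sub>R sg e (p (int l)) + t *\<^sub>R sg e (p (int (l - 1)))"
    using p[of "int l"] p[of "int (l - 1)"] assms(4) l2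
    by (simp add: linear_add[OF w_elt_linear] linear_cmul[OF w_elt_linear] sg_int del: of_nat_diff)
  then show ?thesis
    using w_elt_decreasing[OF simple_height[OF N], of l j] assms(3) l2 by (simp add: simple_last)
qed

lemma w_elt_neg:
  assumes zl: "z = s *\<^sub>R e l" "s > 0" and j: "j \<le> 1" and i: "i \<in> {Suc j..l}"
  shows "w_elt l \<alpha> j (e i) = - e i"
proof -
  obtain p where p: "signed_perm l p" "\<And>a. \<bar>a\<bar> \<le> int l \<Longrightarrow> w_elt l \<alpha> j (sg e a) = sg e (p a)"
    using w_elt_action by blast
  have "z \<bullet> height_vector (Suc l) = s * (sg e (int l) \<bullet> height_vector (Suc l))"
    using l2 by (simp add: zl sg_int)
  then have N: "z \<bullet> height_vector (Suc l) > 0"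
    using zl(2) c_pos l2 by (subst (asm) height_vector_inner) auto
  have pl: "\<bar>p (int l)\<bar> \<le> int l" by (intro signed_perm_le[OF p(1)]) simp
  have "(s *\<^sub>R sg e (p (int l)) + 0 *\<^sub>R sg e (p (int (l - 1)))) \<bullet> height_vector (Suc l) < 0"
    by (rule w_elt_last[OF p(2) N]) (use j l2 zl in auto)
  then have "s * (c * of_int (sgn (p (int l)) * (int (Suc l) - \<bar>p (int l)\<bar>))) < 0"
    using pl by (simp only: height_vector_inner inner_scaleR_left scaleR_zero_left add_0_right)
  then have last: "sgn (p (int l)) * (int (Suc l) - \<bar>p (int l)\<bar>) < 0"
    using zl(2) c_pos by (simp only: mult_less_0_iff of_int_less_0_iff) auto
  have "e 1 \<bullet> z = 0" using zl l2 by (simp add: e_inner)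
  then have "p (int i) = - int i"
    by (intro w_elt_neg_upto[OF p N j _ _ _ _ _ last i]) (use i in auto)
  then show ?thesis using p(2)[of "int i"] i by (simp add: sg_int sg_minus)
qed

lemma w_elt_rev:
  assumes N: "z \<bullet> height_vector (Suc l) > 0" and i: "i \<in> {1..l}"
  shows "w_elt l \<alpha> l (e i) = e (Suc l - i)"
proof -
  obtain p where p: "signed_perm l p" "\<And>a. \<bar>a\<bar> \<le> int l \<Longrightarrow> w_elt l \<alpha> l (sg e a) = sg e (p a)"
    using w_elt_action by blast
  define x where "x = (\<Sum>k=1..l. e k)"
  have ex: "e k \<bullet> x = c" if "k \<in> {1..l}" for k
    using partial_sum_dual[OF e that, of l] that by (simp add: x_def)
  have sgx: "sg e a \<bullet> x = of_int (sgn a) * c" if "\<bar>a\<bar> \<le> int l" for a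
  proof (cases "a = 0")
    case False
    then have "nat \<bar>a\<bar> \<in> {1..l}" using that by auto
    then show ?thesis using ex[of "nat \<bar>a\<bar>"] by (simp add: sg_def)
  qed simp
  have wx: "w_elt l \<alpha> l x = x"
    by (rule refl_group_fixes[OF w_elt(1)]) (auto simp: simple_diff inner_diff_right inner_commute[of x] ex)
  obtain "is" where w: "w_elt l \<alpha> l = refl_word \<alpha> is"
    using w_elt(1) by (auto simp: refl_group_iff)
  have ran: "\<bar>p (int k)\<bar> \<le> int l" if "k \<in> {1..l}" for k
    using that by (intro signed_perm_le[OF p(1)]) simp
  have pos: "p (int k) > 0" if k: "k \<in> {1..l}" for k
  proof -
    have "of_int (sgn (p (int k))) * c = w_elt l \<alpha> l (e k) \<bullet> w_elt l \<alpha> l x"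
      using sgx[OF ran[OF k]] p(2)[of "int k"] k by (simp add: wx sg_int)
    also have "\<dots> = e k \<bullet> x" unfolding w by (rule refl_word_inner)
    finally have "of_int (sgn (p (int k))) = (1::real)" using ex[OF k] c_pos by simp
    then show ?thesis by (simp add: sgn_if split: if_splits)
  qed
  have "p (int i) = int 1 + int l - int i"
  proof (rule interval_rev[where q = "\<lambda>k. p (int k)", OF _ _ _ i])
    show "p (int (Suc k)) < p (int k)" if "k \<in> {1..<l}" for k
      using w_elt_chain[OF p N, of k] pos[of k] pos[of "Suc k"] that by simp
  qed (use ran[of 1] pos[of l] l2 in auto)
  then have "p (int i) = int (Suc l - i)" using i by auto
  then show ?thesis using p(2)[of "int i"] i by (simp add: sg_int del: of_nat_diff)
qed

end

locale type_D = classical +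
  assumes zD: "z = e (l - 1) + e l" and l3: "3 \<le> l"
begin

lemma cartan_D: "k \<in> {1..l} \<Longrightarrow> cartan_number (\<Sum>m=1..l. e m) (\<alpha> k) = (if k = l then 2 else 0)"
proof -
  assume k: "k \<in> {1..l}"
  have ex: "e m \<bullet> (\<Sum>k=1..l. e k) = c" if "m \<in> {1..l}" for m
    using partial_sum_dual[OF e that, of l] that by simp
  show ?thesis
    using k l3 c_pos ex[of k] ex[of "Suc k"] ex[of "l - 1"] ex[of l]
    by (cases "k = l") (auto simp: cartan_number_def simple_diff simple_last zD inner_diff_right inner_diff_left
      inner_add_left inner_add_right e_inner inner_commute[of "sum _ _"])
qed

text \<open>The sum of the \<open>e m\<close> is twice a weight, and a weight is moved by the Weyl group only within its
  coset of the root lattice.\<close>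

lemma sum_moves_even:
  assumes "w \<in> refl_group \<alpha> {1..l}"
  shows "\<exists>d :: nat \<Rightarrow> int. w (\<Sum>m=1..l. e m) = (\<Sum>m=1..l. e m) + (\<Sum>i=1..l. of_int (2 * d i) *\<^sub>R \<alpha> i)"
proof -
  let ?u = "\<Sum>m=1..l. e m"
  obtain "is" where "set is \<subseteq> {1..l}" "w = refl_word \<alpha> is" using assms by (auto simp: refl_group_iff)
  moreover have "set is \<subseteq> {1..l} \<Longrightarrow> \<exists>d :: nat \<Rightarrow> int. refl_word \<alpha> is ?u = ?u + (\<Sum>i=1..l. of_int (2 * d i) *\<^sub>R \<alpha> i)" for "is"
  proof (induction "is")
    case Nil
    show ?case by (intro exI[of _ "\<lambda>_. 0"]) simp
  next
    case (Cons k "is")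
    then obtain d :: "nat \<Rightarrow> int" where d: "refl_word \<alpha> is ?u = ?u + (\<Sum>i=1..l. of_int (2 * d i) *\<^sub>R \<alpha> i)"
      by auto
    have k: "k \<in> {1..l}" using Cons.prems by simp
    have "\<exists>n::int. cartan_number (\<alpha> i) (\<alpha> k) = of_int n" if "i \<in> {1..l}" for i
      using cartan_Ints[OF simple_root[OF that] simple_root[OF k]] by (auto elim: Ints_cases)
    then obtain n :: "nat \<Rightarrow> int" where n: "\<And>i. i \<in> {1..l} \<Longrightarrow> cartan_number (\<alpha> i) (\<alpha> k) = of_int (n i)"
      by metis
    define m where "m = (if k = l then 1 else 0) + (\<Sum>i=1..l. d i * n i)"
    have "cartan_number (refl_word \<alpha> is ?u) (\<alpha> k) = of_int (2 * m)"
    proof -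
      have "cartan_number (\<Sum>i=1..l. of_int (2 * d i) *\<^sub>R \<alpha> i) (\<alpha> k) = of_int (2 * (\<Sum>i=1..l. d i * n i))"
        unfolding cartan_number_sum cartan_number_scaleR by (simp add: n sum_distrib_left mult.assoc)
      then show ?thesis unfolding d cartan_number_add cartan_D[OF k] by (simp add: m_def)
    qed
    then have "refl_word \<alpha> (k # is) ?u = ?u + (\<Sum>i=1..l. of_int (2 * d i) *\<^sub>R \<alpha> i) - of_int (2 * m) *\<^sub>R \<alpha> k"
      by (simp add: refl_word_Cons reflection_eq_cartan d)
    also have "of_int (2 * m) *\<^sub>R \<alpha> k = (\<Sum>i=1..l. of_int (2 * (if i = k then m else 0)) *\<^sub>R \<alpha> i)"
    proof -
      have "(\<Sum>i=1..l. of_int (2 * (if i = k then m else 0)) *\<^sub>R \<alpha> i) = (\<Sum>i=1..l. if i = k then of_int (2 * m) *\<^sub>R \<alpha> k else 0)"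
        by (intro sum.cong) auto
      then show ?thesis using k by simp
    qed
    also have "?u + (\<Sum>i=1..l. of_int (2 * d i) *\<^sub>R \<alpha> i) - \<dots> =
        ?u + (\<Sum>i=1..l. of_int (2 * (d i - (if i = k then m else 0))) *\<^sub>R \<alpha> i)"
      by (simp add: sum_subtractf algebra_simps)
    finally show ?case by (rule exI[of _ "\<lambda>i. d i - (if i = k then m else 0)"])
  qed
  ultimately show ?thesis by blast
qed

lemma w_elt_neg_D:
  assumes j: "j \<le> 1"
  shows "i \<in> {Suc j..<l} \<Longrightarrow> w_elt l \<alpha> j (e i) = - e i"
    and "w_elt l \<alpha> j (e l) = (if even (l - j) then - e l else e l)"
proof -
  obtain p where p: "signed_perm l p" "\<And>a. \<bar>a\<bar> \<le> int l \<Longrightarrow> w_elt l \<alpha> j (sg e a) = sg e (p a)"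
    using w_elt_action by blast
  have "z \<bullet> height_vector l = sg e (int (l - 1)) \<bullet> height_vector l + sg e (int l) \<bullet> height_vector l"
    using l3 by (simp add: zD inner_add_left sg_int del: of_nat_diff)
  then have N: "z \<bullet> height_vector l > 0"
    using c_pos l3 by (subst (asm) (1 2) height_vector_inner) auto
  let ?h = "\<lambda>i. sgn (p (int i)) * (int l - \<bar>p (int i)\<bar>)"
  have ran: "\<bar>p (int k)\<bar> \<le> int l" if "k \<le> l" for k
    using that by (intro signed_perm_le[OF p(1)]) simp
  have "(1 *\<^sub>R sg e (p (int l)) + 1 *\<^sub>R sg e (p (int (l - 1)))) \<bullet> height_vector l < 0"
    by (rule w_elt_last[OF p(2) N]) (use j l3 zD in auto)
  then have "c * of_int (?h l) + c * of_int (?h (l - 1)) < 0"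
    using ran[of l] ran[of "l - 1"] by (simp only: height_vector_inner inner_add_left scaleR_one)
  then have "c * of_int (?h l + ?h (l - 1)) < 0" by (simp add: algebra_simps)
  then have sum: "?h l + ?h (l - 1) < 0" using c_pos by (simp only: mult_less_0_iff of_int_less_0_iff) auto
  have "?h (l - 1) < ?h (Suc (l - 1))" by (rule w_elt_chain[OF p N]) (use j l3 in auto)
  then have last: "?h (l - 1) < 0" using sum l3 by simp
  have "e 1 \<bullet> z = 0" using zD l3 by (simp add: e_inner inner_add_right)
  then have pneg: "p (int i) = - int i" if "i \<in> {Suc j..l - 1}" for i
    by (intro w_elt_neg_upto[OF p N j _ _ _ _ _ last that]) (use that l3 in auto)
  show neg: "w_elt l \<alpha> j (e i) = - e i" if "i \<in> {Suc j..<l}" for i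
  proof -
    have "i \<in> {Suc j..l - 1}" "i \<le> l" using that by auto
    then show ?thesis using p(2)[of "int i"] pneg[of i] by (simp add: sg_int sg_minus)
  qed
  have first: "w_elt l \<alpha> j (e 1) = e 1" if "j = 1"
    using w_elt_fixes_e1 e1_orthogonal \<open>e 1 \<bullet> z = 0\<close> that by blast
  have pl: "p (int l) = int l \<or> p (int l) = - int l"
  proof -
    have ne: "p (int l) \<noteq> int k \<and> p (int l) \<noteq> - int k" if k: "k < l" for k
    proof -
      consider "k = 0" | "k = 1" "j = 1" | "k \<in> {Suc j..l - 1}" using k j by fastforce
      then have "p (int k) = int k \<or> p (int k) = - int k"
      proof cases
        case 2
        then have "sg e (p 1) = sg e 1" using p(2)[of 1] l2 sg_int[of 1 e] first by simp
        then show ?thesis using sg_inj signed_perm_le[OF p(1), of 1] l2 2 by simp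
      qed (use pneg signed_perm_0[OF p(1)] in auto)
      then show ?thesis
        using signed_perm_eq_iff[OF p(1), of "int l" "int k"] signed_perm_eq_iff[OF p(1), of "int l" "- int k"]
          signed_perm_minus[OF p(1), of "int k"] k by auto
    qed
    have "\<not> nat \<bar>p (int l)\<bar> < l"
      using ne[of "nat \<bar>p (int l)\<bar>"] by (cases "p (int l) \<ge> 0") auto
    then show ?thesis using ran[of l] by linarith
  qed
  define \<epsilon> :: int where "\<epsilon> = (if p (int l) = int l then 1 else -1)"
  have wl: "w_elt l \<alpha> j (e l) = of_int \<epsilon> *\<^sub>R e l"
    using p(2)[of "int l"] pl l3 by (auto simp: \<epsilon>_def sg_int sg_minus)
  let ?u = "\<Sum>m=1..l. e m"
  have ex: "e m \<bullet> ?u = c" if "m \<in> {1..l}" for m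
    using partial_sum_dual[OF e that, of l] that by simp
  obtain d :: "nat \<Rightarrow> int" where d: "w_elt l \<alpha> j ?u = ?u + (\<Sum>i=1..l. of_int (2 * d i) *\<^sub>R \<alpha> i)"
    using sum_moves_even[OF w_elt_in_group] by blast
  have "(\<Sum>i=1..l. of_int (2 * d i) *\<^sub>R \<alpha> i) \<bullet> ?u = (\<Sum>i=1..l. if i = l then of_int (4 * d l) * c else 0)"
    unfolding inner_sum_left
    by (intro sum.cong) (use ex l3 in \<open>auto simp: simple_diff simple_last zD inner_diff_left inner_add_left\<close>)
  also have "\<dots> = of_int (4 * d l) * c" using l3 by simp
  finally have "w_elt l \<alpha> j ?u \<bullet> ?u = (real l + of_int (4 * d l)) * c"
    unfolding d inner_add_left using ex by (simp add: inner_sum_left algebra_simps)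
  moreover have "w_elt l \<alpha> j ?u \<bullet> ?u = of_int (2 * int j - int l + 1 + \<epsilon>) * c"
  proof -
    have "w_elt l \<alpha> j ?u \<bullet> ?u = (\<Sum>m=1..l. w_elt l \<alpha> j (e m) \<bullet> ?u)"
      by (simp add: linear_sum[OF w_elt_linear] inner_sum_left)
    also have "\<dots> = (\<Sum>m=1..l. (if m \<le> j then 2 * c else 0) - c + (if m = l then (of_int \<epsilon> + 1) * c else 0))"
    proof (rule sum.cong[OF refl])
      fix m assume m: "m \<in> {1..l}"
      consider "m \<le> j" "m = 1" "j = 1" | "m \<in> {Suc j..<l}" | "m = l" "j < l" using m j l3 by fastforce
      then show "w_elt l \<alpha> j (e m) \<bullet> ?u =
          (if m \<le> j then 2 * c else 0) - c + (if m = l then (of_int \<epsilon> + 1) * c else 0)"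
        by cases (use ex[OF m] first neg wl l3 in \<open>auto simp: algebra_simps\<close>)
    qed
    also have "\<dots> = (\<Sum>m=1..l. if m \<le> j then 2 * c else 0) - real l * c + (of_int \<epsilon> + 1) * c"
      using l3 by (simp add: sum.distrib sum_subtractf)
    also have "(\<Sum>m=1..l. if m \<le> j then 2 * c else 0) = 2 * real j * c"
    proof -
      have "{m \<in> {1..l}. m \<le> j} = {1..j}" using j l3 by auto
      then show ?thesis using sum.inter_filter[of "{1..l}" "\<lambda>_. 2 * c" "\<lambda>m. m \<le> j"] by simp
    qed
    finally show ?thesis by (simp add: algebra_simps)
  qed
  ultimately have "real_of_int (int l + 4 * d l) = of_int (2 * int j - int l + 1 + \<epsilon>)"
    using c_pos by simp
  then have "int l + 4 * d l = 2 * int j - int l + 1 + \<epsilon>" by linarith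
  then have "\<epsilon> = 2 * (int l - int j + 2 * d l) - 1" by simp
  then have "\<epsilon> = (if even (l - j) then -1 else 1)"
    using j l3 unfolding \<epsilon>_def by (auto split: if_splits) presburger+
  then show "w_elt l \<alpha> j (e l) = (if even (l - j) then - e l else e l)" using wl by simp
qed

end

section \<open>Folding in types B, C and D\<close>

context rbase
begin

lemma refl_group_finite_order:
  assumes "w \<in> refl_group \<alpha> {1..l}"
  shows "finite_order_map w"
proof (rule finite_order_map.intro)
  show "linear w" using refl_group_linear[OF _ assms] by simp
  obtain w' where "\<And>x. w' (w x) = x" using refl_group_inverse[OF _ assms] by blast
  then have "inj w" by (metis injI)
  moreover have "w ` \<Phi> \<subseteq> \<Phi>" using refl_group_root[OF _ assms] by auto
  ultimately show "\<exists>k>0. w ^^ k = id"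
    using finite_order_if_invariant \<open>linear w\<close> finite_roots span_roots by blast
qed

lemma finite_order_omega: "finite_order_map (omega_elt l \<alpha> j)"
  by (rule refl_group_finite_order[OF omega_refl_group])

end

lemma sg_sum_nonzero:
  assumes f: "orthogonal_family f r c" and "\<bar>u\<bar> \<le> int r" "\<bar>v\<bar> \<le> int r" "u \<noteq> - v"
  shows "sg f u + sg f v \<noteq> 0"
proof
  assume *: "sg f u + sg f v = 0"
  have "sg f u \<bullet> (sg f u + sg f v) = 0" "sg f v \<bullet> (sg f u + sg f v) = 0" "c > 0"
    using f by (auto simp: * simplex_family_def)
  then show False
    using assms sg_inner[OF f, of u u] sg_inner[OF f, of u v] sg_inner[OF f, of v v] sg_inner[OF f, of v u]
    by (auto simp: inner_add_right split: if_splits)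
qed

lemma eq_minus_self: "x = - x \<Longrightarrow> x = 0" for x :: "'a::real_vector"
proof -
  assume "x = - x"
  then have "2 *\<^sub>R x = 0" by (simp add: scaleR_2 eq_neg_iff_add_eq_0)
  then show ?thesis by simp
qed

context finite_order_map
begin

lemma average_neg_zero: "\<omega> x = - x \<Longrightarrow> average \<omega> x = 0"
  using average_map[of x] average_scaleR[of "-1" x] by (intro eq_minus_self) simp

lemma average_swap: "\<omega> x = - y \<Longrightarrow> \<omega> y = - x \<Longrightarrow> average \<omega> x = (1 / 2) *\<^sub>R (x - y)"
  using average_involution[of x] by (simp add: linear_neg[OF lin])

lemma Phi_re_rsums:
  assumes \<Phi>: "\<Phi> = rsums P e l"
    and avg: "\<And>i. i \<in> {1..l} \<Longrightarrow> average \<omega> (e i) = sg f (\<pi> (int i))"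
    and odd: "\<And>a. \<pi> (- a) = - \<pi> a"
    and f: "orthogonal_family f r c"
    and ran: "\<And>a. \<bar>a\<bar> \<le> int l \<Longrightarrow> \<bar>\<pi> a\<bar> \<le> int r"
    and into: "\<And>a b. \<bar>a\<bar> \<le> int l \<Longrightarrow> \<bar>b\<bar> \<le> int l \<Longrightarrow> P a b \<Longrightarrow> \<pi> a = - \<pi> b \<or> Q (\<pi> a) (\<pi> b)"
    and onto: "\<And>u v. \<bar>u\<bar> \<le> int r \<Longrightarrow> \<bar>v\<bar> \<le> int r \<Longrightarrow> Q u v \<Longrightarrow>
      \<exists>a b. \<bar>a\<bar> \<le> int l \<and> \<bar>b\<bar> \<le> int l \<and> P a b \<and> \<pi> a = u \<and> \<pi> b = v"
    and Q: "\<And>u v. Q u v \<Longrightarrow> u \<noteq> - v"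
  shows "Phi_re \<omega> \<Phi> = rsums Q f r"
proof -
  have avg': "average \<omega> (sg e a) = sg f (\<pi> a)" if a: "\<bar>a\<bar> \<le> int l" for a
  proof -
    consider "a = 0" | i where "a = int i" "i \<in> {1..l}" | i where "a = - int i" "i \<in> {1..l}"
      using a by (cases a rule: int_cases2) fastforce+
    then show ?thesis
    proof cases
      case 1
      then show ?thesis using odd[of 0] linear_0[OF linear_average] by simp
    next
      case 2
      then show ?thesis using avg by (simp add: sg_int)
    next
      case 3
      then show ?thesis using avg by (simp add: sg_int sg_minus odd linear_neg[OF linear_average])
    qed
  qed
  show ?thesis
  proof
    show "Phi_re \<omega> \<Phi> \<subseteq> rsums Q f r"
    proof
      fix x assume "x \<in> Phi_re \<omega> \<Phi>"
      then obtain \<beta> where x: "x = average \<omega> \<beta>" "\<beta> \<in> rsums P e l" "average \<omega> \<beta> \<noteq> 0"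
        unfolding Phi_re_def \<Phi> by blast
      then obtain a b where ab: "\<beta> = sg e a + sg e b" "\<bar>a\<bar> \<le> int l" "\<bar>b\<bar> \<le> int l" "P a b"
        unfolding rsums_def by blast
      have eq: "x = sg f (\<pi> a) + sg f (\<pi> b)" using x(1) ab by (simp add: average_add avg')
      have "\<pi> a \<noteq> - \<pi> b" using eq x by (auto simp: sg_minus)
      then have "Q (\<pi> a) (\<pi> b)" using into ab by blast
      then show "x \<in> rsums Q f r" using eq ran ab by (intro rsumsI) auto
    qed
    show "rsums Q f r \<subseteq> Phi_re \<omega> \<Phi>"
    proof
      fix x assume "x \<in> rsums Q f r"
      then obtain u v where uv: "x = sg f u + sg f v" "\<bar>u\<bar> \<le> int r" "\<bar>v\<bar> \<le> int r" "Q u v"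
        unfolding rsums_def by blast
      then obtain a b where ab: "\<bar>a\<bar> \<le> int l" "\<bar>b\<bar> \<le> int l" "P a b" "\<pi> a = u" "\<pi> b = v"
        using onto by blast
      have "x = average \<omega> (sg e a + sg e b)" using uv ab by (simp add: average_add avg')
      moreover have "sg e a + sg e b \<in> \<Phi>" unfolding \<Phi> using ab by (intro rsumsI[of P a b]) auto
      moreover have "x \<noteq> 0"
        unfolding uv(1) by (rule sg_sum_nonzero[OF f uv(2,3) Q[OF uv(4)]])
      ultimately show "x \<in> Phi_re \<omega> \<Phi>" unfolding Phi_re_def by blast
    qed
  qed
qed

end

text \<open>The index \<open>\<pi> a\<close> with \<open>average (sg e a) = sg f (\<pi> a)\<close> when \<open>f i = (e i - e (l + 1 - i)) / 2\<close> for
  \<open>i \<le> r\<close> and the \<open>l - 2 r\<close> vectors in the middle are averaged to \<open>0\<close>.\<close>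

definition fold_index :: "nat \<Rightarrow> nat \<Rightarrow> int \<Rightarrow> int" where
  "fold_index l r a = (if \<bar>a\<bar> \<le> int r then a else if \<bar>a\<bar> \<le> int l - int r then 0
     else if a > 0 then a - (int l + 1) else a + (int l + 1))"

text \<open>The same for \<open>f i = (e (i + 1) - e (l - i)) / 2\<close>, with \<open>e 1\<close> and \<open>e l\<close> averaged to \<open>0\<close> as well.\<close>

definition inner_fold_index :: "nat \<Rightarrow> nat \<Rightarrow> int \<Rightarrow> int" where
  "inner_fold_index l r a = (if \<bar>a\<bar> \<le> 1 \<or> \<bar>a\<bar> = int l then 0
     else if \<bar>a\<bar> \<le> int r + 1 then (if a > 0 then a - 1 else a + 1)
     else if \<bar>a\<bar> < int l - int r then 0 else if a > 0 then a - int l else a + int l)"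

context classical
begin

interpretation omega: finite_order_map "omega_elt l \<alpha> j" for j
  by (rule finite_order_omega)

lemma omega_neg_first:
  assumes "z = e l"
  shows "omega_elt l \<alpha> 1 (e 1) = - e 1" and "i \<in> {2..l} \<Longrightarrow> omega_elt l \<alpha> 1 (e i) = e i"
proof -
  have 0: "w_elt l \<alpha> 0 (e i) = - e i" if "i \<in> {1..l}" for i
    by (rule w_elt_neg[of 1]) (use assms that in auto)
  have 1: "w_elt l \<alpha> 1 (e i) = - e i" if "i \<in> {2..l}" for i
    by (rule w_elt_neg[of 1]) (use assms that in auto)
  have "e 1 \<bullet> z = 0" using assms l2 by (simp add: e_inner)
  then have "w_elt l \<alpha> 1 (e 1) = e 1" using w_elt_fixes_e1 e1_orthogonal by blast
  then show "omega_elt l \<alpha> 1 (e 1) = - e 1"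
    using 0[of 1] l2 by (simp add: omega_elt_def linear_neg[OF w_elt_linear])
  show "i \<in> {2..l} \<Longrightarrow> omega_elt l \<alpha> 1 (e i) = e i"
    using 0[of i] 1[of i] by (simp add: omega_elt_def linear_neg[OF w_elt_linear])
qed

theorem type_B_first:
  assumes zB: "z = e l"
  shows "has_type (fixed_space (omega_elt l \<alpha> 1)) (Phi_re (omega_elt l \<alpha> 1) \<Phi>) (Type_B (l - 1))"
proof -
  let ?f = "\<lambda>i. e (Suc i)"
  have f: "orthogonal_family ?f (l - 1) c"
    unfolding simplex_family_def using c_pos by (auto simp: e_inner)
  have \<Phi>: "\<Phi> = rsums cond_B e l" using roots_eq orb_single[OF e, of 1] l2 zB by simp
  have "Phi_re (omega_elt l \<alpha> 1) \<Phi> = rsums cond_B ?f (l - 1)"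
  proof (rule omega.Phi_re_rsums[OF \<Phi> _ _ f, where \<pi> = "\<lambda>a. if a > 0 then a - 1 else if a < 0 then a + 1 else 0"])
    fix i assume i: "i \<in> {1..l}"
    show "average (omega_elt l \<alpha> 1) (e i) = sg ?f (if int i > 0 then int i - 1 else if int i < 0 then int i + 1 else 0)"
    proof (cases "i = 1")
      case True
      then show ?thesis using omega_neg_first(1)[OF zB] by (simp add: omega.average_neg_zero)
    next
      case False
      then have "omega_elt l \<alpha> 1 (e i) = e i" using omega_neg_first(2)[OF zB, of i] i by auto
      then have "average (omega_elt l \<alpha> 1) (e i) = e i" by (rule omega.average_fixed)
      moreover have "int i - 1 = int (i - 1)" "Suc (i - 1) = i" "0 < i - 1" using i False by auto
      ultimately show ?thesis using i sg_int[of "i - 1" ?f] by simp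
    qed
  next
    fix u v :: int assume "\<bar>u\<bar> \<le> int (l - 1)" "\<bar>v\<bar> \<le> int (l - 1)" "cond_B u v"
    then show "\<exists>a b. \<bar>a\<bar> \<le> int l \<and> \<bar>b\<bar> \<le> int l \<and> cond_B a b \<and>
        (if a > 0 then a - 1 else if a < 0 then a + 1 else 0) = u \<and>
        (if b > 0 then b - 1 else if b < 0 then b + 1 else 0) = v"
      by (intro exI[of _ "if u > 0 then u + 1 else if u < 0 then u - 1 else 0"]
          exI[of _ "if v > 0 then v + 1 else if v < 0 then v - 1 else 0"]) (auto simp: cond_B_def)
  qed (auto simp: cond_B_def)
  then show ?thesis
    using has_type_B[OF f] omega.span_Phi_re[OF span_roots, of 1] l2 by simp
qed

lemma reverse_family:
  assumes "2 * r \<le> l"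
  shows "orthogonal_family (\<lambda>i. (1 / 2) *\<^sub>R (e i - e (Suc l - i))) r (c / 2)"
  unfolding simplex_family_def
proof (intro conjI ballI)
  fix i k assume ik: "i \<in> {1..r}" "k \<in> {1..r}"
  then have "i \<in> {1..l}" "k \<in> {1..l}" "Suc l - i \<in> {1..l}" "Suc l - k \<in> {1..l}"
    "i \<noteq> Suc l - k" "Suc l - i \<noteq> k" "Suc l - i = Suc l - k \<longleftrightarrow> i = k"
    using assms by auto
  then show "(1 / 2) *\<^sub>R (e i - e (Suc l - i)) \<bullet> (1 / 2) *\<^sub>R (e k - e (Suc l - k)) = 0 + (if i = k then c / 2 else 0)"
    by (simp add: inner_diff_left inner_diff_right e_inner)
qed (simp add: c_pos)

lemma average_reverse:
  assumes rev: "\<And>i. i \<in> {1..l} \<Longrightarrow> omega_elt l \<alpha> l (e i) = - e (Suc l - i)"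
    and r: "l = 2 * r \<or> l = 2 * r + 1" and i: "i \<in> {1..l}"
  shows "average (omega_elt l \<alpha> l) (e i) = sg (\<lambda>i. (1 / 2) *\<^sub>R (e i - e (Suc l - i))) (fold_index l r (int i))"
    (is "_ = sg ?f _")
proof -
  have i': "Suc l - i \<in> {1..l}" "Suc l - (Suc l - i) = i" using i by auto
  have avg: "average (omega_elt l \<alpha> l) (e i) = (1 / 2) *\<^sub>R (e i - e (Suc l - i))"
    using omega.average_swap rev[OF i] rev[OF i'(1)] i' by metis
  consider "i \<le> r" | "r < i" "i \<le> l - r" | "i > l - r" "r < i" using r by linarith
  then show ?thesis
  proof cases
    case 1
    then show ?thesis using avg i by (simp add: fold_index_def sg_int)
  next
    case 2
    then have "Suc l - i = i" "fold_index l r (int i) = 0" using r by (auto simp: fold_index_def)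
    then show ?thesis using avg by simp
  next
    case 3
    then have "fold_index l r (int i) = - int (Suc l - i)" using i r by (auto simp: fold_index_def)
    moreover have "0 < Suc l - i" using i by simp
    ultimately have "sg ?f (fold_index l r (int i)) = - ?f (Suc l - i)"
      by (simp only: sg_minus sg_int)
    also have "\<dots> = (1 / 2) *\<^sub>R (e i - e (Suc l - i))" by (simp add: i'(2) scaleR_diff_right)
    finally show ?thesis using avg by simp
  qed
qed

lemma fold_index_minus: "fold_index l r (- a) = - fold_index l r a"
  and fold_index_le: "2 * r \<le> l \<Longrightarrow> \<bar>a\<bar> \<le> int l \<Longrightarrow> \<bar>fold_index l r a\<bar> \<le> int r"
  by (auto simp: fold_index_def)

lemma omega_reverse:
  assumes "z = 2 *\<^sub>R e l" "i \<in> {1..l}"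
  shows "omega_elt l \<alpha> l (e i) = - e (Suc l - i)"
proof -
  have "w_elt l \<alpha> 0 (e i) = - e i" by (rule w_elt_neg[of 2]) (use assms in auto)
  moreover have "z \<bullet> height_vector (Suc l) = 2 * (sg e (int l) \<bullet> height_vector (Suc l))"
    using l2 by (simp add: assms sg_int)
  then have "z \<bullet> height_vector (Suc l) > 0"
    using c_pos l2 by (subst (asm) height_vector_inner) auto
  then have "w_elt l \<alpha> l (e i) = e (Suc l - i)" by (rule w_elt_rev) (rule assms)
  ultimately show ?thesis by (simp add: omega_elt_def linear_neg[OF w_elt_linear])
qed

theorem type_C_last:
  assumes zC: "z = 2 *\<^sub>R e l"
  shows "even l \<Longrightarrow> has_type (fixed_space (omega_elt l \<alpha> l)) (Phi_re (omega_elt l \<alpha> l) \<Phi>) (Type_C (l div 2))"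
    and "odd l \<Longrightarrow> has_type_BC (fixed_space (omega_elt l \<alpha> l)) (Phi_re (omega_elt l \<alpha> l) \<Phi>) ((l - 1) div 2)"
proof -
  let ?\<omega> = "omega_elt l \<alpha> l"
  define r where "r = l div 2"
  have r: "l = 2 * r \<or> l = 2 * r + 1" "2 * r \<le> l" "1 \<le> r" using l2 by (auto simp: r_def)
  let ?f = "\<lambda>i. (1 / 2) *\<^sub>R (e i - e (Suc l - i))"
  note f = reverse_family[OF r(2)]
  have \<Phi>: "\<Phi> = rsums cond_C e l" using roots_eq orb_single[OF e, of 2] l2 zC by simp
  note * = omega.Phi_re_rsums[OF \<Phi> average_reverse[OF omega_reverse[OF zC] r(1)] fold_index_minus f
      fold_index_le[OF r(2)]]
  {
    assume "even l"
    then have l: "l = 2 * r" by (simp add: r_def)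
    have "Phi_re ?\<omega> \<Phi> = rsums cond_C ?f r"
    proof (rule *)
      fix u v :: int assume "\<bar>u\<bar> \<le> int r" "\<bar>v\<bar> \<le> int r" "cond_C u v"
      then show "\<exists>a b. \<bar>a\<bar> \<le> int l \<and> \<bar>b\<bar> \<le> int l \<and> cond_C a b \<and> fold_index l r a = u \<and> fold_index l r b = v"
        using l by (intro exI[of _ u] exI[of _ v]) (auto simp: fold_index_def)
    qed (use l in \<open>auto simp: cond_C_def fold_index_def split: if_splits\<close>)
    then show "has_type (fixed_space ?\<omega>) (Phi_re ?\<omega> \<Phi>) (Type_C (l div 2))"
      using has_type_C[OF f] omega.span_Phi_re[OF span_roots, of l] r(3) l by simp
  }
  {
    assume "odd l"
    then have l: "l = 2 * r + 1" using r by auto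
    have "Phi_re ?\<omega> \<Phi> = rsums cond_BC ?f r"
    proof (rule *)
      fix u v :: int assume "\<bar>u\<bar> \<le> int r" "\<bar>v\<bar> \<le> int r" "cond_BC u v"
      then show "\<exists>a b. \<bar>a\<bar> \<le> int l \<and> \<bar>b\<bar> \<le> int l \<and> cond_C a b \<and> fold_index l r a = u \<and> fold_index l r b = v"
        using l by (intro exI[of _ "if u = 0 then int r + 1 else u"] exI[of _ "if v = 0 then int r + 1 else v"])
          (auto simp: fold_index_def cond_C_def cond_BC_def)
    qed (auto simp: cond_BC_def)
    moreover have "(l - 1) div 2 = r" using l by simp
    ultimately show "has_type_BC (fixed_space ?\<omega>) (Phi_re ?\<omega> \<Phi>) ((l - 1) div 2)"
      using has_type_BC_sums[OF f] omega.span_Phi_re[OF span_roots, of l] r(3) by simp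
  }
qed

end

context type_D
begin

interpretation omega: finite_order_map "omega_elt l \<alpha> j" for j
  by (rule finite_order_omega)

lemma roots_D: "\<Phi> = rsums cond_D e l"
  using roots_eq orb_D[OF e l2] zD by simp

lemma omega_D_first:
  shows "omega_elt l \<alpha> 1 (e 1) = - e 1" "omega_elt l \<alpha> 1 (e l) = - e l"
    and "i \<in> {2..<l} \<Longrightarrow> omega_elt l \<alpha> 1 (e i) = e i"
proof -
  have "e 1 \<bullet> z = 0" using zD l3 by (simp add: e_inner inner_add_right)
  then have "w_elt l \<alpha> 1 (e 1) = e 1" using w_elt_fixes_e1 e1_orthogonal by blast
  then show "omega_elt l \<alpha> 1 (e 1) = - e 1"
    using w_elt_neg_D(1)[of 0 1] l3 by (simp add: omega_elt_def linear_neg[OF w_elt_linear])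
  have "even (l - 1) \<longleftrightarrow> \<not> even l" using l3 by auto
  then show "omega_elt l \<alpha> 1 (e l) = - e l"
    using w_elt_neg_D(2)[of 0] w_elt_neg_D(2)[of 1] by (simp add: omega_elt_def linear_neg[OF w_elt_linear])
  show "i \<in> {2..<l} \<Longrightarrow> omega_elt l \<alpha> 1 (e i) = e i"
    using w_elt_neg_D(1)[of 0 i] w_elt_neg_D(1)[of 1 i]
    by (auto simp: omega_elt_def linear_neg[OF w_elt_linear] numeral_2_eq_2 One_nat_def)
qed

theorem type_D_first:
  "has_type (fixed_space (omega_elt l \<alpha> 1)) (Phi_re (omega_elt l \<alpha> 1) \<Phi>) (Type_B (l - 2))"
proof -
  let ?f = "\<lambda>i. e (Suc i)"
  let ?\<pi> = "\<lambda>a::int. if \<bar>a\<bar> = int l then 0 else if a > 0 then a - 1 else if a < 0 then a + 1 else 0"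
  have f: "orthogonal_family ?f (l - 2) c"
    unfolding simplex_family_def using c_pos by (auto simp: e_inner)
  have "Phi_re (omega_elt l \<alpha> 1) \<Phi> = rsums cond_B ?f (l - 2)"
  proof (rule omega.Phi_re_rsums[OF roots_D _ _ f, where \<pi> = ?\<pi>])
    fix i assume i: "i \<in> {1..l}"
    consider "i = 1" | "i = l" | "i \<in> {2..<l}" using i by force
    then show "average (omega_elt l \<alpha> 1) (e i) = sg ?f (?\<pi> (int i))"
    proof cases
      case 3
      then have "average (omega_elt l \<alpha> 1) (e i) = e i" by (intro omega.average_fixed omega_D_first(3))
      moreover have "?\<pi> (int i) = int (i - 1)" "Suc (i - 1) = i" "0 < i - 1" using 3 by auto
      ultimately show ?thesis using i sg_int[of "i - 1" ?f] by simp
    qed (use omega_D_first(1,2) l3 in \<open>simp_all add: omega.average_neg_zero\<close>)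
  next
    fix u v :: int assume uv: "\<bar>u\<bar> \<le> int (l - 2)" "\<bar>v\<bar> \<le> int (l - 2)" "cond_B u v"
    let ?s = "\<lambda>u::int. if u > 0 then u + 1 else if u < 0 then u - 1 else 1"
    have s: "\<bar>?s u\<bar> = \<bar>u\<bar> + 1" "\<bar>u\<bar> \<le> int (l - 2) \<Longrightarrow> ?\<pi> (?s u) = u" "?s u \<noteq> 0" for u
      using l3 by auto
    have "cond_D (?s u) (?s v)" using uv(3) s(1,3) unfolding cond_B_def cond_D_def by presburger
    moreover have "\<bar>?s u\<bar> \<le> int l" "\<bar>?s v\<bar> \<le> int l" using uv(1,2) s(1)[of u] s(1)[of v] l3 by linarith+
    ultimately show "\<exists>a b. \<bar>a\<bar> \<le> int l \<and> \<bar>b\<bar> \<le> int l \<and> cond_D a b \<and> ?\<pi> a = u \<and> ?\<pi> b = v"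
      using s(2)[OF uv(1)] s(2)[OF uv(2)] by blast
  next
    fix a b :: int assume ab: "\<bar>a\<bar> \<le> int l" "\<bar>b\<bar> \<le> int l" "cond_D a b"
    have p: "a \<noteq> 0 \<Longrightarrow> \<bar>?\<pi> a\<bar> = (if \<bar>a\<bar> = int l then 0 else \<bar>a\<bar> - 1)" for a by auto
    show "?\<pi> a = - ?\<pi> b \<or> cond_B (?\<pi> a) (?\<pi> b)"
    proof (cases "\<bar>?\<pi> a\<bar> = \<bar>?\<pi> b\<bar>")
      case True
      then have "\<bar>?\<pi> a\<bar> = 0" "\<bar>?\<pi> b\<bar> = 0"
        using ab p[of a] p[of b] l3 unfolding cond_D_def by (auto split: if_splits)
      then show ?thesis by simp
    qed (simp add: cond_B_def)
  next
    fix a :: int assume "\<bar>a\<bar> \<le> int l"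
    then show "\<bar>?\<pi> a\<bar> \<le> int (l - 2)" using l3 by auto
  next
    fix u v :: int assume "cond_B u v"
    then show "u \<noteq> - v" by (auto simp: cond_B_def)
  qed auto
  then show ?thesis
    using has_type_B[OF f] omega.span_Phi_re[OF span_roots, of 1] l3 by simp
qed

lemma omega_D_last:
  shows "i \<in> {1..<l} \<Longrightarrow> omega_elt l \<alpha> l (e i) = - e (Suc l - i)"
    and "omega_elt l \<alpha> l (e l) = (if even l then - e 1 else e 1)"
proof -
  have "z \<bullet> height_vector (Suc l) = sg e (int (l - 1)) \<bullet> height_vector (Suc l) + sg e (int l) \<bullet> height_vector (Suc l)"
    using l3 by (simp add: zD inner_add_left sg_int del: of_nat_diff)
  then have "z \<bullet> height_vector (Suc l) > 0"
    using c_pos l3 by (subst (asm) (1 2) height_vector_inner) auto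
  note rev = w_elt_rev[OF this]
  show "i \<in> {1..<l} \<Longrightarrow> omega_elt l \<alpha> l (e i) = - e (Suc l - i)"
    using w_elt_neg_D(1)[of 0 i] rev[of i] by (simp add: omega_elt_def linear_neg[OF w_elt_linear] One_nat_def)
  show "omega_elt l \<alpha> l (e l) = (if even l then - e 1 else e 1)"
    using w_elt_neg_D(2)[of 0] rev[of l] l3 by (simp add: omega_elt_def linear_neg[OF w_elt_linear] One_nat_def)
qed

theorem type_D_last_even:
  assumes "even l"
  shows "has_type (fixed_space (omega_elt l \<alpha> l)) (Phi_re (omega_elt l \<alpha> l) \<Phi>) (Type_C (l div 2))"
proof -
  let ?\<omega> = "omega_elt l \<alpha> l"
  define r where "r = l div 2"
  have l: "l = 2 * r" using assms by (simp add: r_def)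
  have r: "l = 2 * r \<or> l = 2 * r + 1" "2 * r \<le> l" "1 \<le> r" using l l3 by auto
  let ?f = "\<lambda>i. (1 / 2) *\<^sub>R (e i - e (Suc l - i))"
  note f = reverse_family[OF r(2)]
  have rev: "?\<omega> (e i) = - e (Suc l - i)" if "i \<in> {1..l}" for i
    using omega_D_last that assms by (cases "i = l") (auto simp: One_nat_def)
  have "Phi_re ?\<omega> \<Phi> = rsums cond_C ?f r"
  proof (rule omega.Phi_re_rsums[OF roots_D average_reverse[OF rev r(1)] fold_index_minus f fold_index_le[OF r(2)]])
    fix u v :: int assume "\<bar>u\<bar> \<le> int r" "\<bar>v\<bar> \<le> int r" "cond_C u v"
    then show "\<exists>a b. \<bar>a\<bar> \<le> int l \<and> \<bar>b\<bar> \<le> int l \<and> cond_D a b \<and> fold_index l r a = u \<and> fold_index l r b = v"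
      using l by (intro exI[of _ u] exI[of _ "if u = v then (if v > 0 then v - (int l + 1) else v + (int l + 1)) else v"])
        (auto simp: fold_index_def cond_C_def cond_D_def)
  qed (use l in \<open>auto simp: cond_C_def cond_D_def fold_index_def split: if_splits\<close>)
  then show ?thesis
    using has_type_C[OF f] omega.span_Phi_re[OF span_roots, of l] r(3) l by simp
qed

theorem type_D_last_odd:
  assumes "odd l" "5 \<le> l"
  shows "has_type_BC (fixed_space (omega_elt l \<alpha> l)) (Phi_re (omega_elt l \<alpha> l) \<Phi>) ((l - 3) div 2)"
proof -
  let ?\<omega> = "omega_elt l \<alpha> l"
  define r where "r = (l - 3) div 2"
  have l: "l = 2 * r + 3" "1 \<le> r" using assms by (auto simp: r_def elim!: oddE)
  let ?f = "\<lambda>i. (1 / 2) *\<^sub>R (e (Suc i) - e (l - i))"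
  have f: "orthogonal_family ?f r (c / 2)"
    unfolding simplex_family_def
  proof (intro conjI ballI)
    fix i k assume ik: "i \<in> {1..r}" "k \<in> {1..r}"
    then have "Suc i \<in> {1..l}" "Suc k \<in> {1..l}" "l - i \<in> {1..l}" "l - k \<in> {1..l}"
      "Suc i \<noteq> l - k" "l - i \<noteq> Suc k" "l - i = l - k \<longleftrightarrow> i = k"
      using l by auto
    then show "?f i \<bullet> ?f k = 0 + (if i = k then c / 2 else 0)"
      by (simp add: inner_diff_left inner_diff_right e_inner)
  qed (simp add: c_pos)
  have ends: "?\<omega> (e 1) = - e l" "?\<omega> (e l) = e 1"
    using omega_D_last(1)[of 1] omega_D_last(2) assms l3 by (auto simp: One_nat_def)
  have "average ?\<omega> (e 1) = - average ?\<omega> (e l)" "average ?\<omega> (e l) = average ?\<omega> (e 1)"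
    using omega.average_map[of l "e 1"] omega.average_map[of l "e l"]
    by (simp_all add: ends linear_neg[OF omega.linear_average])
  then have avg0: "average ?\<omega> (e 1) = 0" "average ?\<omega> (e l) = 0"
    using eq_minus_self by metis+
  have "Phi_re ?\<omega> \<Phi> = rsums cond_BC ?f r"
  proof (rule omega.Phi_re_rsums[OF roots_D _ _ f, where \<pi> = "inner_fold_index l r"])
    fix i assume i: "i \<in> {1..l}"
    consider "i = 1" | "i = l" | "i \<in> {2..<l}" using i by force
    then show "average ?\<omega> (e i) = sg ?f (inner_fold_index l r (int i))"
    proof cases
      case 3
      then have i': "Suc l - i \<in> {1..<l}" "Suc l - (Suc l - i) = i" "i \<in> {1..<l}" by auto
      have avg: "average ?\<omega> (e i) = (1 / 2) *\<^sub>R (e i - e (Suc l - i))"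
        using omega.average_swap omega_D_last(1)[OF i'(1)] omega_D_last(1)[OF i'(3)] i' by metis
      consider "i \<le> r + 1" | "i = r + 2" | "i > r + 2" using l by linarith
      then show ?thesis
      proof cases
        case 1
        then have "inner_fold_index l r (int i) = int (i - 1)" "0 < i - 1" "Suc (i - 1) = i" "l - (i - 1) = Suc l - i"
          using 3 l by (auto simp: inner_fold_index_def)
        then show ?thesis using avg sg_int[of "i - 1" ?f] by simp
      next
        case 2
        then have "Suc l - i = i" "inner_fold_index l r (int i) = 0" using l by (auto simp: inner_fold_index_def)
        then show ?thesis using avg by simp
      next
        case 3
        then have "inner_fold_index l r (int i) = - int (l - i)" "0 < l - i" "Suc (l - i) = Suc l - i" "l - (l - i) = i"
          using \<open>i \<in> {2..<l}\<close> l by (auto simp: inner_fold_index_def)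
        then have "sg ?f (inner_fold_index l r (int i)) = - ?f (l - i)"
          using sg_int[of "l - i" ?f] by (simp only: sg_minus)
        also have "\<dots> = (1 / 2) *\<^sub>R (e i - e (Suc l - i))"
          using \<open>Suc (l - i) = Suc l - i\<close> \<open>l - (l - i) = i\<close> by (simp add: scaleR_diff_right)
        finally show ?thesis using avg by simp
      qed
    qed (use avg0 in \<open>simp_all add: inner_fold_index_def\<close>)
  next
    fix u v :: int assume uv: "\<bar>u\<bar> \<le> int r" "\<bar>v\<bar> \<le> int r" "cond_BC u v"
    let ?s = "\<lambda>u::int. if u > 0 then u + 1 else if u < 0 then u - 1 else 1"
    let ?t = "\<lambda>u::int. if u > 0 then u - int l else u + int l"
    have s: "\<bar>?s u\<bar> = \<bar>u\<bar> + 1" "inner_fold_index l r (?s u) = u" "?s u \<noteq> 0" if "\<bar>u\<bar> \<le> int r" for u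
      using l that by (auto simp: inner_fold_index_def)
    have t: "\<bar>?t u\<bar> = int l - \<bar>u\<bar>" "inner_fold_index l r (?t u) = u" if "\<bar>u\<bar> \<le> int r" "u \<noteq> 0" for u
      using l that by (auto simp: inner_fold_index_def)
    show "\<exists>a b. \<bar>a\<bar> \<le> int l \<and> \<bar>b\<bar> \<le> int l \<and> cond_D a b \<and> inner_fold_index l r a = u \<and> inner_fold_index l r b = v"
    proof (cases "u = v")
      case True
      then have v: "v \<noteq> 0" using uv(3) by (auto simp: cond_BC_def)
      note s = s[OF uv(1)] and t = t[OF uv(2) v]
      have "\<bar>?s u\<bar> \<le> int l" "\<bar>?t v\<bar> \<le> int l" "\<bar>?s u\<bar> \<noteq> \<bar>?t v\<bar>" "\<bar>?t v\<bar> \<noteq> 0"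
        unfolding s(1) t(1) using uv(1,2) l by linarith+
      then have "cond_D (?s u) (?t v)" using s(3) unfolding cond_D_def by simp
      with \<open>\<bar>?s u\<bar> \<le> int l\<close> \<open>\<bar>?t v\<bar> \<le> int l\<close> s(2) t(2) show ?thesis by blast
    next
      case False
      note su = s[OF uv(1)] and sv = s[OF uv(2)]
      have "\<bar>?s u\<bar> \<le> int l" "\<bar>?s v\<bar> \<le> int l"
        unfolding su(1) sv(1) using uv(1,2) l by linarith+
      moreover have "\<bar>?s u\<bar> \<noteq> \<bar>?s v\<bar>"
        unfolding su(1) sv(1) using False uv(3) by (auto simp: cond_BC_def int_abs_eq_iff)
      then have "cond_D (?s u) (?s v)" using su(3) sv(3) unfolding cond_D_def by simp
      ultimately show ?thesis using su(2) sv(2) by blast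
    qed
  next
    fix a :: int
    show "inner_fold_index l r (- a) = - inner_fold_index l r a" by (auto simp: inner_fold_index_def)
    assume "\<bar>a\<bar> \<le> int l"
    then show "\<bar>inner_fold_index l r a\<bar> \<le> int r" using l by (auto simp: inner_fold_index_def)
  qed (auto simp: cond_BC_def)
  then show ?thesis
    using has_type_BC_sums[OF f l(2)] omega.span_Phi_re[OF span_roots, of l] unfolding r_def by simp
qed

end

section \<open>Folding in type A\<close>

lemma sum_periodic_shift:
  fixes a :: "nat \<Rightarrow> 'a::ab_group_add"
  assumes "\<And>t. a (t + h) = a t"
  shows "(\<Sum>t<h. a (t + s)) = (\<Sum>t<h. a t)"
proof (induction s)
  case (Suc s)
  have "(\<Sum>t<h. a (Suc t + s)) + a s = (\<Sum>t<Suc h. a (t + s))"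
    by (subst sum.lessThan_Suc_shift) (simp add: add.commute)
  also have "\<dots> = (\<Sum>t<h. a (t + s)) + a s" using assms[of s] by (simp add: add.commute)
  finally show ?case using Suc by simp
qed simp

locale type_A = rbase +
  fixes e :: "nat \<Rightarrow> 'a" and c d :: real
  assumes e: "simplex_family e (Suc l) c d" and simple: "\<And>i. i \<in> {1..l} \<Longrightarrow> \<alpha> i = e i - e (Suc i)"
begin

lemma c_pos: "c > 0"
  using e by (simp add: simplex_family_def)

lemma e_inner: "i \<in> {1..Suc l} \<Longrightarrow> k \<in> {1..Suc l} \<Longrightarrow> e i \<bullet> e k = d + (if i = k then c else 0)"
  using simplex_familyD[OF e] by simp

lemma refl_group_action:
  assumes "w \<in> refl_group \<alpha> {1..l}"
  obtains (perm) p where "\<And>a. a \<in> {1..Suc l} \<Longrightarrow> p a \<in> {1..Suc l} \<and> w (e a) = e (p a)"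
proof -
  obtain "is" where "set is \<subseteq> {1..l}" "w = refl_word \<alpha> is" using assms by (auto simp: refl_group_iff)
  moreover have "set is \<subseteq> {1..l} \<Longrightarrow>
      \<exists>p. \<forall>a\<in>{1..Suc l}. p a \<in> {1..Suc l} \<and> refl_word \<alpha> is (e a) = e (p a)" for "is"
  proof (induction "is")
    case Nil
    show ?case by (intro exI[of _ id]) simp
  next
    case (Cons i "is")
    then obtain p where p: "\<forall>a\<in>{1..Suc l}. p a \<in> {1..Suc l} \<and> refl_word \<alpha> is (e a) = e (p a)" by auto
    let ?t = "\<lambda>x. if x = i then Suc i else if x = Suc i then i else x"
    have i: "i \<in> {1..Suc l}" "Suc i \<in> {1..Suc l}" "\<alpha> i = e i - e (Suc i)" using Cons.prems simple by auto
    have "reflection (\<alpha> i) (e x) = e (?t x)" "?t x \<in> {1..Suc l}" if "x \<in> {1..Suc l}" for x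
      using reflection_diff_family[OF e i(1,2) _ that] i that by auto
    then show ?case
      using p by (intro exI[of _ "\<lambda>a. ?t (p a)"]) (auto simp: refl_word_Cons)
  qed
  ultimately show ?thesis using perm by blast
qed

lemma w_elt_A:
  assumes j: "j \<le> l" and i: "i \<in> {1..Suc l}"
  shows "w_elt l \<alpha> j (e i) = e (if i \<le> j then j + 1 - i else j + l + 2 - i)"
proof -
  have "w_elt l \<alpha> j \<in> refl_group \<alpha> {1..l}" by (rule w_elt_in_group)
  then obtain p where p: "\<And>a. a \<in> {1..Suc l} \<Longrightarrow> p a \<in> {1..Suc l} \<and> w_elt l \<alpha> j (e a) = e (p a)"
    using refl_group_action by blast
  define x where "x = (\<Sum>k=1..j. e k)"
  have ex: "e k \<bullet> x = real j * d + (if k \<le> j then c else 0)" if "k \<in> {1..Suc l}" for k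
    unfolding x_def using partial_sum_dual[OF e that] j by simp
  have orth: "x \<bullet> \<alpha> k = 0" if "k \<in> {1..l} - {j}" for k
    using that ex[of k] ex[of "Suc k"] by (auto simp: simple inner_diff_right inner_commute[of x])
  have wx: "w_elt l \<alpha> j x = x" by (rule refl_group_fixes[OF w_elt(1) orth])
  obtain "is" where w_is: "w_elt l \<alpha> j = refl_word \<alpha> is" using w_elt(1) by (auto simp: refl_group_iff)
  have low: "p k \<le> j \<longleftrightarrow> k \<le> j" if k: "k \<in> {1..Suc l}" for k
  proof -
    have "e (p k) \<bullet> x = e k \<bullet> x"
      using refl_word_inner[of \<alpha> "is" "e k" x] p[OF k] wx w_is by simp
    then show ?thesis using ex[OF k] ex[of "p k"] p[OF k] c_pos by (auto split: if_splits)
  qed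
  obtain \<rho> where \<rho>: "\<And>k. k \<in> {1..l} \<Longrightarrow> \<rho> \<bullet> \<alpha> k = 1"
    using dual_vectors[OF indep_simple inj_simple, of "\<lambda>_. 1"] by blast
  have e\<rho>: "k \<le> Suc l \<Longrightarrow> e k \<bullet> \<rho> = e 1 \<bullet> \<rho> + 1 - real k" if "1 \<le> k" for k
    using that
  proof (induction k rule: dec_induct)
    case (step k)
    then have "e (Suc k) = e k - \<alpha> k" using simple[of k] by simp
    then show ?case using step \<rho>[of k] by (simp add: inner_diff_left inner_commute[of "\<alpha> k"])
  qed simp
  have dec: "p (Suc k) < p k" if k: "k \<in> {1..l} - {j}" for k
  proof -
    have "w_elt l \<alpha> j (\<alpha> k) \<bullet> \<rho> < 0"
      by (rule w_elt_decreasing) (use k \<rho> in \<open>auto simp: inner_commute[of _ \<rho>]\<close>)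
    moreover have "w_elt l \<alpha> j (\<alpha> k) = e (p k) - e (p (Suc k))"
      using p[of k] p[of "Suc k"] k simple[of k]
      by (simp add: linear_diff[OF w_elt_linear])
    ultimately show ?thesis
      using e\<rho>[of "p k"] e\<rho>[of "p (Suc k)"] p[of k] p[of "Suc k"] k by (simp add: inner_diff_left)
  qed
  have "p i = (if i \<le> j then j + 1 - i else j + l + 2 - i)"
  proof (cases "i \<le> j")
    case True
    have "int (p i) = int 1 + int j - int i"
    proof (rule interval_rev[where q = "\<lambda>k. int (p k)"])
      show "int (p (Suc k)) < int (p k)" if "k \<in> {1..<j}" for k
        using dec[of k] that j by auto
    qed (use True i j low[of 1] p[of j] in auto)
    then show ?thesis using True by simp
  next
    case False
    have "int (p i) = int (Suc j) + int (Suc l) - int i"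
    proof (rule interval_rev[where q = "\<lambda>k. int (p k)"])
      show "int (p (Suc k)) < int (p k)" if "k \<in> {Suc j..<Suc l}" for k
        using dec[of k] that j by auto
      show "int (Suc j) \<le> int (p (Suc l))" using low[of "Suc l"] j by simp
    qed (use False i j p[of "Suc j"] in auto)
    then show ?thesis using False i by simp
  qed
  then show ?thesis using p[OF i] by simp
qed

abbreviation cyc :: "nat \<Rightarrow> 'a" where
  "cyc k \<equiv> e (Suc (k mod Suc l))"

lemma omega_cyc:
  assumes j: "1 \<le> j" "j \<le> l"
  shows "omega_elt l \<alpha> j (cyc k) = cyc (k + j)"
proof -
  define m where "m = k mod Suc l"
  have m: "m \<le> l" unfolding m_def by (metis less_Suc_eq_le mod_less_divisor zero_less_Suc)
  have km: "(k + j) mod Suc l = (m + j) mod Suc l" unfolding m_def by (simp add: mod_add_left_eq)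
  have "omega_elt l \<alpha> j (e (Suc m)) = w_elt l \<alpha> j (e (Suc (l - m)))"
    using w_elt_A[of 0 "Suc m"] m by (simp add: omega_elt_def Suc_diff_le)
  also have "\<dots> = e (if Suc (l - m) \<le> j then j - (l - m) else j + m + 1)"
    using w_elt_A[OF j(2), of "Suc (l - m)"] m by (auto simp: One_nat_def)
  also have "(if Suc (l - m) \<le> j then j - (l - m) else j + m + 1) = Suc ((m + j) mod Suc l)"
  proof (cases "Suc (l - m) \<le> j")
    case True
    then have "(m + j) mod Suc l = m + j - Suc l" using m j by (subst mod_if) auto
    then show ?thesis using True m by auto
  next
    case False
    then show ?thesis using m by auto
  qed
  finally show ?thesis unfolding km m_def .
qed

lemma roots_A: "\<Phi> = differences e (Suc l)"
  using roots_eq_orb orb_A[OF e, of \<alpha>] simple by auto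

lemma Phi_re_A:
  assumes j: "1 \<le> j" "j \<le> l"
  obtains f c' where "simplex_family f (gcd (Suc l) j) c' d"
    "Phi_re (omega_elt l \<alpha> j) \<Phi> = differences f (gcd (Suc l) j)"
proof -
  let ?\<omega> = "omega_elt l \<alpha> j"
  interpret omega: finite_order_map ?\<omega> by (rule finite_order_omega)
  define g where "g = gcd (Suc l) j"
  obtain h where h: "Suc l = g * h" unfolding g_def by (meson dvdE gcd_dvd1)
  obtain s where s: "j = g * s" unfolding g_def by (meson dvdE gcd_dvd2)
  have g0: "0 < g" "0 < h" using h by (auto intro: Nat.gr0I)
  define F where "F k = average ?\<omega> (cyc k)" for k
  have F_j: "F (k + j * n) = F k" for k n
  proof (induction n)
    case (Suc n)
    have "F (k + j * Suc n) = average ?\<omega> (?\<omega> (cyc (k + j * n)))"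
      using omega_cyc[OF j, of "k + j * n"] by (simp add: F_def algebra_simps)
    then show ?case using Suc by (simp add: omega.average_map F_def)
  qed simp
  have F_N: "F (k + Suc l * n) = F k" for k n unfolding F_def by (simp only: mod_mult_self2)
  obtain x y where "j * x = Suc l * y + g"
    using bezout_nat[of j "Suc l"] j by (auto simp: g_def gcd.commute)
  then have F_g1: "F (k + g) = F k" for k
    using F_j[of k x] F_N[of "k + g" y] by (simp add: algebra_simps)
  have F_g: "F (k + g * n) = F k" for k n
  proof (induction n)
    case (Suc n)
    then show ?case using F_g1[of "k + g * n"] by (simp add: algebra_simps)
  qed simp
  have F_mod: "F k = F (k mod g)" for k
    using F_g[of "k mod g" "k div g"] by simp
  define G where "G u = (1 / real h) *\<^sub>R (\<Sum>t<h. cyc (u + g * t))" for u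
  have "?\<omega> (G u) = G u" for u
  proof -
    have "(\<Sum>t<h. ?\<omega> (cyc (u + g * t))) = (\<Sum>t<h. cyc (u + g * (t + s)))"
      using omega_cyc[OF j] s by (intro sum.cong) (simp_all add: algebra_simps)
    also have "\<dots> = (\<Sum>t<h. cyc (u + g * t))"
    proof (rule sum_periodic_shift)
      fix t show "cyc (u + g * (t + h)) = cyc (u + g * t)"
        by (simp add: h distrib_left add.assoc[symmetric])
    qed
    finally show ?thesis by (simp add: G_def linear_cmul[OF omega.lin] linear_sum[OF omega.lin])
  qed
  then have "average ?\<omega> (G u) = G u" for u by (rule omega.average_fixed)
  moreover have "average ?\<omega> (G u) = F u" for u
  proof -
    have "average ?\<omega> (G u) = (1 / real h) *\<^sub>R (\<Sum>t<h. F (u + g * t))"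
      by (simp add: G_def omega.average_scaleR linear_sum[OF omega.linear_average] F_def)
    then show ?thesis using g0 by (simp add: F_g sum_constant_scaleR)
  qed
  ultimately have FG: "F u = G u" for u by metis
  have GG: "G u \<bullet> G v = d + (if u = v then c / real h else 0)" if uv: "u < g" "v < g" for u v
  proof -
    have lt: "u + g * t < Suc l" if "t < h" "u < g" for t u
    proof -
      have "u + g * t < g * Suc t" using that by simp
      also have "\<dots> \<le> g * h" using that by (intro mult_le_mono2) simp
      finally show ?thesis using h by simp
    qed
    have eq: "u + g * t = v + g * t' \<longleftrightarrow> u = v \<and> t = t'" for t t'
    proof
      assume *: "u + g * t = v + g * t'"
      have "u = (u + g * t) mod g" "v = (v + g * t') mod g" using uv by auto
      with * have "u = v" by metis
      with * g0 show "u = v \<and> t = t'" by simp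
    qed simp
    have "(\<Sum>t<h. cyc (u + g * t)) \<bullet> (\<Sum>t<h. cyc (v + g * t)) =
        (\<Sum>t<h. \<Sum>t'<h. d + (if t' = t then (if u = v then c else 0) else 0))"
      unfolding inner_sum_left inner_sum_right
    proof (intro sum.cong refl)
      fix t t' assume t: "t \<in> {..<h}" "t' \<in> {..<h}"
      then have "cyc (u + g * t') = e (Suc (u + g * t'))" "cyc (v + g * t) = e (Suc (v + g * t))"
        using lt uv by simp_all
      then show "cyc (u + g * t') \<bullet> cyc (v + g * t) = d + (if t' = t then (if u = v then c else 0) else 0)"
        using t lt uv by (simp add: e_inner Suc_le_eq less_Suc_eq_le[symmetric] eq)
    qed
    also have "\<dots> = real h * (real h * d + (if u = v then c else 0))"
      by (simp add: sum.distrib sum.delta)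
    finally show ?thesis using g0 by (simp add: G_def field_simps)
  qed
  define f where "f i = F (i - 1)" for i
  have f: "simplex_family f g (c / real h) d"
    unfolding simplex_family_def
  proof (intro conjI ballI)
    fix i k assume ik: "i \<in> {1..g}" "k \<in> {1..g}"
    then have "i - 1 < g" "k - 1 < g" "i - 1 = k - 1 \<longleftrightarrow> i = k" by auto
    then show "f i \<bullet> f k = d + (if i = k then c / real h else 0)" by (simp add: f_def FG GG)
  qed (simp add: c_pos g0)
  have avg: "average ?\<omega> (e a) = f (Suc ((a - 1) mod g))" if "a \<in> {1..Suc l}" for a
  proof -
    have "cyc (a - 1) = e a" using that by (cases a) auto
    then show ?thesis using F_mod[of "a - 1"] by (simp add: F_def f_def)
  qed
  have ran: "Suc (k mod g) \<in> {1..g}" for k using g0 by (simp add: Suc_le_eq)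
  have "Phi_re ?\<omega> \<Phi> = differences f g"
  proof
    show "Phi_re ?\<omega> \<Phi> \<subseteq> differences f g"
    proof
      fix x assume "x \<in> Phi_re ?\<omega> \<Phi>"
      then obtain a b where ab: "x = average ?\<omega> (e a - e b)" "x \<noteq> 0" "a \<in> {1..Suc l}" "b \<in> {1..Suc l}"
        unfolding Phi_re_def roots_A differences_def by blast
      then have x: "x = f (Suc ((a - 1) mod g)) - f (Suc ((b - 1) mod g))"
        by (simp add: linear_diff[OF omega.linear_average] avg)
      then have "Suc ((a - 1) mod g) \<noteq> Suc ((b - 1) mod g)" using ab(2) by auto
      with x ran show "x \<in> differences f g" unfolding differences_def by blast
    qed
    show "differences f g \<subseteq> Phi_re ?\<omega> \<Phi>"
    proof
      fix x assume "x \<in> differences f g"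
      then obtain a b where ab: "x = f a - f b" "a \<in> {1..g}" "b \<in> {1..g}" "a \<noteq> b"
        unfolding differences_def by blast
      have "g \<le> Suc l" unfolding g_def by (rule gcd_le1_nat) simp
      then have in_l: "a \<in> {1..Suc l}" "b \<in> {1..Suc l}" using ab by auto
      have "Suc ((a - 1) mod g) = a" "Suc ((b - 1) mod g) = b" using ab by auto
      then have "x = average ?\<omega> (e a - e b)"
        using ab in_l by (simp add: linear_diff[OF omega.linear_average] avg)
      moreover have "e a - e b \<in> \<Phi>" unfolding roots_A differences_def using in_l ab(4) by blast
      moreover have "f a \<bullet> x \<noteq> 0"
        using ab simplex_familyD[OF f] c_pos g0 by (simp add: inner_diff_right)
      then have "x \<noteq> 0" by auto
      ultimately show "x \<in> Phi_re ?\<omega> \<Phi>" unfolding Phi_re_def by blast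
    qed
  qed
  with f show ?thesis unfolding g_def by (rule that)
qed

theorem type_A_omega:
  assumes j: "1 \<le> j" "j \<le> l"
  shows "gcd (l + 1) j = 1 \<Longrightarrow> Phi_re (omega_elt l \<alpha> j) \<Phi> = {}"
    and "gcd (l + 1) j = 1 \<Longrightarrow> root_system (fixed_space (omega_elt l \<alpha> j)) (Phi_re (omega_elt l \<alpha> j) \<Phi>)"
    and "gcd (l + 1) j \<noteq> 1 \<Longrightarrow> has_type (fixed_space (omega_elt l \<alpha> j)) (Phi_re (omega_elt l \<alpha> j) \<Phi>)
      (Type_A (gcd (l + 1) j - 1))"
proof -
  interpret omega: finite_order_map "omega_elt l \<alpha> j" by (rule finite_order_omega)
  obtain f c' where f: "simplex_family f (gcd (Suc l) j) c' d"
    and Phi: "Phi_re (omega_elt l \<alpha> j) \<Phi> = differences f (gcd (Suc l) j)"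
    using Phi_re_A[OF j] by blast
  note span = omega.span_Phi_re[OF span_roots]
  show empty: "Phi_re (omega_elt l \<alpha> j) \<Phi> = {}" if "gcd (l + 1) j = 1"
  proof -
    have "gcd (Suc l) j = 1" using that by (simp only: Suc_eq_plus1)
    then show ?thesis unfolding Phi by (auto simp: differences_def)
  qed
  show "root_system (fixed_space (omega_elt l \<alpha> j)) (Phi_re (omega_elt l \<alpha> j) \<Phi>)" if "gcd (l + 1) j = 1"
    using span empty[OF that] by (simp add: root_system_def)
  show "has_type (fixed_space (omega_elt l \<alpha> j)) (Phi_re (omega_elt l \<alpha> j) \<Phi>) (Type_A (gcd (l + 1) j - 1))"
    if "gcd (l + 1) j \<noteq> 1"
  proof -
    have "Suc (gcd (l + 1) j - 1) = gcd (l + 1) j" by (rule Suc_diff_1) simp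
    then have "Suc (gcd (l + 1) j - 1) = gcd (Suc l) j" by (simp only: Suc_eq_plus1)
    then have "has_type (span (differences f (gcd (Suc l) j))) (differences f (gcd (Suc l) j)) (Type_A (gcd (l + 1) j - 1))"
      using has_type_A[of f "gcd (l + 1) j - 1" c' d] f by simp
    then show ?thesis using span Phi by simp
  qed
qed

end

section \<open>Folding in types E6 and E7\<close>

text \<open>Vectors in coordinates with respect to a basis numbered from 1; the entries of the lists are
  numbered from 0.\<close>

definition lvec :: "(nat \<Rightarrow> 'a::real_vector) \<Rightarrow> int list \<Rightarrow> 'a" where
  "lvec \<delta> cs = (\<Sum>i<length cs. of_int (cs ! i) *\<^sub>R \<delta> (Suc i))"

definition dot :: "int list \<Rightarrow> int list \<Rightarrow> int" where
  "dot xs ys = sum_list (map2 (*) xs ys)"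

definition unit_list :: "nat \<Rightarrow> nat \<Rightarrow> int list" where
  "unit_list r i = (replicate r 0)[i := 1]"

definition refl_list :: "int list list \<Rightarrow> nat \<Rightarrow> int list \<Rightarrow> int list" where
  "refl_list C i cs = cs[i := cs ! i - dot cs (C ! i)]"

primrec act :: "int list list \<Rightarrow> nat list \<Rightarrow> int list \<Rightarrow> int list" where
  "act C [] cs = cs"
| "act C (i # is) cs = refl_list C i (act C is cs)"

definition sum_lists :: "nat \<Rightarrow> int list list \<Rightarrow> int list" where
  "sum_lists n vs = foldr (map2 (+)) vs (replicate n 0)"

definition lincomb :: "nat \<Rightarrow> int list \<Rightarrow> int list list \<Rightarrow> int list" where
  "lincomb n ds D = sum_lists n (map2 (\<lambda>d v. map ((*) d) v) ds D)"

definition mat_app :: "int list list \<Rightarrow> int list \<Rightarrow> int list" where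
  "mat_app M cs = map (dot cs) M"

definition square :: "int list list \<Rightarrow> bool" where
  "square C \<longleftrightarrow> list_all (\<lambda>c. length c = length C) C"

definition cartan_columns :: "(nat \<Rightarrow> 'a::euclidean_space) \<Rightarrow> int list list \<Rightarrow> bool" where
  "cartan_columns \<delta> C \<longleftrightarrow> square C \<and>
     (\<forall>i<length C. \<forall>k<length C. cartan_number (\<delta> (Suc k)) (\<delta> (Suc i)) = of_int (C ! i ! k))"

definition columns_check :: "dynkin \<Rightarrow> int list list \<Rightarrow> bool" where
  "columns_check X C \<longleftrightarrow> square C \<and>
     list_all (\<lambda>i. list_all (\<lambda>k. cartan_matrix X (Suc k) (Suc i) = C ! i ! k) [0..<length C]) [0..<length C]"

text \<open>A list that passes \<open>roots_check\<close> consists of the positive roots: each entry is obtained from a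
  unit vector through earlier entries, and up to sign the list is closed under the reflections.\<close>

fun reach_check :: "int list list \<Rightarrow> int list list \<Rightarrow> int list list \<Rightarrow> bool" where
  "reach_check C acc [] = True"
| "reach_check C acc (v # vs) \<longleftrightarrow>
     list_ex (\<lambda>i. v = unit_list (length C) i \<or> List.member acc (refl_list C i v)) [0..<length C] \<and>
     reach_check C (v # acc) vs"

definition roots_check :: "int list list \<Rightarrow> int list list \<Rightarrow> bool" where
  "roots_check C L \<longleftrightarrow> reach_check C [] L \<and>
     list_all (\<lambda>v. length v = length C \<and> list_all (\<lambda>x. 0 \<le> x) v \<and>
       list_all (\<lambda>i. v = unit_list (length C) i \<or> List.member L (refl_list C i v)) [0..<length C]) L \<and>
     list_all (\<lambda>i. List.member L (unit_list (length C) i)) [0..<length C]"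

text \<open>The index is an argument of the separate constants \<open>nonpos_image\<close> and \<open>average_at\<close>, since otherwise
  symbolic evaluation would unfold the words under a binder, with an indeterminate index.\<close>

definition nonpos_image :: "int list list \<Rightarrow> nat list \<Rightarrow> nat \<Rightarrow> bool" where
  "nonpos_image C is i \<longleftrightarrow> list_all (\<lambda>x. x \<le> 0) (act C is (unit_list (length C) i))"

definition longest_check :: "int list list \<Rightarrow> nat list \<Rightarrow> nat list \<Rightarrow> bool" where
  "longest_check C S is \<longleftrightarrow> list_all (List.member S) is \<and> list_all (nonpos_image C is) S"

primrec orbit_lists :: "int list list \<Rightarrow> nat list \<Rightarrow> nat \<Rightarrow> int list \<Rightarrow> int list list" where
  "orbit_lists C is 0 cs = []"
| "orbit_lists C is (Suc k) cs = cs # orbit_lists C is k (act C is cs)"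

definition average_at :: "int list list \<Rightarrow> nat \<Rightarrow> nat list \<Rightarrow> int list list \<Rightarrow> int list list \<Rightarrow> nat \<Rightarrow> bool" where
  "average_at C k is M D i \<longleftrightarrow>
     last (orbit_lists C is (Suc k) (unit_list (length C) i)) = unit_list (length C) i \<and>
     sum_lists (length C) (orbit_lists C is k (unit_list (length C) i)) =
       lincomb (length C) (map (\<lambda>R. R ! i) M) D"

definition average_check :: "int list list \<Rightarrow> nat \<Rightarrow> nat list \<Rightarrow> int list list \<Rightarrow> int list list \<Rightarrow> bool" where
  "average_check C k is M D \<longleftrightarrow> list_all (average_at C k is M D) [0..<length C]"

definition image_check :: "int list list \<Rightarrow> int list list \<Rightarrow> bool" where
  "image_check L L' \<longleftrightarrow>
     list_all (\<lambda>u. List.member L' u \<or> List.member L' (map uminus u) \<or> list_all ((=) 0) u) L \<and>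
     list_all (\<lambda>u. List.member L u \<or> List.member L (map uminus u)) L'"

lemma member_iff: "List.member L x \<longleftrightarrow> x \<in> set L"
  by (rule List.member_iff)

lemma dot_eq_sum: "length xs = n \<Longrightarrow> length ys = n \<Longrightarrow> dot xs ys = (\<Sum>k<n. xs ! k * ys ! k)"
  by (simp add: dot_def sum_list_sum_nth atLeast0LessThan)

lemma length_unit_list [simp]: "length (unit_list r i) = r"
  by (simp add: unit_list_def)

lemma length_refl_list [simp]: "length (refl_list C i cs) = length cs"
  by (simp add: refl_list_def)

lemma length_act [simp]: "length (act C is cs) = length cs"
  by (induction "is") simp_all

lemma length_act_funpow [simp]: "length ((act C is ^^ t) cs) = length cs"
  by (induction t) simp_all

lemma orbit_lists_eq: "orbit_lists C is k cs = map (\<lambda>t. (act C is ^^ t) cs) [0..<k]"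
proof (induction k arbitrary: cs)
  case (Suc k)
  have "map (\<lambda>t. (act C is ^^ t) cs) [0..<Suc k] = cs # map (\<lambda>t. (act C is ^^ Suc t) cs) [0..<k]"
    by (simp only: upt_conv_Cons[of 0] zero_less_Suc list.map funpow_0 map_Suc_upt[symmetric] map_map comp_def)
  then show ?case using Suc by (simp add: funpow_swap1)
qed simp

lemma last_orbit_lists: "last (orbit_lists C is (Suc k) cs) = (act C is ^^ k) cs"
  unfolding orbit_lists_eq by simp

lemma vec_unit: "i < r \<Longrightarrow> lvec \<delta> (unit_list r i) = \<delta> (Suc i)"
proof -
  assume i: "i < r"
  have "lvec \<delta> (unit_list r i) = (\<Sum>k<r. if k = i then \<delta> (Suc i) else 0)"
    unfolding lvec_def by (intro sum.cong) (auto simp: unit_list_def nth_list_update)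
  then show ?thesis using i by simp
qed

lemma vec_eq_sum: "length cs = n \<Longrightarrow> lvec \<delta> cs = (\<Sum>i<n. of_int (cs ! i) *\<^sub>R \<delta> (Suc i))"
  by (simp add: lvec_def)

lemma vec_minus: "lvec \<delta> (map uminus cs) = - lvec \<delta> cs"
  by (simp add: lvec_def sum_negf)

lemma vec_replicate_0: "lvec \<delta> (replicate n 0) = 0"
  by (simp add: lvec_def)

lemma vec_add: "length xs = length ys \<Longrightarrow> lvec \<delta> (map2 (+) xs ys) = lvec \<delta> xs + lvec \<delta> ys"
  by (simp add: lvec_def scaleR_add_left sum.distrib)

lemma vec_scale: "lvec \<delta> (map ((*) d) xs) = of_int d *\<^sub>R lvec \<delta> xs"
  by (simp add: lvec_def scaleR_sum_right)

lemma vec_sum_lists: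
  assumes "\<And>v. v \<in> set vs \<Longrightarrow> length v = n"
  shows "length (sum_lists n vs) = n" and "lvec \<delta> (sum_lists n vs) = sum_list (map (lvec \<delta>) vs)"
proof -
  have "length (sum_lists n vs) = n \<and> lvec \<delta> (sum_lists n vs) = sum_list (map (lvec \<delta>) vs)"
    using assms by (induction vs) (auto simp: sum_lists_def vec_replicate_0 vec_add)
  then show "length (sum_lists n vs) = n" "lvec \<delta> (sum_lists n vs) = sum_list (map (lvec \<delta>) vs)" by auto
qed

lemma vec_lincomb:
  assumes "\<And>v. v \<in> set D \<Longrightarrow> length v = n" and "length ds = r" "length D = r"
  shows "lvec \<alpha> (lincomb n ds D) = (\<Sum>m<r. of_int (ds ! m) *\<^sub>R lvec \<alpha> (D ! m))"
proof -
  have "lvec \<alpha> (lincomb n ds D) = sum_list (map (lvec \<alpha>) (map2 (\<lambda>d v. map ((*) d) v) ds D))"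
    unfolding lincomb_def by (rule vec_sum_lists) (use assms(1) in \<open>auto dest: set_zip_rightD\<close>)
  then show ?thesis
    using assms(2,3) by (simp add: sum_list_sum_nth atLeast0LessThan vec_scale)
qed

lemma reflection_vec:
  assumes C: "cartan_columns \<delta> C" and "length cs = length C" "i < length C"
  shows "reflection (\<delta> (Suc i)) (lvec \<delta> cs) = lvec \<delta> (refl_list C i cs)"
proof -
  let ?r = "length C"
  have len: "length (C ! i) = ?r" using C assms(3) by (simp add: cartan_columns_def square_def list_all_length)
  have "cartan_number (lvec \<delta> cs) (\<delta> (Suc i)) = of_int (dot cs (C ! i))"
    using C assms(2,3) len
    by (simp add: lvec_def cartan_number_sum cartan_number_scaleR dot_eq_sum[of _ ?r] cartan_columns_def)
  moreover have "lvec \<delta> (refl_list C i cs) =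
      (\<Sum>k<?r. of_int (cs ! k) *\<^sub>R \<delta> (Suc k) - (if k = i then of_int (dot cs (C ! i)) *\<^sub>R \<delta> (Suc i) else 0))"
    unfolding lvec_def using assms(2,3)
    by (intro sum.cong) (auto simp: refl_list_def nth_list_update scaleR_diff_left)
  ultimately show ?thesis
    using assms(2,3) by (simp add: reflection_eq_cartan lvec_def sum_subtractf)
qed

lemma refl_word_vec:
  assumes C: "cartan_columns \<delta> C" and "length cs = length C" "set is \<subseteq> {..<length C}"
  shows "refl_word \<delta> (map Suc is) (lvec \<delta> cs) = lvec \<delta> (act C is cs)"
  using assms(3)
proof (induction "is")
  case Nil
  show ?case by simp
next
  case (Cons i "is")
  then have "refl_word \<delta> (map Suc (i # is)) (lvec \<delta> cs) = reflection (\<delta> (Suc i)) (lvec \<delta> (act C is cs))"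
    by (simp add: refl_word_Cons)
  also have "\<dots> = lvec \<delta> (refl_list C i (act C is cs))"
    by (rule reflection_vec[OF C]) (use Cons assms in auto)
  finally show ?case by simp
qed

lemma reach_check_orb:
  assumes C: "cartan_columns \<delta> C"
  shows "reach_check C acc vs \<Longrightarrow> (\<And>v. v \<in> set acc \<Longrightarrow> lvec \<delta> v \<in> orb \<delta> (length C)) \<Longrightarrow>
    (\<And>v. v \<in> set vs \<Longrightarrow> length v = length C) \<Longrightarrow> v \<in> set vs \<Longrightarrow> lvec \<delta> v \<in> orb \<delta> (length C)"
proof (induction vs arbitrary: acc v)
  case (Cons u us)
  obtain i where i: "i < length C" "u = unit_list (length C) i \<or> refl_list C i u \<in> set acc"
    using Cons.prems(1) by (auto simp: list_ex_iff member_iff)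
  have u: "lvec \<delta> u \<in> orb \<delta> (length C)"
  proof (cases "u = unit_list (length C) i")
    case True
    then show ?thesis using vec_unit[OF i(1), of \<delta>] orb_simple[of "Suc i" "length C" \<delta>] i(1) by simp
  next
    case False
    then have "lvec \<delta> (refl_list C i u) \<in> orb \<delta> (length C)" using i Cons.prems(2) by blast
    then have "reflection (\<delta> (Suc i)) (lvec \<delta> u) \<in> orb \<delta> (length C)"
      using reflection_vec[OF C _ i(1), of u] Cons.prems(3) by simp
    then have "reflection (\<delta> (Suc i)) (reflection (\<delta> (Suc i)) (lvec \<delta> u)) \<in> orb \<delta> (length C)"
      by (rule orb_reflection) (use i in auto)
    then show ?thesis by simp
  qed
  show ?case
  proof (cases "v = u")
    case False
    show ?thesis
      by (rule Cons.IH[of "u # acc" v]) (use Cons.prems u False in auto)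
  qed (use u in simp)
qed simp

lemma orb_eq_lists:
  assumes C: "cartan_columns \<delta> C" and L: "roots_check C L"
  shows "orb \<delta> (length C) = lvec \<delta> ` set L \<union> uminus ` lvec \<delta> ` set L"
proof
  let ?R = "lvec \<delta> ` set L \<union> uminus ` lvec \<delta> ` set L"
  have len: "length v = length C" if "v \<in> set L" for v
    using L that by (auto simp: roots_check_def list_all_iff)
  show "orb \<delta> (length C) \<subseteq> ?R"
  proof
    fix x assume "x \<in> orb \<delta> (length C)"
    then show "x \<in> ?R"
    proof induction
      case (orb_simple i)
      then obtain k where k: "i = Suc k" "k < length C" by (cases i) auto
      then have "unit_list (length C) k \<in> set L" using L by (auto simp: roots_check_def list_all_iff member_iff)
      then show ?case using vec_unit[OF k(2), of \<delta>] k by (metis UnI1 imageI)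
    next
      case (orb_reflection x i)
      then obtain k where k: "i = Suc k" "k < length C" by (cases i) auto
      have *: "reflection (\<delta> i) (lvec \<delta> v) \<in> ?R \<and> - reflection (\<delta> i) (lvec \<delta> v) \<in> ?R" if v: "v \<in> set L" for v
      proof (cases "v = unit_list (length C) k")
        case True
        then have "lvec \<delta> v = \<delta> i" using vec_unit[OF k(2), of \<delta>] k by simp
        then show ?thesis using v by (metis UnCI imageI minus_minus reflection_self)
      next
        case False
        moreover have "v = unit_list (length C) k \<or> refl_list C k v \<in> set L"
          using L v k(2) unfolding roots_check_def list_all_iff member_iff by simp
        ultimately have "refl_list C k v \<in> set L" by blast
        then show ?thesis using reflection_vec[OF C len[OF v] k(2)] k by (metis UnCI imageI)
      qed
      from orb_reflection(3) obtain v where v: "v \<in> set L" "x = lvec \<delta> v \<or> x = - lvec \<delta> v" by blast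
      from v(2) show ?case
      proof
        assume "x = - lvec \<delta> v"
        then show ?thesis using *[OF v(1)] by (simp only: reflection_minus)
      qed (use *[OF v(1)] in blast)
    qed
  qed
  have "lvec \<delta> v \<in> orb \<delta> (length C)" if "v \<in> set L" for v
    by (rule reach_check_orb[OF C, of "[]" L]) (use L len that in \<open>auto simp: roots_check_def\<close>)
  then show "?R \<subseteq> orb \<delta> (length C)" using orb_minus by blast
qed

lemma columns_check:
  assumes "columns_check X C"
    and "\<And>i j. i \<in> {1..length C} \<Longrightarrow> j \<in> {1..length C} \<Longrightarrow> cartan_number (\<delta> i) (\<delta> j) = of_int (cartan_matrix X i j)"
  shows "cartan_columns \<delta> C"
  using assms by (auto simp: columns_check_def cartan_columns_def list_all_iff)

lemma vec_nonneg_comb: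
  assumes "length v = r" "list_all (\<lambda>x. 0 \<le> x) v"
  shows "lvec \<delta> v = (\<Sum>i=1..r. real (nat (v ! (i - 1))) *\<^sub>R \<delta> i)"
proof -
  have "(\<Sum>i=1..r. real (nat (v ! (i - 1))) *\<^sub>R \<delta> i) = (\<Sum>i<r. real (nat (v ! i)) *\<^sub>R \<delta> (Suc i))"
    by (rule sum.reindex_bij_witness[of _ Suc "\<lambda>i. i - 1"]) auto
  also have "\<dots> = lvec \<delta> v"
    unfolding lvec_def using assms by (intro sum.cong) (auto simp: list_all_length)
  finally show ?thesis ..
qed

lemma has_type_lists:
  assumes X: "columns_check X C" "length C = dynkin_rank X"
    and cartan: "\<And>i j. i \<in> {1..length C} \<Longrightarrow> j \<in> {1..length C} \<Longrightarrow>
      cartan_number (\<delta> i) (\<delta> j) = of_int (cartan_matrix X i j)"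
    and indep: "independent (\<delta> ` {1..length C})" "inj_on \<delta> {1..length C}"
    and L: "roots_check C L"
  shows "has_type (span (orb \<delta> (length C))) (orb \<delta> (length C)) X"
proof (rule has_typeI[OF refl _ X(2) cartan indep])
  have "cartan_columns \<delta> C" by (rule columns_check[OF X(1)]) (rule cartan)
  note eq = orb_eq_lists[OF this L]
  show "finite (orb \<delta> (length C))" unfolding eq by simp
  fix x assume "x \<in> orb \<delta> (length C)"
  then obtain v where v: "v \<in> set L" "x = lvec \<delta> v \<or> x = - lvec \<delta> v" unfolding eq by auto
  have "lvec \<delta> v = (\<Sum>i=1..length C. real (nat (v ! (i - 1))) *\<^sub>R \<delta> i)"
    by (rule vec_nonneg_comb) (use L v in \<open>auto simp: roots_check_def list_all_iff\<close>)
  with v(2) show "\<exists>c :: nat \<Rightarrow> nat. x = (\<Sum>i=1..length C. real (c i) *\<^sub>R \<delta> i) \<or>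
      x = - (\<Sum>i=1..length C. real (c i) *\<^sub>R \<delta> i)" by metis
qed auto

context rbase
begin

lemma longest_element_word:
  assumes C: "cartan_columns \<alpha> C" "length C = l" and "longest_check C S is" and S: "set S \<subseteq> {..<l}"
  shows "longest_element \<alpha> (Suc ` set S) = refl_word \<alpha> (map Suc is)"
proof (rule longest_element_eq)
  have is_S: "set is \<subseteq> set S" using assms(3) by (auto simp: longest_check_def list_all_iff member_iff)
  show S': "Suc ` set S \<subseteq> {1..l}" using S by auto
  show w: "refl_word \<alpha> (map Suc is) \<in> refl_group \<alpha> (Suc ` set S)"
    using is_S unfolding refl_group_iff by (intro exI[of _ "map Suc is"]) auto
  fix i assume "i \<in> Suc ` set S"
  then obtain k where k: "i = Suc k" "k \<in> set S" by blast
  then have kl: "k < l" using S by auto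
  let ?v = "act C is (unit_list l k)"
  have eq: "refl_word \<alpha> (map Suc is) (\<alpha> i) = lvec \<alpha> ?v"
    using refl_word_vec[OF C(1), of "unit_list l k" "is"] vec_unit[OF kl, of \<alpha>] is_S S C(2) k by auto
  have "list_all (\<lambda>x. x \<le> 0) ?v"
    using assms(3) k C(2) by (auto simp: longest_check_def nonpos_image_def list_all_iff)
  then have "list_all (\<lambda>x. 0 \<le> x) (map uminus ?v)" by (simp add: list_all_iff)
  then have "- lvec \<alpha> ?v = (\<Sum>i=1..l. real (nat (map uminus ?v ! (i - 1))) *\<^sub>R \<alpha> i)"
    using vec_nonneg_comb[of "map uminus ?v" l \<alpha>] by (simp add: vec_minus)
  moreover have "refl_word \<alpha> (map Suc is) (\<alpha> i) \<in> \<Phi>"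
    using refl_group_root[OF S' w simple_root[of i]] k kl by simp
  then have "- lvec \<alpha> ?v \<in> \<Phi>" unfolding eq by (rule root_minus)
  ultimately show "- refl_word \<alpha> (map Suc is) (\<alpha> i) \<in> pos"
    unfolding eq pos_def by (intro CollectI conjI exI[of _ "\<lambda>i. nat (map uminus ?v ! (i - 1))"])
qed

lemma omega_word:
  assumes C: "cartan_columns \<alpha> C" "length C = l"
    and 0: "longest_check C S0 is0" "Suc ` set S0 = {1..l}"
    and j: "longest_check C Sj isj" "Suc ` set Sj = {1..l} - {j}"
  shows "set (isj @ is0) \<subseteq> {..<l}" and "omega_elt l \<alpha> j = refl_word \<alpha> (map Suc (isj @ is0))"
proof -
  have "k < l" if "Suc k \<in> {1..l}" for k using that by simp
  then have S: "set S0 \<subseteq> {..<l}" "set Sj \<subseteq> {..<l}" using 0(2) j(2) by blast+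
  moreover have "set is0 \<subseteq> set S0" "set isj \<subseteq> set Sj"
    using 0(1) j(1) by (auto simp: longest_check_def list_all_iff member_iff)
  ultimately show "set (isj @ is0) \<subseteq> {..<l}" by auto
  have "{1..l} - {0} = {1..l}" by auto
  then show "omega_elt l \<alpha> j = refl_word \<alpha> (map Suc (isj @ is0))"
    using longest_element_word[OF C 0(1) S(1)] longest_element_word[OF C j(1) S(2)] 0(2) j(2)
    by (simp add: omega_elt_def w_elt_def refl_word_append)
qed

text \<open>The folded basis vectors \<open>\<delta> (m + 1)\<close> are given by the rows of \<open>D\<close>, divided by the order \<open>k\<close>, and the
  rows of \<open>M\<close> express the averages of the simple roots by them.\<close>

theorem has_type_folded:
  assumes C: "cartan_columns \<alpha> C" "length C = l" and L: "roots_check C L"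
    and \<omega>: "\<omega> = refl_word \<alpha> (map Suc is)" "set is \<subseteq> {..<l}"
    and avg: "average_check C k is M D" "0 < k"
    and MD: "length M = r" "length D = r" "list_all (\<lambda>R. length R = l) M" "list_all (\<lambda>R. length R = l) D"
    and \<delta>: "\<And>m. m < r \<Longrightarrow> real k *\<^sub>R \<delta> (Suc m) = lvec \<alpha> (D ! m)"
    and X: "columns_check X C'" "length C' = r" "dynkin_rank X = r" "roots_check C' L'"
    and cartan: "\<And>i j. i \<in> {1..r} \<Longrightarrow> j \<in> {1..r} \<Longrightarrow> cartan_number (\<delta> i) (\<delta> j) = of_int (cartan_matrix X i j)"
    and indep: "independent (\<delta> ` {1..r})" "inj_on \<delta> {1..r}"
    and image: "image_check (map (mat_app M) L) L'"
  shows "has_type (fixed_space \<omega>) (Phi_re \<omega> \<Phi>) X"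
proof -
  have "\<omega> \<in> refl_group \<alpha> {1..l}"
    unfolding \<omega>(1) refl_group_iff using \<omega>(2) by (intro exI[of _ "map Suc is"]) auto
  then interpret omega: finite_order_map \<omega> by (rule refl_group_finite_order)
  have pow: "(\<omega> ^^ t) (lvec \<alpha> cs) = lvec \<alpha> ((act C is ^^ t) cs)" if "length cs = l" for t cs
  proof (induction t)
    case (Suc t)
    then show ?case using refl_word_vec[OF C(1)] \<omega> that C(2) by simp
  qed simp
  have avg_simple: "average \<omega> (\<alpha> (Suc i)) = (\<Sum>m<r. of_int (M ! m ! i) *\<^sub>R \<delta> (Suc m))" if i: "i < l" for i
  proof -
    let ?u = "unit_list l i"
    have u: "(act C is ^^ k) ?u = ?u"
      "sum_lists l (map (\<lambda>t. (act C is ^^ t) ?u) [0..<k]) = lincomb l (map (\<lambda>R. R ! i) M) D"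
    proof -
      have "average_at C k is M D i" using avg(1) i C(2) by (simp add: average_check_def list_all_iff)
      then show "(act C is ^^ k) ?u = ?u"
        "sum_lists l (map (\<lambda>t. (act C is ^^ t) ?u) [0..<k]) = lincomb l (map (\<lambda>R. R ! i) M) D"
        unfolding average_at_def last_orbit_lists C(2) by (simp_all only: orbit_lists_eq)
    qed
    have "(\<omega> ^^ k) (lvec \<alpha> ?u) = lvec \<alpha> ?u" by (simp add: pow u(1))
    then have "average \<omega> (lvec \<alpha> ?u) = (1 / real k) *\<^sub>R (\<Sum>t<k. lvec \<alpha> ((act C is ^^ t) ?u))"
      using omega.average_eq[OF _ avg(2)] by (simp add: pow)
    also have "(\<Sum>t<k. lvec \<alpha> ((act C is ^^ t) ?u)) = lvec \<alpha> (sum_lists l (map (\<lambda>t. (act C is ^^ t) ?u) [0..<k]))"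
      by (subst vec_sum_lists) (auto simp: sum_list_sum_nth atLeast0LessThan)
    also have "\<dots> = (\<Sum>m<r. of_int (M ! m ! i) *\<^sub>R lvec \<alpha> (D ! m))"
      unfolding u(2) using MD by (subst vec_lincomb[where r = r]) (auto simp: list_all_iff)
    also have "\<dots> = real k *\<^sub>R (\<Sum>m<r. of_int (M ! m ! i) *\<^sub>R \<delta> (Suc m))"
      by (simp add: \<delta>[symmetric] scaleR_sum_right mult.commute)
    finally show ?thesis using avg(2) i by (simp add: vec_unit)
  qed
  have avg_vec: "average \<omega> (lvec \<alpha> v) = lvec \<delta> (mat_app M v)" if v: "length v = l" for v
  proof -
    have "average \<omega> (lvec \<alpha> v) = (\<Sum>i<l. of_int (v ! i) *\<^sub>R (\<Sum>m<r. of_int (M ! m ! i) *\<^sub>R \<delta> (Suc m)))"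
      by (simp add: vec_eq_sum[OF v] linear_sum[OF omega.linear_average] omega.average_scaleR avg_simple)
    also have "\<dots> = (\<Sum>m<r. (\<Sum>i<l. of_int (v ! i * M ! m ! i)) *\<^sub>R \<delta> (Suc m))"
      by (simp add: scaleR_sum_right scaleR_sum_left) (rule sum.swap)
    also have "\<dots> = (\<Sum>m<r. of_int (dot v (M ! m)) *\<^sub>R \<delta> (Suc m))"
      using MD v by (intro sum.cong) (auto simp: dot_eq_sum[of _ l] list_all_length)
    also have "\<dots> = lvec \<delta> (mat_app M v)" using MD by (simp add: lvec_def mat_app_def)
    finally show ?thesis .
  qed
  have type: "has_type (span (orb \<delta> r)) (orb \<delta> r) X"
    using has_type_lists[OF X(1) _ _ _ _ X(4), of \<delta>] X(2,3) cartan indep by simp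
  have orb': "orb \<delta> r = lvec \<delta> ` set L' \<union> uminus ` lvec \<delta> ` set L'"
    using orb_eq_lists[OF columns_check[OF X(1)] X(4), of \<delta>] cartan X(2) by simp
  have \<Phi>: "\<Phi> = lvec \<alpha> ` set L \<union> uminus ` lvec \<alpha> ` set L"
    using roots_eq_orb orb_eq_lists[OF C(1) L] C(2) by simp
  have len: "length v = l" if "v \<in> set L" for v
    using L that C(2) by (auto simp: roots_check_def list_all_iff)
  have zero: "0 \<notin> orb \<delta> r" using type by (simp add: has_type_def root_system_def)
  have sub: "lvec \<delta> (mat_app M v) \<in> orb \<delta> r \<or> lvec \<delta> (mat_app M v) = 0" if v: "v \<in> set L" for v
  proof -
    let ?u = "mat_app M v"
    consider "?u \<in> set L'" | "map uminus ?u \<in> set L'" | "list_all ((=) 0) ?u"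
      using image v unfolding image_check_def list_all_iff member_iff by auto
    then show ?thesis
    proof cases
      case 1
      then show ?thesis unfolding orb' by blast
    next
      case 2
      then have "- lvec \<delta> (map uminus ?u) \<in> orb \<delta> r" unfolding orb' by blast
      then show ?thesis by (simp add: vec_minus)
    next
      case 3
      then show ?thesis by (auto simp: lvec_def list_all_length intro!: sum.neutral)
    qed
  qed
  have sup: "\<exists>v\<in>set L. lvec \<delta> u = lvec \<delta> (mat_app M v) \<or> lvec \<delta> u = - lvec \<delta> (mat_app M v)"
    if u: "u \<in> set L'" for u
  proof -
    have "u \<in> mat_app M ` set L \<or> map uminus u \<in> mat_app M ` set L"
      using image u unfolding image_check_def list_all_iff member_iff set_map by (elim conjE) (erule (1) bspec)
    then obtain v where v: "v \<in> set L" "u = mat_app M v \<or> map uminus u = mat_app M v"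
      by blast
    then have "lvec \<delta> u = lvec \<delta> (mat_app M v) \<or> lvec \<delta> u = - lvec \<delta> (mat_app M v)"
      using vec_minus[of \<delta> u] by (metis minus_minus)
    with v(1) show ?thesis by blast
  qed
  have "Phi_re \<omega> \<Phi> = average \<omega> ` \<Phi> - {0}" by (auto simp: Phi_re_def)
  also have "average \<omega> ` \<Phi> = (\<lambda>v. lvec \<delta> (mat_app M v)) ` set L \<union> (\<lambda>v. - lvec \<delta> (mat_app M v)) ` set L"
    unfolding \<Phi> image_Un image_image
    by (intro arg_cong2[where f = "(\<union>)"] image_cong) (simp_all add: avg_vec len linear_neg[OF omega.linear_average])
  also have "\<dots> - {0} = orb \<delta> r"
  proof
    show "(\<lambda>v. lvec \<delta> (mat_app M v)) ` set L \<union> (\<lambda>v. - lvec \<delta> (mat_app M v)) ` set L - {0} \<subseteq> orb \<delta> r"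
      using sub orb_minus by fastforce
    show "orb \<delta> r \<subseteq> (\<lambda>v. lvec \<delta> (mat_app M v)) ` set L \<union> (\<lambda>v. - lvec \<delta> (mat_app M v)) ` set L - {0}"
    proof
      fix x assume x: "x \<in> orb \<delta> r"
      then obtain u where u: "u \<in> set L'" "x = lvec \<delta> u \<or> x = - lvec \<delta> u" unfolding orb' by blast
      obtain v where "v \<in> set L" "lvec \<delta> u = lvec \<delta> (mat_app M v) \<or> lvec \<delta> u = - lvec \<delta> (mat_app M v)"
        using sup[OF u(1)] by blast
      moreover have "x \<noteq> 0" using x zero by blast
      ultimately show "x \<in> (\<lambda>v. lvec \<delta> (mat_app M v)) ` set L \<union> (\<lambda>v. - lvec \<delta> (mat_app M v)) ` set L - {0}"
        using u(2) by auto
    qed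
  qed
  finally have "Phi_re \<omega> \<Phi> = orb \<delta> r" .
  then show ?thesis using type omega.span_Phi_re[OF span_roots] by simp
qed

end

definition G2_cols :: "int list list" where
  "G2_cols = [[2,-3], [-1,2]]"

definition G2_pos :: "int list list" where
  "G2_pos = [[1,0], [0,1], [1,1], [3,1], [2,1], [3,2]]"

definition F4_cols :: "int list list" where
  "F4_cols = [[2,-1,0,0], [-1,2,-1,0], [0,-2,2,-1], [0,0,-1,2]]"

definition F4_pos :: "int list list" where
  "F4_pos = [[1,0,0,0], [0,1,0,0], [0,0,1,0], [0,0,0,1], [1,1,0,0], [0,1,2,0], [0,1,1,0], [0,0,1,1],
    [1,1,2,0], [0,1,2,2], [1,1,1,0], [0,1,1,1], [1,2,2,0], [1,1,2,2], [1,1,1,1], [0,1,2,1],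
    [1,2,2,2], [1,1,2,1], [1,2,4,2], [1,2,2,1], [1,3,4,2], [1,2,3,1], [2,3,4,2], [1,2,3,2]]"

definition E6_cols :: "int list list" where
  "E6_cols = [[2,0,-1,0,0,0], [0,2,0,-1,0,0], [-1,0,2,-1,0,0], [0,-1,-1,2,-1,0], [0,0,0,-1,2,-1],
    [0,0,0,0,-1,2]]"

definition E6_pos :: "int list list" where
  "E6_pos = [[1,0,0,0,0,0], [0,1,0,0,0,0], [0,0,1,0,0,0], [0,0,0,1,0,0], [0,0,0,0,1,0], [0,0,0,0,0,1],
    [1,0,1,0,0,0], [0,1,0,1,0,0], [0,0,1,1,0,0], [0,0,0,1,1,0], [0,0,0,0,1,1], [1,0,1,1,0,0],
    [0,1,1,1,0,0], [0,1,0,1,1,0], [0,0,1,1,1,0], [0,0,0,1,1,1], [1,1,1,1,0,0], [1,0,1,1,1,0],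
    [0,1,1,1,1,0], [0,1,0,1,1,1], [0,0,1,1,1,1], [1,1,1,1,1,0], [1,0,1,1,1,1], [0,1,1,2,1,0],
    [0,1,1,1,1,1], [1,1,1,2,1,0], [1,1,1,1,1,1], [0,1,1,2,1,1], [1,1,2,2,1,0], [1,1,1,2,1,1],
    [0,1,1,2,2,1], [1,1,2,2,1,1], [1,1,1,2,2,1], [1,1,2,2,2,1], [1,1,2,3,2,1], [1,2,2,3,2,1]]"

definition E7_cols :: "int list list" where
  "E7_cols = [[2,0,-1,0,0,0,0], [0,2,0,-1,0,0,0], [-1,0,2,-1,0,0,0], [0,-1,-1,2,-1,0,0],
    [0,0,0,-1,2,-1,0], [0,0,0,0,-1,2,-1], [0,0,0,0,0,-1,2]]"

definition E7_pos :: "int list list" where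
  "E7_pos = [[1,0,0,0,0,0,0], [0,1,0,0,0,0,0], [0,0,1,0,0,0,0], [0,0,0,1,0,0,0], [0,0,0,0,1,0,0],
    [0,0,0,0,0,1,0], [0,0,0,0,0,0,1], [1,0,1,0,0,0,0], [0,1,0,1,0,0,0], [0,0,1,1,0,0,0],
    [0,0,0,1,1,0,0], [0,0,0,0,1,1,0], [0,0,0,0,0,1,1], [1,0,1,1,0,0,0], [0,1,1,1,0,0,0],
    [0,1,0,1,1,0,0], [0,0,1,1,1,0,0], [0,0,0,1,1,1,0], [0,0,0,0,1,1,1], [1,1,1,1,0,0,0],
    [1,0,1,1,1,0,0], [0,1,1,1,1,0,0], [0,1,0,1,1,1,0], [0,0,1,1,1,1,0], [0,0,0,1,1,1,1],
    [1,1,1,1,1,0,0], [1,0,1,1,1,1,0], [0,1,1,2,1,0,0], [0,1,1,1,1,1,0], [0,1,0,1,1,1,1],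
    [0,0,1,1,1,1,1], [1,1,1,2,1,0,0], [1,1,1,1,1,1,0], [1,0,1,1,1,1,1], [0,1,1,2,1,1,0],
    [0,1,1,1,1,1,1], [1,1,2,2,1,0,0], [1,1,1,2,1,1,0], [1,1,1,1,1,1,1], [0,1,1,2,2,1,0],
    [0,1,1,2,1,1,1], [1,1,2,2,1,1,0], [1,1,1,2,2,1,0], [1,1,1,2,1,1,1], [0,1,1,2,2,1,1],
    [1,1,2,2,2,1,0], [1,1,2,2,1,1,1], [1,1,1,2,2,1,1], [0,1,1,2,2,2,1], [1,1,2,3,2,1,0],
    [1,1,2,2,2,1,1], [1,1,1,2,2,2,1], [1,2,2,3,2,1,0], [1,1,2,3,2,1,1], [1,1,2,2,2,2,1],
    [1,2,2,3,2,1,1], [1,1,2,3,2,2,1], [1,2,2,3,2,2,1], [1,1,2,3,3,2,1], [1,2,2,3,3,2,1],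
    [1,2,2,4,3,2,1], [1,2,3,4,3,2,1], [2,2,3,4,3,2,1]]"

definition E6_word0 :: "nat list" where
  "E6_word0 = [0, 1, 2, 0, 3, 1, 2, 0, 3, 2, 4, 3, 1, 2, 0, 3, 2, 4, 3, 1, 5, 4, 3, 1, 2, 0, 3, 2, 4,
    3, 1, 5, 4, 3, 2, 0]"

definition E6_word1 :: "nat list" where
  "E6_word1 = [1, 2, 3, 1, 2, 3, 4, 3, 1, 2, 3, 4, 5, 4, 3, 1, 2, 3, 4, 5]"

definition E6_word6 :: "nat list" where
  "E6_word6 = [0, 1, 2, 0, 3, 1, 2, 0, 3, 2, 4, 3, 1, 2, 0, 3, 2, 4, 3, 1]"

definition E7_word0 :: "nat list" where
  "E7_word0 = [0, 1, 2, 0, 3, 1, 2, 0, 3, 2, 4, 3, 1, 2, 0, 3, 2, 4, 3, 1, 5, 4, 3, 1, 2, 0, 3, 2, 4,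
    3, 1, 5, 4, 3, 2, 0, 6, 5, 4, 3, 1, 2, 0, 3, 2, 4, 3, 1, 5, 4, 3, 2, 0, 6, 5, 4, 3, 1,
    2, 3, 4, 5, 6]"

definition E7_word7 :: "nat list" where
  "E7_word7 = [0, 1, 2, 0, 3, 1, 2, 0, 3, 2, 4, 3, 1, 2, 0, 3, 2, 4, 3, 1, 5, 4, 3, 1, 2, 0, 3, 2, 4,
    3, 1, 5, 4, 3, 2, 0]"

lemma cartan_lists:
  "columns_check Type_G2 G2_cols" "columns_check Type_F4 F4_cols"
  "columns_check (Type_E 6) E6_cols" "columns_check (Type_E 7) E7_cols"
  by code_simp+

lemma root_lists:
  "roots_check G2_cols G2_pos" "roots_check F4_cols F4_pos" "roots_check E6_cols E6_pos" "roots_check E7_cols E7_pos"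
  by code_simp+

lemma longest_lists:
  "longest_check E6_cols [0..<6] E6_word0" "longest_check E6_cols [1..<6] E6_word1"
  "longest_check E6_cols [0..<5] E6_word6" "longest_check E7_cols [0..<7] E7_word0"
  "longest_check E7_cols [0..<6] E7_word7"
  by code_simp+

text \<open>The negative entries come from the orbit of \<open>\<alpha>_0 = - \<theta>\<close>: the sum over this orbit is a negative
  combination of the simple roots outside it.\<close>

definition E6_fold :: "int list list" where
  "E6_fold = [[-2,1,1,0,1,-2], [-1,0,0,1,0,-1]]"

definition E6_basis :: "int list list" where
  "E6_basis = [[0,1,1,0,1,0], [0,0,0,3,0,0]]"

definition E7_fold :: "int list list" where
  "E7_fold = [[0,1,0,0,0,0,-1], [0,0,0,1,0,0,-2], [0,0,1,0,1,0,-3], [1,0,0,0,0,1,-2]]"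

definition E7_basis :: "int list list" where
  "E7_basis = [[0,2,0,0,0,0,0], [0,0,0,2,0,0,0], [0,0,1,0,1,0,0], [1,0,0,0,0,1,0]]"

lemma average_lists:
  "average_check E6_cols 3 (E6_word1 @ E6_word0) E6_fold E6_basis"
  "average_check E6_cols 3 (E6_word6 @ E6_word0) E6_fold E6_basis"
  "average_check E7_cols 2 (E7_word7 @ E7_word0) E7_fold E7_basis"
  by code_simp+

lemma image_lists:
  "image_check (map (mat_app E6_fold) E6_pos) G2_pos" "image_check (map (mat_app E7_fold) E7_pos) F4_pos"
  by code_simp+

lemma equal_norms:
  "cartan_number a b = -1 \<Longrightarrow> cartan_number b a = -1 \<Longrightarrow> a \<bullet> a = b \<bullet> b"
  by (auto simp: cartan_number_def inner_commute divide_eq_eq split: if_splits)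

context rbase
begin

lemma gram_E:
  assumes "5 \<le> l"
    and "\<forall>i\<in>{1..l}. \<forall>k\<in>{1..l}. cartan_number (\<alpha> i) (\<alpha> k) = of_int (cartan_matrix (Type_E l) i k)"
  shows "\<exists>c>0. \<forall>i\<in>{1..l}. \<forall>k\<in>{1..l}. \<alpha> i \<bullet> \<alpha> k = c * of_int (cartan_matrix (Type_E l) i k)"
proof -
  have cartan: "cartan_number (\<alpha> i) (\<alpha> k) = of_int (cartan_matrix (Type_E l) i k)"
    if "i \<in> {1..l}" "k \<in> {1..l}" for i k
    using assms(2) that by blast
  have chain: "k \<le> l \<Longrightarrow> \<alpha> k \<bullet> \<alpha> k = \<alpha> 3 \<bullet> \<alpha> 3" if "3 \<le> k" for k
    using that
  proof (induction k rule: dec_induct)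
    case (step k)
    have "\<alpha> k \<bullet> \<alpha> k = \<alpha> (Suc k) \<bullet> \<alpha> (Suc k)"
      by (rule equal_norms) (use step cartan[of k "Suc k"] cartan[of "Suc k" k] in \<open>auto simp: simply_laced_def\<close>)
    then show ?case using step by simp
  qed simp
  have "\<alpha> 1 \<bullet> \<alpha> 1 = \<alpha> 3 \<bullet> \<alpha> 3"
    by (rule equal_norms) (use assms(1) cartan[of 1 3] cartan[of 3 1] in \<open>auto simp: simply_laced_def\<close>)
  moreover have "\<alpha> 2 \<bullet> \<alpha> 2 = \<alpha> 4 \<bullet> \<alpha> 4"
    by (rule equal_norms) (use assms(1) cartan[of 2 4] cartan[of 4 2] in \<open>auto simp: simply_laced_def\<close>)
  ultimately have norm: "\<alpha> k \<bullet> \<alpha> k = \<alpha> 3 \<bullet> \<alpha> 3" if k: "k \<in> {1..l}" for k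
  proof -
    consider "k = 1" | "k = 2" | "3 \<le> k" using k by force
    then show ?thesis
      using \<open>\<alpha> 1 \<bullet> \<alpha> 1 = \<alpha> 3 \<bullet> \<alpha> 3\<close> \<open>\<alpha> 2 \<bullet> \<alpha> 2 = \<alpha> 4 \<bullet> \<alpha> 4\<close> chain[of 4] chain[of k] assms(1) k by cases auto
  qed
  show ?thesis
  proof (intro exI[of _ "\<alpha> 3 \<bullet> \<alpha> 3 / 2"] conjI ballI)
    show "\<alpha> 3 \<bullet> \<alpha> 3 / 2 > 0" using simple_nonzero[of 3] assms(1) by simp
    fix i k assume ik: "i \<in> {1..l}" "k \<in> {1..l}"
    show "\<alpha> i \<bullet> \<alpha> k = \<alpha> 3 \<bullet> \<alpha> 3 / 2 * of_int (cartan_matrix (Type_E l) i k)"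
      using inner_eq_cartan[OF simple_nonzero[OF ik(2)], of "\<alpha> i"] cartan[OF ik] norm[OF ik(2)]
      by (simp del: cartan_matrix.simps)
  qed
qed

theorem type_E6:
  assumes l: "l = 6" and cartan: "\<And>i k. i \<in> {1..6} \<Longrightarrow> k \<in> {1..6} \<Longrightarrow>
      cartan_number (\<alpha> i) (\<alpha> k) = of_int (cartan_matrix (Type_E 6) i k)"
    and j: "j = 1 \<or> j = 6"
  shows "has_type (fixed_space (omega_elt l \<alpha> j)) (Phi_re (omega_elt l \<alpha> j) \<Phi>) Type_G2"
proof -
  have "\<exists>c>0. \<forall>i\<in>{1..l}. \<forall>k\<in>{1..l}. \<alpha> i \<bullet> \<alpha> k = c * of_int (cartan_matrix (Type_E l) i k)"
  proof (rule gram_E)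
    show "\<forall>i\<in>{1..l}. \<forall>k\<in>{1..l}. cartan_number (\<alpha> i) (\<alpha> k) = of_int (cartan_matrix (Type_E l) i k)"
      unfolding l using cartan by blast
  qed (simp add: l)
  then obtain c where c: "c > 0" and "\<forall>i\<in>{1..6}. \<forall>k\<in>{1..6}. \<alpha> i \<bullet> \<alpha> k = c * of_int (cartan_matrix (Type_E 6) i k)"
    unfolding l by blast
  then have gram: "\<alpha> i \<bullet> \<alpha> k = c * of_int (cartan_matrix (Type_E 6) i k)" if "i \<in> {1..6}" "k \<in> {1..6}" for i k
    using that by blast
  have len: "length E6_cols = l" "length G2_cols = 2" by (simp_all add: E6_cols_def G2_cols_def l)
  have C: "cartan_columns \<alpha> E6_cols" by (rule columns_check[OF cartan_lists(3)]) (simp only: len l cartan)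
  define \<delta> where "\<delta> = (\<lambda>i::nat. if i = 1 then (1 / 3) *\<^sub>R (\<alpha> 2 + \<alpha> 3 + \<alpha> 5) else \<alpha> 4)"
  have two: "i = 1 \<or> i = 2" if "i \<in> {1..2}" for i :: nat using that by auto
  have dual: "\<delta> i \<bullet> lam (if k = 1 then 2 else 4) = 0 \<longleftrightarrow> i \<noteq> k" if "i \<in> {1..2}" "k \<in> {1..2}" for i k
  proof -
    have "m \<in> {1..l}" if "1 \<le> m" "m \<le> 6" for m using that l by simp
    note lam' = lam[OF this]
    show ?thesis
      using two[OF that(1)] two[OF that(2)] by (elim disjE) (simp_all add: \<delta>_def inner_add_left lam')
  qed
  have S: "Suc ` set [0..<6] = {1..l}" "Suc ` set [1..<6] = {1..l} - {1}" "Suc ` set [0..<5] = {1..l} - {6}"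
    by (auto simp: l image_iff Suc_le_eq gr0_conv_Suc) (presburger+)?
  obtain js where js: "set js \<subseteq> {..<l}" "omega_elt l \<alpha> j = refl_word \<alpha> (map Suc js)"
    "average_check E6_cols 3 js E6_fold E6_basis"
    using j
  proof
    assume "j = 1"
    then show thesis
      using that omega_word[OF C len(1) longest_lists(1) S(1) longest_lists(2) S(2)] average_lists(1) by blast
  next
    assume "j = 6"
    then show thesis
      using that omega_word[OF C len(1) longest_lists(1) S(1) longest_lists(3) S(3)] average_lists(2) by blast
  qed
  show ?thesis
  proof (rule has_type_folded[OF C len(1) root_lists(3) js(2,1,3) _ _ _ _ _ _ cartan_lists(1) len(2) _ root_lists(1) _
        independent_if_dual(2,1)[OF dual] image_lists(1)])
    fix m :: nat assume "m < 2"
    then have "m = 0 \<or> m = 1" by auto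
    then show "real 3 *\<^sub>R \<delta> (Suc m) = lvec \<alpha> (E6_basis ! m)"
      by (auto simp: \<delta>_def lvec_def E6_basis_def lessThan_Suc eval_nat_numeral One_nat_def algebra_simps)
  next
    fix i k :: nat assume "i \<in> {1..2}" "k \<in> {1..2}"
    moreover have "\<alpha> 4 \<noteq> 0" "\<alpha> 2 + \<alpha> 3 + \<alpha> 5 \<noteq> 0"
      using dual[of 1 1] dual[of 2 2] by (auto simp: \<delta>_def)
    ultimately show "cartan_number (\<delta> i) (\<delta> k) = of_int (cartan_matrix Type_G2 i k)"
      using two[of i] two[of k] c
      by (auto simp: \<delta>_def cartan_number_def inner_add_left inner_add_right gram simply_laced_def)
  qed (auto simp: E6_fold_def E6_basis_def l)
qed

theorem type_E7:
  assumes l: "l = 7" and cartan: "\<And>i k. i \<in> {1..7} \<Longrightarrow> k \<in> {1..7} \<Longrightarrow>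
      cartan_number (\<alpha> i) (\<alpha> k) = of_int (cartan_matrix (Type_E 7) i k)"
  shows "has_type (fixed_space (omega_elt l \<alpha> 7)) (Phi_re (omega_elt l \<alpha> 7) \<Phi>) Type_F4"
proof -
  have "\<exists>c>0. \<forall>i\<in>{1..l}. \<forall>k\<in>{1..l}. \<alpha> i \<bullet> \<alpha> k = c * of_int (cartan_matrix (Type_E l) i k)"
  proof (rule gram_E)
    show "\<forall>i\<in>{1..l}. \<forall>k\<in>{1..l}. cartan_number (\<alpha> i) (\<alpha> k) = of_int (cartan_matrix (Type_E l) i k)"
      unfolding l using cartan by blast
  qed (simp add: l)
  then obtain c where c: "c > 0" and "\<forall>i\<in>{1..7}. \<forall>k\<in>{1..7}. \<alpha> i \<bullet> \<alpha> k = c * of_int (cartan_matrix (Type_E 7) i k)"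
    unfolding l by blast
  then have gram: "\<alpha> i \<bullet> \<alpha> k = c * of_int (cartan_matrix (Type_E 7) i k)" if "i \<in> {1..7}" "k \<in> {1..7}" for i k
    using that by blast
  have len: "length E7_cols = l" "length F4_cols = 4" by (simp_all add: E7_cols_def F4_cols_def l)
  have C: "cartan_columns \<alpha> E7_cols" by (rule columns_check[OF cartan_lists(4)]) (simp only: len l cartan)
  define \<delta> where "\<delta> = (\<lambda>i::nat. if i = 1 then \<alpha> 2 else if i = 2 then \<alpha> 4
    else if i = 3 then (1 / 2) *\<^sub>R (\<alpha> 3 + \<alpha> 5) else (1 / 2) *\<^sub>R (\<alpha> 1 + \<alpha> 6))"
  have four: "i = 1 \<or> i = 2 \<or> i = 3 \<or> i = 4" if "i \<in> {1..4}" for i :: nat using that by auto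
  have dual: "\<delta> i \<bullet> lam (if k = 1 then 2 else if k = 2 then 4 else if k = 3 then 3 else 1) = 0 \<longleftrightarrow> i \<noteq> k"
    if "i \<in> {1..4}" "k \<in> {1..4}" for i k
  proof -
    have "m \<in> {1..l}" if "1 \<le> m" "m \<le> 6" for m using that l by simp
    note lam' = lam[OF this]
    show ?thesis
      using four[OF that(1)] four[OF that(2)] by (elim disjE) (simp_all add: \<delta>_def inner_add_left lam')
  qed
  have S: "Suc ` set [0..<7] = {1..l}" "Suc ` set [0..<6] = {1..l} - {7}"
    by (auto simp: l image_iff Suc_le_eq gr0_conv_Suc) (presburger+)?
  note js = omega_word[OF C len(1) longest_lists(4) S(1) longest_lists(5) S(2)]
  show ?thesis
  proof (rule has_type_folded[OF C len(1) root_lists(4) js(2,1) average_lists(3) _ _ _ _ _ _ cartan_lists(2) len(2) _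
        root_lists(2) _ independent_if_dual(2,1)[OF dual] image_lists(2)])
    fix m :: nat assume "m < 4"
    then have "m = 0 \<or> m = 1 \<or> m = 2 \<or> m = 3" by auto
    then show "real 2 *\<^sub>R \<delta> (Suc m) = lvec \<alpha> (E7_basis ! m)"
      by (auto simp: \<delta>_def lvec_def E7_basis_def lessThan_Suc eval_nat_numeral One_nat_def algebra_simps)
  next
    fix i k :: nat assume "i \<in> {1..4}" "k \<in> {1..4}"
    then show "cartan_number (\<delta> i) (\<delta> k) = of_int (cartan_matrix Type_F4 i k)"
      using four[of i] four[of k] c
      by (auto simp: \<delta>_def cartan_number_def inner_add_left inner_add_right gram simply_laced_def)
  qed (auto simp: E7_fold_def E7_basis_def l)
qed

end

section \<open>Realization of Bourbaki bases\<close>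

lemma has_type_B1: "has_type V R (Type_B 1) \<Longrightarrow> has_type V R (Type_A 1)"
  by (simp add: has_type_def bourbaki_basis_def)

lemma refl_group_reindex: "refl_group (\<lambda>i. \<alpha> (\<pi> i)) S = refl_group \<alpha> (\<pi> ` S)"
  and refl_length_reindex: "refl_length (\<lambda>i. \<alpha> (\<pi> i)) S = refl_length \<alpha> (\<pi> ` S)"
proof -
  have *: "(\<exists>is. set is \<subseteq> S \<and> Q (map \<pi> is)) \<longleftrightarrow> (\<exists>is. set is \<subseteq> \<pi> ` S \<and> Q is)" for Q
  proof
    assume "\<exists>is. set is \<subseteq> \<pi> ` S \<and> Q is"
    then obtain "is" where "is \<in> lists (\<pi> ` S)" "Q is" by (auto simp: in_lists_conv_set)
    then show "\<exists>is. set is \<subseteq> S \<and> Q (map \<pi> is)"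
      unfolding lists_image by (auto simp: in_lists_conv_set)
  qed (metis image_mono set_map)
  show "refl_group (\<lambda>i. \<alpha> (\<pi> i)) S = refl_group \<alpha> (\<pi> ` S)"
    unfolding set_eq_iff refl_group_iff refl_word_reindex using *[of "\<lambda>is. _ = refl_word \<alpha> is"] by blast
  show "refl_length (\<lambda>i. \<alpha> (\<pi> i)) S = refl_length \<alpha> (\<pi> ` S)"
  proof
    fix w
    have "(\<exists>is. set is \<subseteq> S \<and> length is = n \<and> refl_word \<alpha> (map \<pi> is) = w) \<longleftrightarrow>
        (\<exists>is. set is \<subseteq> \<pi> ` S \<and> length is = n \<and> refl_word \<alpha> is = w)" for n
      using *[of "\<lambda>is. length is = n \<and> refl_word \<alpha> is = w"] by simp
    then show "refl_length (\<lambda>i. \<alpha> (\<pi> i)) S w = refl_length \<alpha> (\<pi> ` S) w"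
      unfolding refl_length_def refl_word_reindex by simp
  qed
qed

lemma longest_element_reindex: "longest_element (\<lambda>i. \<alpha> (\<pi> i)) S = longest_element \<alpha> (\<pi> ` S)"
  unfolding longest_element_def refl_group_reindex refl_length_reindex ..

lemma root_basis_reindex:
  assumes "root_basis V R l \<alpha>" and \<pi>: "bij_betw \<pi> {1..l} {1..l}"
  shows "root_basis V R l (\<lambda>i. \<alpha> (\<pi> i))"
proof -
  have im: "(\<lambda>i. \<alpha> (\<pi> i)) ` {1..l} = \<alpha> ` {1..l}"
    using bij_betw_imp_surj_on[OF \<pi>] by (metis image_image)
  have sum: "(\<Sum>i=1..l. real (c i) *\<^sub>R \<alpha> i) = (\<Sum>i=1..l. real (c (\<pi> i)) *\<^sub>R \<alpha> (\<pi> i))" for c :: "nat \<Rightarrow> nat"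
    by (rule sum.reindex_bij_betw[OF \<pi>, symmetric])
  have inj: "inj_on (\<lambda>i. \<alpha> (\<pi> i)) {1..l}"
    using assms(1) comp_inj_on[of \<pi> "{1..l}" \<alpha>] bij_betw_imp_inj_on[OF \<pi>] bij_betw_imp_surj_on[OF \<pi>]
    by (simp add: root_basis_def comp_def)
  have comb: "\<exists>c :: nat \<Rightarrow> nat. \<beta> = (\<Sum>i=1..l. real (c i) *\<^sub>R \<alpha> (\<pi> i)) \<or> \<beta> = - (\<Sum>i=1..l. real (c i) *\<^sub>R \<alpha> (\<pi> i))"
    if "\<beta> \<in> R" for \<beta>
  proof -
    obtain c :: "nat \<Rightarrow> nat" where
      "\<beta> = (\<Sum>i=1..l. real (c i) *\<^sub>R \<alpha> i) \<or> \<beta> = - (\<Sum>i=1..l. real (c i) *\<^sub>R \<alpha> i)"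
      using assms(1) \<open>\<beta> \<in> R\<close> unfolding root_basis_def by blast
    then show ?thesis unfolding sum by (intro exI[of _ "\<lambda>i. c (\<pi> i)"])
  qed
  show ?thesis
    using assms(1) inj comb unfolding root_basis_def im by blast
qed

lemma root_basis_dim: "root_basis (UNIV :: 'a::euclidean_space set) R l \<alpha> \<Longrightarrow> l = DIM('a)"
proof -
  assume b: "root_basis (UNIV :: 'a set) R l \<alpha>"
  then have "card (\<alpha> ` {1..l}) = dim (UNIV :: 'a set)"
    unfolding root_basis_def by (metis dim_eq_card_independent dim_span)
  moreover have "card (\<alpha> ` {1..l}) = l" using b by (simp add: root_basis_def card_image)
  ultimately show ?thesis by simp
qed

text \<open>This diagram automorphism reduces the case \<open>j = l - 1\<close> in type \<open>D\<close> to \<open>j = l\<close>.\<close>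

definition swap_last :: "nat \<Rightarrow> nat \<Rightarrow> nat" where
  "swap_last l i = (if i = l - 1 then l else if i = l then l - 1 else i)"

lemma cartan_matrix_swap:
  assumes "3 \<le> l" "i \<le> l" "k \<le> l"
  shows "cartan_matrix (Type_D l) (swap_last l i) (swap_last l k) = cartan_matrix (Type_D l) i k"
proof -
  obtain m where m: "l = Suc (Suc m)" "0 < m" using assms(1) by (cases l; cases "l - 1") auto
  have s: "swap_last l (Suc m) = l" "swap_last l l = Suc m" "x < Suc m \<Longrightarrow> swap_last l x = x" for x
    by (auto simp: swap_last_def m)
  have "i = Suc m \<or> i = l \<or> i < Suc m" "k = Suc m \<or> k = l \<or> k < Suc m" using assms m by auto
  then show ?thesis
    by (elim disjE) (simp_all add: s simply_laced_def, simp_all add: m)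
qed
lemma bourbaki_cartan:
  assumes "bourbaki_basis V R X \<alpha>" "l = dynkin_rank X" "i \<in> {1..l}" "k \<in> {1..l}"
  shows "cartan_number (\<alpha> i) (\<alpha> k) = of_int (cartan_matrix X i k)"
  using assms by (simp add: bourbaki_basis_def)

context rbase
begin

lemma type_A_realization:
  assumes "bourbaki_basis UNIV \<Phi> (Type_A l) \<alpha>" and "1 \<le> l"
  obtains e c d where "type_A \<Phi> \<alpha> l e c d"
proof -
  note cartan = bourbaki_cartan[OF assms(1), of l]
  have norm: "\<alpha> k \<bullet> \<alpha> k = \<alpha> 1 \<bullet> \<alpha> 1" if "k \<in> {1..l}" for k
    by (rule chain_norms[of l]) (use that cartan in \<open>auto simp: simply_laced_def\<close>)
  have "\<alpha> 1 \<bullet> \<alpha> 1 > 0" using simple_nonzero[of 1] assms(2) by simp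
  moreover have "\<alpha> i \<bullet> \<alpha> k = \<alpha> 1 \<bullet> \<alpha> 1 / 2 * of_int (chain i k)" if "i \<in> {1..l}" "k \<in> {1..l}" for i k
    using inner_eq_cartan[OF simple_nonzero[OF that(2)], of "\<alpha> i"] cartan[OF _ that] norm[OF that(2)] by simp
  ultimately show ?thesis
    using simplex_realization[OF indep_simple inj_simple span_simple, of "\<alpha> 1 \<bullet> \<alpha> 1 / 2"]
      that type_A.intro[OF rbase_axioms type_A_axioms.intro] assms(2)
    by (metis half_gt_zero)
qed

lemma classical_realization:
  assumes l: "2 \<le> l" and st: "s + t \<noteq> 0"
    and cartan: "\<And>i k. i \<in> {1..<l} \<Longrightarrow> k \<in> {1..<l} \<Longrightarrow> cartan_number (\<alpha> i) (\<alpha> k) = of_int (chain i k)"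
    and last: "\<And>i. i \<in> {1..<l} \<Longrightarrow> cartan_number (\<alpha> i) (\<alpha> l) * (s\<^sup>2 + t\<^sup>2) =
      2 * ((if Suc i = l then t - s else 0) - (if i + 2 = l then t else 0))"
    and norm: "2 * (\<alpha> l \<bullet> \<alpha> l) = (\<alpha> (l - 1) \<bullet> \<alpha> (l - 1)) * (s\<^sup>2 + t\<^sup>2)"
    and z: "\<And>e. s *\<^sub>R e l + t *\<^sub>R e (l - 1) \<in> rsums cond_BC (e :: nat \<Rightarrow> 'a) l"
  obtains e c where "classical \<Phi> \<alpha> l e c (s *\<^sub>R e l + t *\<^sub>R e (l - 1))"
proof -
  define c where "c = \<alpha> 1 \<bullet> \<alpha> 1 / 2"
  have c: "c > 0" using simple_nonzero[of 1] l by (simp add: c_def)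
  have norms: "\<alpha> k \<bullet> \<alpha> k = 2 * c" if "k \<in> {1..<l}" for k
  proof -
    have "\<alpha> k \<bullet> \<alpha> k = \<alpha> 1 \<bullet> \<alpha> 1"
      by (rule chain_norms[of "l - 1"]) (use that cartan in \<open>auto simp: simply_laced_def\<close>)
    then show ?thesis by (simp add: c_def)
  qed
  have nl: "\<alpha> l \<bullet> \<alpha> l = c * (s\<^sup>2 + t\<^sup>2)" using norm norms[of "l - 1"] l by simp
  have gram1: "\<alpha> i \<bullet> \<alpha> k = c * of_int (chain i k)" if "i \<in> {1..<l}" "k \<in> {1..<l}" for i k
    using inner_eq_cartan[OF simple_nonzero, of k "\<alpha> i"] cartan[OF that] norms[OF that(2)] that by simp
  have gram2: "\<alpha> i \<bullet> \<alpha> l = c * ((if Suc i = l then t - s else 0) - (if i + 2 = l then t else 0))"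
    if "i \<in> {1..<l}" for i
  proof -
    have "\<alpha> i \<bullet> \<alpha> l = c * (cartan_number (\<alpha> i) (\<alpha> l) * (s\<^sup>2 + t\<^sup>2)) / 2"
      using inner_eq_cartan[OF simple_nonzero, of l "\<alpha> i"] l by (simp add: nl)
    moreover have "c * (2 * x) / 2 = c * x" for x :: real by simp
    ultimately show ?thesis unfolding last[OF that] by (simp only:)
  qed
  obtain e where "orthogonal_family e l c"
    "\<And>i. i \<in> {1..l} \<Longrightarrow> \<alpha> i = chain_system e (s *\<^sub>R e l + t *\<^sub>R e (l - 1)) l i"
    using orthogonal_realization[OF indep_simple inj_simple span_simple c l st gram1 gram2 nl] by blast
  then have "classical \<Phi> \<alpha> l e c (s *\<^sub>R e l + t *\<^sub>R e (l - 1))"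
    using classical.intro[OF rbase_axioms classical_axioms.intro] z l by blast
  then show ?thesis by (rule that)
qed

lemma type_BC_realization:
  assumes sX: "s = 1 \<and> X = Type_B l \<or> s = 2 \<and> X = Type_C l"
    and X: "bourbaki_basis UNIV \<Phi> X \<alpha>" and l: "2 \<le> l"
  obtains (realization) e c where "classical \<Phi> \<alpha> l e c (s *\<^sub>R e l)"
proof (rule classical_realization[of s 0, OF l])
  have cartan: "cartan_number (\<alpha> i) (\<alpha> k) = of_int (cartan_matrix X i k)" if "i \<in> {1..l}" "k \<in> {1..l}" for i k
    using bourbaki_cartan[OF X _ that] sX by auto
  show "cartan_number (\<alpha> i) (\<alpha> k) = of_int (chain i k)" if "i \<in> {1..<l}" "k \<in> {1..<l}" for i k
    using cartan[of i k] that sX by auto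
  show "cartan_number (\<alpha> i) (\<alpha> l) * (s\<^sup>2 + 0\<^sup>2) = 2 * ((if Suc i = l then 0 - s else 0) - (if i + 2 = l then 0 else 0))"
    if "i \<in> {1..<l}" for i
    using cartan[of i l] that sX by (auto simp: simply_laced_def)
  define m where "m = l - 1"
  have m: "l = Suc m" "m \<in> {1..l}" "l \<in> {1..l}" using l by (auto simp: m_def)
  have "cartan_number (\<alpha> m) (\<alpha> l) * s = -2" "cartan_number (\<alpha> l) (\<alpha> m) = - s"
    using cartan[OF m(2,3)] cartan[OF m(3,2)] sX by (auto simp: m(1) simply_laced_def)
  moreover have "(\<alpha> m \<bullet> \<alpha> l) * s = cartan_number (\<alpha> m) (\<alpha> l) * s * (\<alpha> l \<bullet> \<alpha> l) / 2"
    by (subst inner_eq_cartan[OF simple_nonzero[OF m(3)], of "\<alpha> m"]) (simp add: algebra_simps)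
  ultimately have "(\<alpha> m \<bullet> \<alpha> l) * s = - (\<alpha> l \<bullet> \<alpha> l)" by simp
  moreover have "\<alpha> m \<bullet> \<alpha> l = - s * (\<alpha> m \<bullet> \<alpha> m) / 2"
    using inner_eq_cartan[OF simple_nonzero[OF m(2)], of "\<alpha> l"] \<open>cartan_number (\<alpha> l) (\<alpha> m) = - s\<close>
    by (simp add: inner_commute)
  ultimately have "- s * (\<alpha> m \<bullet> \<alpha> m) / 2 * s = - (\<alpha> l \<bullet> \<alpha> l)" by simp
  then show "2 * (\<alpha> l \<bullet> \<alpha> l) = \<alpha> (l - 1) \<bullet> \<alpha> (l - 1) * (s\<^sup>2 + 0\<^sup>2)"
    by (simp add: power2_eq_square m_def algebra_simps)
  show "s *\<^sub>R e l + 0 *\<^sub>R e (l - 1) \<in> rsums cond_BC e l" for e :: "nat \<Rightarrow> 'a"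
    using l sX by (auto simp: cond_BC_def sg_int scaleR_2
      intro: rsumsI[of _ "int l" 0] rsumsI[of _ "int l" "int l"])
  show thesis if "classical \<Phi> \<alpha> l e c (s *\<^sub>R e l + 0 *\<^sub>R e (l - 1))" for e c
    using that realization by simp
qed (use sX in auto)

lemma type_D_realization:
  assumes "\<forall>i\<in>{1..l}. \<forall>k\<in>{1..l}. cartan_number (\<alpha> i) (\<alpha> k) = of_int (cartan_matrix (Type_D l) i k)"
    and l: "3 \<le> l"
  obtains e c z where "type_D \<Phi> \<alpha> l e c z"
proof (rule classical_realization[of 1 1])
  have cartan: "cartan_number (\<alpha> i) (\<alpha> k) = of_int (cartan_matrix (Type_D l) i k)"
    if "i \<in> {1..l}" "k \<in> {1..l}" for i k
    using assms(1) that by blast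
  show "cartan_number (\<alpha> i) (\<alpha> k) = of_int (chain i k)" if "i \<in> {1..<l}" "k \<in> {1..<l}" for i k
    using cartan[of i k] that by (auto simp: simply_laced_def)
  show "cartan_number (\<alpha> i) (\<alpha> l) * (1\<^sup>2 + 1\<^sup>2) = 2 * ((if Suc i = l then 1 - 1 else 0) - (if i + 2 = l then 1 else 0))"
    if "i \<in> {1..<l}" for i
    using cartan[of i l] that by (auto simp: simply_laced_def)
  define m where "m = l - 2"
  have m: "l = Suc (Suc m)" "m \<in> {1..l}" "Suc m \<in> {1..l}" "l \<in> {1..l}" using l by (auto simp: m_def)
  have "\<alpha> m \<bullet> \<alpha> m = \<alpha> l \<bullet> \<alpha> l"
    by (rule equal_norms) (use cartan[OF m(2,4)] cartan[OF m(4,2)] in \<open>simp_all add: m(1) simply_laced_def\<close>)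
  moreover have "\<alpha> m \<bullet> \<alpha> m = \<alpha> (Suc m) \<bullet> \<alpha> (Suc m)"
    by (rule equal_norms) (use cartan[OF m(2,3)] cartan[OF m(3,2)] in \<open>simp_all add: m(1) simply_laced_def\<close>)
  moreover have "l - 1 = Suc m" using m(1) by simp
  ultimately show "2 * (\<alpha> l \<bullet> \<alpha> l) = \<alpha> (l - 1) \<bullet> \<alpha> (l - 1) * (1\<^sup>2 + 1\<^sup>2)" by simp
  show "1 *\<^sub>R e l + 1 *\<^sub>R e (l - 1) \<in> rsums cond_BC e l" for e :: "nat \<Rightarrow> 'a"
    using l by (intro rsumsI[of _ "int l" "int (l - 1)"]) (auto simp: cond_BC_def sg_int simp del: of_nat_diff)
  show thesis if "classical \<Phi> \<alpha> l e c (1 *\<^sub>R e l + 1 *\<^sub>R e (l - 1))" for e c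
  proof -
    have "classical \<Phi> \<alpha> l e c (e (l - 1) + e l)" using that by (simp add: add.commute)
    then show thesis
      using \<open>\<And>e c z. type_D \<Phi> \<alpha> l e c z \<Longrightarrow> thesis\<close> type_D.intro type_D_axioms.intro l by blast
  qed
qed (use l in simp_all)

lemma type_D_swap:
  assumes D: "bourbaki_basis UNIV \<Phi> (Type_D l) \<alpha>" and l: "3 \<le> l"
  obtains \<beta> e c z where "type_D \<Phi> \<beta> l e c z" "omega_elt l \<alpha> (l - 1) = omega_elt l \<beta> l"
proof -
  define \<pi> where "\<pi> = swap_last l"
  let ?\<beta> = "\<lambda>i. \<alpha> (\<pi> i)"
  have inv: "\<pi> (\<pi> i) = i" for i using l by (auto simp: \<pi>_def swap_last_def)
  have ran: "\<pi> i \<in> {1..l} \<longleftrightarrow> i \<in> {1..l}" for i using l by (auto simp: \<pi>_def swap_last_def)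
  have im: "\<pi> ` S = {i. \<pi> i \<in> S}" for S by (force simp: inv image_iff intro: inv[symmetric])
  have bij: "bij_betw \<pi> {1..l} {1..l}"
    by (rule bij_betwI[of _ _ _ \<pi>]) (use ran inv in auto)
  have "rbase \<Phi> ?\<beta> l"
    by (rule rbase.intro[OF rs red root_basis_reindex[OF base bij]])
  moreover have "\<forall>i\<in>{1..l}. \<forall>k\<in>{1..l}. cartan_number (?\<beta> i) (?\<beta> k) = of_int (cartan_matrix (Type_D l) i k)"
  proof (intro ballI)
    fix i k assume ik: "i \<in> {1..l}" "k \<in> {1..l}"
    have "cartan_matrix (Type_D l) (\<pi> i) (\<pi> k) = cartan_matrix (Type_D l) i k"
      unfolding \<pi>_def using ik l by (intro cartan_matrix_swap) auto
    then show "cartan_number (?\<beta> i) (?\<beta> k) = of_int (cartan_matrix (Type_D l) i k)"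
      using bourbaki_cartan[OF D, of l "\<pi> i" "\<pi> k"] ran ik by simp
  qed
  ultimately obtain e c z where "type_D \<Phi> ?\<beta> l e c z"
    using rbase.type_D_realization[of \<Phi> ?\<beta> l] l by blast
  moreover have "omega_elt l \<alpha> (l - 1) = omega_elt l ?\<beta> l"
  proof -
    have "\<pi> ` ({1..l} - {l}) = {1..l} - {l - 1}" "\<pi> ` ({1..l} - {0}) = {1..l} - {0}"
      unfolding im using l by (auto simp: \<pi>_def swap_last_def split: if_splits)
    then show ?thesis unfolding omega_elt_def w_elt_def longest_element_reindex by simp
  qed
  ultimately show ?thesis by (rule that)
qed

end

theorem theorem4p7:
  fixes \<Phi> :: "'a::euclidean_space set"
    and \<alpha> :: "nat \<Rightarrow> 'a"
    and \<theta> :: 'a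
    and \<omega> :: "'a \<Rightarrow> 'a"
    and n :: "nat \<Rightarrow> nat"
    and l j :: nat
  assumes "root_system UNIV \<Phi>" and "reduced_rs \<Phi>" and "irreducible_rs \<Phi>"
    and "root_basis UNIV \<Phi> l \<alpha>"
    and "highest_root \<Phi> l \<alpha> \<theta>"
    and "\<theta> = (\<Sum>i=1..l. real (n i) *\<^sub>R \<alpha> i)" and "n 0 = 1"
    and "j \<in> {i \<in> {0..l}. n i = 1} - {0}"
    and "\<omega> = omega_elt l \<alpha> j"
  shows
    "(bourbaki_basis UNIV \<Phi> (Type_A l) \<alpha> \<and> l \<ge> 1 \<and> gcd (l + 1) j = 1 \<longrightarrow>
        Phi_re \<omega> \<Phi> = {} \<and> root_system (fixed_space \<omega>) (Phi_re \<omega> \<Phi>)) \<and>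
     (bourbaki_basis UNIV \<Phi> (Type_A l) \<alpha> \<and> l \<ge> 1 \<and> gcd (l + 1) j \<noteq> 1 \<longrightarrow>
        has_type (fixed_space \<omega>) (Phi_re \<omega> \<Phi>) (Type_A (gcd (l + 1) j - 1))) \<and>
     (bourbaki_basis UNIV \<Phi> (Type_B l) \<alpha> \<and> l = 2 \<and> j = 1 \<longrightarrow>
        has_type (fixed_space \<omega>) (Phi_re \<omega> \<Phi>) (Type_A 1)) \<and>
     (bourbaki_basis UNIV \<Phi> (Type_B l) \<alpha> \<and> l \<ge> 3 \<and> j = 1 \<longrightarrow>
        has_type (fixed_space \<omega>) (Phi_re \<omega> \<Phi>) (Type_B (l - 1))) \<and>
     (bourbaki_basis UNIV \<Phi> (Type_C l) \<alpha> \<and> l \<ge> 3 \<and> odd l \<and> j = l \<longrightarrow>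
        has_type_BC (fixed_space \<omega>) (Phi_re \<omega> \<Phi>) ((l - 1) div 2)) \<and>
     (bourbaki_basis UNIV \<Phi> (Type_C l) \<alpha> \<and> l \<ge> 4 \<and> even l \<and> j = l \<longrightarrow>
        has_type (fixed_space \<omega>) (Phi_re \<omega> \<Phi>) (Type_C (l div 2))) \<and>
     (bourbaki_basis UNIV \<Phi> (Type_D l) \<alpha> \<and> l \<ge> 4 \<and> j = 1 \<longrightarrow>
        has_type (fixed_space \<omega>) (Phi_re \<omega> \<Phi>) (Type_B (l - 2))) \<and>
     (bourbaki_basis UNIV \<Phi> (Type_D l) \<alpha> \<and> l \<ge> 4 \<and> even l \<and> j \<in> {l - 1, l} \<longrightarrow>
        has_type (fixed_space \<omega>) (Phi_re \<omega> \<Phi>) (Type_C (l div 2))) \<and>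
     (bourbaki_basis UNIV \<Phi> (Type_D l) \<alpha> \<and> l \<ge> 5 \<and> odd l \<and> j \<in> {l - 1, l} \<longrightarrow>
        has_type_BC (fixed_space \<omega>) (Phi_re \<omega> \<Phi>) ((l - 3) div 2)) \<and>
     (bourbaki_basis UNIV \<Phi> (Type_E 6) \<alpha> \<and> j \<in> {1, 6} \<longrightarrow>
        has_type (fixed_space \<omega>) (Phi_re \<omega> \<Phi>) Type_G2) \<and>
     (bourbaki_basis UNIV \<Phi> (Type_E 7) \<alpha> \<and> j = 7 \<longrightarrow>
        has_type (fixed_space \<omega>) (Phi_re \<omega> \<Phi>) Type_F4)"
proof -
  interpret rbase \<Phi> \<alpha> l
    using assms(1,2,4) by (rule rbase.intro)
  have j: "1 \<le> j" "j \<le> l" using assms(8) by auto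
  have A: "(gcd (l + 1) j = 1 \<longrightarrow> Phi_re \<omega> \<Phi> = {} \<and> root_system (fixed_space \<omega>) (Phi_re \<omega> \<Phi>)) \<and>
      (gcd (l + 1) j \<noteq> 1 \<longrightarrow> has_type (fixed_space \<omega>) (Phi_re \<omega> \<Phi>) (Type_A (gcd (l + 1) j - 1)))"
    if A: "bourbaki_basis UNIV \<Phi> (Type_A l) \<alpha>" "l \<ge> 1"
  proof -
    obtain e c d where A: "type_A \<Phi> \<alpha> l e c d" using type_A_realization[OF A] by blast
    show ?thesis
      unfolding assms(9) using type_A.type_A_omega[OF A j] by (intro conjI impI)
  qed
  have B: "has_type (fixed_space \<omega>) (Phi_re \<omega> \<Phi>) (Type_B (l - 1))"
    if B: "bourbaki_basis UNIV \<Phi> (Type_B l) \<alpha>" "l \<ge> 2" "j = 1"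
  proof -
    obtain e c where "classical \<Phi> \<alpha> l e c (1 *\<^sub>R e l)"
      using type_BC_realization[of 1 "Type_B l"] B(1,2) by blast
    then have "classical \<Phi> \<alpha> l e c (e l)" by simp
    from classical.type_B_first[OF this refl] show ?thesis unfolding assms(9) B(3) .
  qed
  have C: "(even l \<longrightarrow> has_type (fixed_space \<omega>) (Phi_re \<omega> \<Phi>) (Type_C (l div 2))) \<and>
      (odd l \<longrightarrow> has_type_BC (fixed_space \<omega>) (Phi_re \<omega> \<Phi>) ((l - 1) div 2))"
    if C: "bourbaki_basis UNIV \<Phi> (Type_C l) \<alpha>" "l \<ge> 2" "j = l"
  proof -
    obtain e c where "classical \<Phi> \<alpha> l e c (2 *\<^sub>R e l)" using type_BC_realization[of 2 "Type_C l"] C(1,2) by blast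
    from classical.type_C_last[OF this refl] show ?thesis unfolding assms(9) C(3) by blast
  qed
  have type_D_obtain: "\<exists>e c z. type_D \<Phi> \<alpha> l e c z" if D: "bourbaki_basis UNIV \<Phi> (Type_D l) \<alpha>" "l \<ge> 4"
  proof -
    have "\<forall>i\<in>{1..l}. \<forall>k\<in>{1..l}. cartan_number (\<alpha> i) (\<alpha> k) = of_int (cartan_matrix (Type_D l) i k)"
      using bourbaki_cartan[OF D(1)] by simp
    moreover have "3 \<le> l" using D(2) by simp
    ultimately show ?thesis using type_D_realization by metis
  qed
  have D1: "has_type (fixed_space \<omega>) (Phi_re \<omega> \<Phi>) (Type_B (l - 2))"
    if D: "bourbaki_basis UNIV \<Phi> (Type_D l) \<alpha>" "l \<ge> 4" "j = 1"
  proof -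
    obtain e c z where "type_D \<Phi> \<alpha> l e c z" using type_D_obtain D(1,2) by blast
    from type_D.type_D_first[OF this] show ?thesis unfolding assms(9) D(3) .
  qed
  have D2: "(even l \<longrightarrow> has_type (fixed_space \<omega>) (Phi_re \<omega> \<Phi>) (Type_C (l div 2))) \<and>
      (odd l \<longrightarrow> l \<ge> 5 \<longrightarrow> has_type_BC (fixed_space \<omega>) (Phi_re \<omega> \<Phi>) ((l - 3) div 2))"
    if D: "bourbaki_basis UNIV \<Phi> (Type_D l) \<alpha>" "l \<ge> 4" "j \<in> {l - 1, l}"
  proof -
    obtain \<beta> e c z where \<beta>: "type_D \<Phi> \<beta> l e c z" "omega_elt l \<alpha> j = omega_elt l \<beta> l"
    proof (cases "j = l")
      case True
      obtain e c z where "type_D \<Phi> \<alpha> l e c z" using type_D_obtain D(1,2) by blast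
      then show ?thesis using that True by blast
    next
      case False
      then have jl: "j = l - 1" using D(3) by simp
      have "3 \<le> l" using D(2) by simp
      from type_D_swap[OF D(1) this] show ?thesis
        using that unfolding jl by metis
    qed
    then show ?thesis
      using type_D.type_D_last_even[OF \<beta>(1)] type_D.type_D_last_odd[OF \<beta>(1)]
      unfolding assms(9) by simp
  qed
  have E6: "has_type (fixed_space \<omega>) (Phi_re \<omega> \<Phi>) Type_G2"
    if E: "bourbaki_basis UNIV \<Phi> (Type_E 6) \<alpha>" "j \<in> {1, 6}"
  proof -
    have "root_basis UNIV \<Phi> 6 \<alpha>" using E(1) by (simp add: bourbaki_basis_def)
    then have "l = 6" using root_basis_dim assms(4) by metis
    then show ?thesis
      unfolding assms(9) by (rule type_E6) (use E in \<open>auto simp: bourbaki_basis_def\<close>)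
  qed
  have E7: "has_type (fixed_space \<omega>) (Phi_re \<omega> \<Phi>) Type_F4"
    if E: "bourbaki_basis UNIV \<Phi> (Type_E 7) \<alpha>" "j = 7"
  proof -
    have "root_basis UNIV \<Phi> 7 \<alpha>" using E(1) by (simp add: bourbaki_basis_def)
    then have "l = 7" using root_basis_dim assms(4) by metis
    then show ?thesis
      unfolding assms(9) E(2) by (rule type_E7) (use E in \<open>auto simp: bourbaki_basis_def\<close>)
  qed
  have B2: "has_type (fixed_space \<omega>) (Phi_re \<omega> \<Phi>) (Type_A 1)"
    if "bourbaki_basis UNIV \<Phi> (Type_B l) \<alpha>" "l = 2" "j = 1"
  proof (rule has_type_B1)
    have "l - 1 = 1" "2 \<le> l" using that(2) by linarith+
    then show "has_type (fixed_space \<omega>) (Phi_re \<omega> \<Phi>) (Type_B 1)"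
      using B[OF that(1) _ that(3)] by (simp only:)
  qed
  have le: "2 \<le> l" if "3 \<le> l \<or> 4 \<le> l" using that by linarith
  show ?thesis
  proof (intro conjI impI; elim conjE)
    assume h: "bourbaki_basis UNIV \<Phi> (Type_A l) \<alpha>" "1 \<le> l"
    show "Phi_re \<omega> \<Phi> = {}" "root_system (fixed_space \<omega>) (Phi_re \<omega> \<Phi>)" if "gcd (l + 1) j = 1"
      using A[OF h, THEN conjunct1, THEN mp, OF that] by (rule conjunct1, rule conjunct2)
    show "has_type (fixed_space \<omega>) (Phi_re \<omega> \<Phi>) (Type_A (gcd (l + 1) j - 1))" if "gcd (l + 1) j \<noteq> 1"
      using A[OF h, THEN conjunct2, THEN mp, OF that] .
  next
    assume "bourbaki_basis UNIV \<Phi> (Type_B l) \<alpha>" "l = 2" "j = 1"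
    then show "has_type (fixed_space \<omega>) (Phi_re \<omega> \<Phi>) (Type_A 1)" by (rule B2)
  next
    assume "bourbaki_basis UNIV \<Phi> (Type_B l) \<alpha>" "3 \<le> l" "j = 1"
    then show "has_type (fixed_space \<omega>) (Phi_re \<omega> \<Phi>) (Type_B (l - 1))" using B le by blast
  next
    assume "bourbaki_basis UNIV \<Phi> (Type_C l) \<alpha>" "3 \<le> l" "odd l" "j = l"
    then show "has_type_BC (fixed_space \<omega>) (Phi_re \<omega> \<Phi>) ((l - 1) div 2)" using C le by blast
  next
    assume "bourbaki_basis UNIV \<Phi> (Type_C l) \<alpha>" "4 \<le> l" "even l" "j = l"
    then show "has_type (fixed_space \<omega>) (Phi_re \<omega> \<Phi>) (Type_C (l div 2))" using C le by blast
  next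
    assume "bourbaki_basis UNIV \<Phi> (Type_D l) \<alpha>" "4 \<le> l" "even l" "j \<in> {l - 1, l}"
    then show "has_type (fixed_space \<omega>) (Phi_re \<omega> \<Phi>) (Type_C (l div 2))" using D2 by blast
  next
    assume h: "bourbaki_basis UNIV \<Phi> (Type_D l) \<alpha>" "5 \<le> l" "odd l" "j \<in> {l - 1, l}"
    then have "4 \<le> l" by linarith
    with h show "has_type_BC (fixed_space \<omega>) (Phi_re \<omega> \<Phi>) ((l - 3) div 2)" using D2 by blast
  qed (fact D1 E6 E7)+
qed

end
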